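(* For every $\Sigma$-semiring $R$, the category $\mathbf{Mod}_R$ of $R$-modules and $R$-linear maps is locally $\aleph_1$-presentable.
   Context: Conventions: $e\sqsubseteq e'$ means "if $e$ is defined then so is $e'$ and they are equal"; $e\simeq e'$ means both directions. A $\Sigma$-monoid is a set with $0$ and a partial operation $\sum:|M|^\omega\rightharpoonup|M|$ satisfying: (1) a family all of whose entries except $x_j$ are $0$ sums to $x_j$; (2) sums are invariant ($\simeq$) under bijective reindexing after discarding zero entries; (3) $\sum_ix_i\simeq\sum_j\sum_kx_{\sigma(j,k)}$ for every bijection $\sigma:\omega\times\omega\to\omega$. A $\Sigma$-semiring $R$ is a $\Sigma$-monoid with a total associative commutative multiplication with unit $1$ such that $0x=0$ and $(\sum_ix_i)(\sum_jy_j)\sqsubseteq\sum_{i,j}x_iy_j$. An $R$-module is a $\Sigma$-monoid $M$ with a total action $R\times M\to M$ with $(rr')x=r(r'x)$, $1x=x$, $0x=r0=0$, $(\sum_ir_i)(\sum_jx_j)\sqsubseteq\sum_{i,j}r_ix_j$. An $R$-linear map $f$ satisfies $f(0)=0$, $f(\sum_ix_i)\sqsubseteq\sum_if(x_i)$ and $f(rx)=rf(x)$. *)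

theory Defs
  imports "HOL-Library.FuncSet" "HOL-Library.Nat_Bijection"
begin

unbundle cardinal_syntax

section \<open>Sigma-monoids, Sigma-semirings and their modules\<close>

text \<open>
  Partial operations take values in \<^typ>\<open>'a option\<close>, so that Kleene equality of two
  expressions is plain equality of their values in \<^typ>\<open>'a option\<close>.
\<close>

record 'a sigma_mon =
  carrier :: "'a set"
  zero :: "'a"
  Sums :: "(nat \<Rightarrow> 'a) \<Rightarrow> 'a option"

record 'a sigma_sring = "'a sigma_mon" +
  mult :: "'a \<Rightarrow> 'a \<Rightarrow> 'a"
  one :: "'a"

record ('r, 'a) rmod = "'a sigma_mon" +
  act :: "'r \<Rightarrow> 'a \<Rightarrow> 'a"

text \<open>
  Sums of families of partially defined expressions: undefined as soon as one of the entries is.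
\<close>

definition Sums_opt :: "('a, 'z) sigma_mon_scheme \<Rightarrow> (nat \<Rightarrow> 'a option) \<Rightarrow> 'a option" where
  "Sums_opt M e = (if \<forall>j. e j \<noteq> None then Sums M (\<lambda>j. the (e j)) else None)"

text \<open>
  Sums over \<open>\<omega> \<times> \<omega>\<close>. In a Sigma-monoid the choice of the bijection between \<open>\<omega>\<close> and
  \<open>\<omega> \<times> \<omega>\<close> does not matter, by invariance under reindexing.
\<close>

definition Sums2 :: "('a, 'z) sigma_mon_scheme \<Rightarrow> (nat \<Rightarrow> nat \<Rightarrow> 'a) \<Rightarrow> 'a option" where
  "Sums2 M x = Sums M (\<lambda>n. case prod_decode n of (i, j) \<Rightarrow> x i j)"

locale sigma_monoid =
  fixes M :: "('a, 'z) sigma_mon_scheme"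
  assumes zero_closed: "zero M \<in> carrier M"
    and Sums_closed: "\<And>x v. \<lbrakk>\<And>i. x i \<in> carrier M; Sums M x = Some v\<rbrakk> \<Longrightarrow> v \<in> carrier M"
    and Sums_single:
      "\<And>x j. \<lbrakk>\<And>i. x i \<in> carrier M; \<And>i. i \<noteq> j \<Longrightarrow> x i = zero M\<rbrakk> \<Longrightarrow> Sums M x = Some (x j)"
    and Sums_reindex:
      "\<And>x y \<sigma>. \<lbrakk>\<And>i. x i \<in> carrier M; \<And>i. y i \<in> carrier M;
          bij_betw \<sigma> {i. x i \<noteq> zero M} {j. y j \<noteq> zero M};
          \<And>i. x i \<noteq> zero M \<Longrightarrow> y (\<sigma> i) = x i\<rbrakk> \<Longrightarrow> Sums M x = Sums M y"
    and Sums_partition: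
      "\<And>x (\<sigma> :: nat \<times> nat \<Rightarrow> nat). \<lbrakk>\<And>i. x i \<in> carrier M; bij \<sigma>\<rbrakk> \<Longrightarrow>
          Sums M x = Sums_opt M (\<lambda>j. Sums M (\<lambda>k. x (\<sigma> (j, k))))"

locale sigma_semiring = sigma_monoid R for R :: "('r, 'z) sigma_sring_scheme" +
  assumes one_closed: "one R \<in> carrier R"
    and mult_closed: "\<And>x y. \<lbrakk>x \<in> carrier R; y \<in> carrier R\<rbrakk> \<Longrightarrow> mult R x y \<in> carrier R"
    and mult_assoc: "\<And>x y z. \<lbrakk>x \<in> carrier R; y \<in> carrier R; z \<in> carrier R\<rbrakk> \<Longrightarrow>
          mult R (mult R x y) z = mult R x (mult R y z)"
    and mult_comm: "\<And>x y. \<lbrakk>x \<in> carrier R; y \<in> carrier R\<rbrakk> \<Longrightarrow> mult R x y = mult R y x"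
    and mult_one: "\<And>x. x \<in> carrier R \<Longrightarrow> mult R (one R) x = x"
    and mult_zero: "\<And>x. x \<in> carrier R \<Longrightarrow> mult R (zero R) x = zero R"
    and mult_Sums: "\<And>x y v w. \<lbrakk>\<And>i. x i \<in> carrier R; \<And>j. y j \<in> carrier R;
          Sums R x = Some v; Sums R y = Some w\<rbrakk> \<Longrightarrow>
          Sums2 R (\<lambda>i j. mult R (x i) (y j)) = Some (mult R v w)"

locale r_module = R: sigma_semiring R + sigma_monoid M
  for R :: "('r, 'z) sigma_sring_scheme" and M :: "('r, 'a, 'y) rmod_scheme" +
  assumes act_closed: "\<And>r x. \<lbrakk>r \<in> carrier R; x \<in> carrier M\<rbrakk> \<Longrightarrow> act M r x \<in> carrier M"
    and act_mult: "\<And>r s x. \<lbrakk>r \<in> carrier R; s \<in> carrier R; x \<in> carrier M\<rbrakk> \<Longrightarrow>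
          act M (mult R r s) x = act M r (act M s x)"
    and act_one: "\<And>x. x \<in> carrier M \<Longrightarrow> act M (one R) x = x"
    and act_zero_left: "\<And>x. x \<in> carrier M \<Longrightarrow> act M (zero R) x = zero M"
    and act_zero_right: "\<And>r. r \<in> carrier R \<Longrightarrow> act M r (zero M) = zero M"
    and act_Sums: "\<And>r x v w. \<lbrakk>\<And>i. r i \<in> carrier R; \<And>j. x j \<in> carrier M;
          Sums R r = Some v; Sums M x = Some w\<rbrakk> \<Longrightarrow>
          Sums2 M (\<lambda>i j. act M (r i) (x j)) = Some (act M v w)"

text \<open>
  Maps are extensional on the carrier, so that equality of functions is equality of maps.
\<close>

definition linear_maps ::
  "('r, 'z) sigma_sring_scheme \<Rightarrow> ('r, 'a) rmod \<Rightarrow> ('r, 'b) rmod \<Rightarrow> ('a \<Rightarrow> 'b) set" where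
  "linear_maps R M N = {f \<in> carrier M \<rightarrow>\<^sub>E carrier N.
     f (zero M) = zero N \<and>
     (\<forall>x v. (\<forall>i. x i \<in> carrier M) \<and> Sums M x = Some v \<longrightarrow> Sums N (\<lambda>i. f (x i)) = Some (f v)) \<and>
     (\<forall>r\<in>carrier R. \<forall>x\<in>carrier M. f (act M r x) = act N r (f x))}"


section \<open>Categories, functors and colimits\<close>

text \<open>
  Hom-sets need not be disjoint, so composition is indexed by the three objects involved:
  \<open>Comp C a b c g f\<close> is the composite of \<open>f : a \<rightarrow> b\<close> and \<open>g : b \<rightarrow> c\<close>.
\<close>

record ('o, 'm) cat =
  Ob :: "'o set"
  Hom :: "'o \<Rightarrow> 'o \<Rightarrow> 'm set"
  Id :: "'o \<Rightarrow> 'm"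
  Comp :: "'o \<Rightarrow> 'o \<Rightarrow> 'o \<Rightarrow> 'm \<Rightarrow> 'm \<Rightarrow> 'm"

locale category =
  fixes C :: "('o, 'm) cat"
  assumes Id_closed: "\<And>a. a \<in> Ob C \<Longrightarrow> Id C a \<in> Hom C a a"
    and Comp_closed: "\<And>a b c f g. \<lbrakk>a \<in> Ob C; b \<in> Ob C; c \<in> Ob C; f \<in> Hom C a b; g \<in> Hom C b c\<rbrakk>
          \<Longrightarrow> Comp C a b c g f \<in> Hom C a c"
    and Comp_Id_right: "\<And>a b f. \<lbrakk>a \<in> Ob C; b \<in> Ob C; f \<in> Hom C a b\<rbrakk>
          \<Longrightarrow> Comp C a a b f (Id C a) = f"
    and Comp_Id_left: "\<And>a b f. \<lbrakk>a \<in> Ob C; b \<in> Ob C; f \<in> Hom C a b\<rbrakk>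
          \<Longrightarrow> Comp C a b b (Id C b) f = f"
    and Comp_assoc: "\<And>a b c d f g h.
          \<lbrakk>a \<in> Ob C; b \<in> Ob C; c \<in> Ob C; d \<in> Ob C;
            f \<in> Hom C a b; g \<in> Hom C b c; h \<in> Hom C c d\<rbrakk>
          \<Longrightarrow> Comp C a c d h (Comp C a b c g f) = Comp C a b d (Comp C b c d h g) f"

text \<open>\<open>Fm a b\<close> is the action of the functor on the morphisms from \<open>a\<close> to \<open>b\<close>.\<close>

definition is_functor ::
  "('j, 'k) cat \<Rightarrow> ('o, 'm) cat \<Rightarrow> ('j \<Rightarrow> 'o) \<Rightarrow> ('j \<Rightarrow> 'j \<Rightarrow> 'k \<Rightarrow> 'm) \<Rightarrow> bool" where
  "is_functor J C Fo Fm \<longleftrightarrow> category J \<and> category C \<and>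
     (\<forall>a\<in>Ob J. Fo a \<in> Ob C) \<and>
     (\<forall>a\<in>Ob J. \<forall>b\<in>Ob J. \<forall>f\<in>Hom J a b. Fm a b f \<in> Hom C (Fo a) (Fo b)) \<and>
     (\<forall>a\<in>Ob J. Fm a a (Id J a) = Id C (Fo a)) \<and>
     (\<forall>a\<in>Ob J. \<forall>b\<in>Ob J. \<forall>c\<in>Ob J. \<forall>f\<in>Hom J a b. \<forall>g\<in>Hom J b c.
        Fm a c (Comp J a b c g f) = Comp C (Fo a) (Fo b) (Fo c) (Fm b c g) (Fm a b f))"

definition is_cocone ::
  "('j, 'k) cat \<Rightarrow> ('o, 'm) cat \<Rightarrow> ('j \<Rightarrow> 'o) \<Rightarrow> ('j \<Rightarrow> 'j \<Rightarrow> 'k \<Rightarrow> 'm) \<Rightarrow> 'o \<Rightarrow> ('j \<Rightarrow> 'm) \<Rightarrow> bool" where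
  "is_cocone J C Fo Fm L c \<longleftrightarrow> L \<in> Ob C \<and>
     (\<forall>a\<in>Ob J. c a \<in> Hom C (Fo a) L) \<and>
     (\<forall>a\<in>Ob J. \<forall>b\<in>Ob J. \<forall>f\<in>Hom J a b. Comp C (Fo a) (Fo b) L (c b) (Fm a b f) = c a)"

definition is_colimit ::
  "('j, 'k) cat \<Rightarrow> ('o, 'm) cat \<Rightarrow> ('j \<Rightarrow> 'o) \<Rightarrow> ('j \<Rightarrow> 'j \<Rightarrow> 'k \<Rightarrow> 'm) \<Rightarrow> 'o \<Rightarrow> ('j \<Rightarrow> 'm) \<Rightarrow> bool" where
  "is_colimit J C Fo Fm L c \<longleftrightarrow> is_cocone J C Fo Fm L c \<and>
     (\<forall>N d. is_cocone J C Fo Fm N d \<longrightarrow>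
        (\<exists>!h. h \<in> Hom C L N \<and> (\<forall>a\<in>Ob J. Comp C (Fo a) L N h (c a) = d a)))"

definition poset_cat :: "'i set \<Rightarrow> 'i rel \<Rightarrow> ('i, unit) cat" where
  "poset_cat I r = \<lparr>Ob = I, Hom = (\<lambda>i j. {u. (i, j) \<in> r}), Id = (\<lambda>_. ()), Comp = (\<lambda>_ _ _ _ _. ())\<rparr>"

text \<open>The category of all sets of elements of a type.\<close>

definition set_cat :: "('a set, 'a \<Rightarrow> 'a) cat" where
  "set_cat = \<lparr>Ob = UNIV, Hom = (\<lambda>A B. A \<rightarrow>\<^sub>E B), Id = (\<lambda>A. \<lambda>x\<in>A. x),
     Comp = (\<lambda>A _ _ g f. compose A g f)\<rparr>"

text \<open>
  The covariant hom-functor of \<open>K\<close> sends an object \<open>a\<close> to \<open>Hom C K a\<close> and a morphism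
  \<open>g : a \<rightarrow> b\<close> to \<open>hom_map C K a b g\<close>.
\<close>

definition hom_map :: "('o, 'm) cat \<Rightarrow> 'o \<Rightarrow> 'o \<Rightarrow> 'o \<Rightarrow> 'm \<Rightarrow> ('m \<Rightarrow> 'm)" where
  "hom_map C K a b g = (\<lambda>f\<in>Hom C K a. Comp C K a b g f)"


section \<open>Smallness\<close>

text \<open>
  HOL has no proper classes, so the set/class distinction is made relative to a cardinal \<open>\<kappa>\<close>
  on some type, as it is made relative to a Grothendieck universe in set theory: a set is small
  if its cardinality is less than \<open>\<kappa>\<close>.  Grothendieck universes correspond to the uncountable
  regular strong limit cardinals.  Only closure under countable powers is required here instead
  of \<open>strong_limit\<close>; this covers all Grothendieck universes, and in contrast to them such
  \<open>\<kappa>\<close> provably exist in HOL and may be taken arbitrarily large: see the lemmas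
  \<open>universe_of_strong_limit\<close> and \<open>universe_cardSuc\<close> below.
\<close>

abbreviation (input) small :: "'u rel \<Rightarrow> 'a set \<Rightarrow> bool" where
  "small \<kappa> A \<equiv> |A| <o \<kappa>"

definition universe :: "'u rel \<Rightarrow> bool" where
  "universe \<kappa> \<longleftrightarrow> Card_order \<kappa> \<and> regularCard \<kappa> \<and> natLeq <o \<kappa> \<and>
     (\<forall>A :: 'u set. small \<kappa> A \<longrightarrow> |A| ^c natLeq <o \<kappa>)"

definition strong_limit :: "'u rel \<Rightarrow> bool" where
  "strong_limit \<kappa> \<longleftrightarrow> (\<forall>A :: 'u set. small \<kappa> A \<longrightarrow> small \<kappa> (Pow A))"

lemma cexp_natLeq:
  fixes A :: "'u set"
  shows "|A| ^c natLeq = |Func (UNIV :: nat set) A|"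
  by (simp add: cexp_def Field_natLeq Field_card_of)

lemma universe_of_strong_limit:
  fixes \<kappa> :: "'u rel"
  assumes "Card_order \<kappa>" "regularCard \<kappa>" "natLeq <o \<kappa>" "strong_limit \<kappa>"
  shows "universe \<kappa>"
proof -
  have inf: "infinite (Field \<kappa>)"
    using cinfinite_mono[OF ordLess_imp_ordLeq[OF assms(3)]] natLeq_cinfinite
    by (simp add: cinfinite_def)
  have "|A| ^c natLeq <o \<kappa>" if A: "|A| <o \<kappa>" for A :: "'u set"
  proof -
    have N: "|UNIV :: nat set| <o \<kappa>"
      using card_of_nat assms(3) ordIso_ordLess_trans by blast
    have "|{n} \<times> A| <o \<kappa>" for n :: nat
      by (rule ordLeq_ordLess_trans[OF card_of_ordLeqI[where f = snd] A]) (auto simp: inj_on_def)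
    moreover have "(UNIV :: nat set) \<times> A = (\<Union>n. {n} \<times> A)"
      by auto
    ultimately have "|(UNIV :: nat set) \<times> A| <o \<kappa>"
      using card_of_UNION_ordLess_infinite_Field_regularCard[OF assms(2) _ N, of "\<lambda>n. {n} \<times> A"]
        assms(1) inf by (simp add: cinfinite_def)
    then obtain B :: "'u set" where B: "|(UNIV :: nat set) \<times> A| =o |B|" "|B| <o \<kappa>"
      using internalize_card_of_ordLess[of "(UNIV :: nat set) \<times> A" \<kappa>] by blast
    then obtain g where g: "bij_betw g ((UNIV :: nat set) \<times> A) B"
      using card_of_ordIso by blast
    have "|Func (UNIV :: nat set) A| \<le>o |Pow B|"
    proof (rule card_of_ordLeqI[where f = "\<lambda>f. range (\<lambda>n. g (n, f n))"])
      show "inj_on (\<lambda>f. range (\<lambda>n. g (n, f n))) (Func (UNIV :: nat set) A)"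
      proof (rule inj_onI, rule ext)
        fix f h n
        assume f: "f \<in> Func UNIV A" and h: "h \<in> Func UNIV A"
          and eq: "range (\<lambda>n. g (n, f n)) = range (\<lambda>n. g (n, h n))"
        have "g (n, f n) \<in> range (\<lambda>n. g (n, h n))"
          by (subst eq[symmetric]) (rule rangeI)
        then obtain m where m: "g (n, f n) = g (m, h m)"
          by (rule rangeE)
        have "f n \<in> A" "h m \<in> A"
          using f h by (simp_all add: Func_def)
        then have "(n, f n) = (m, h m)"
          by (intro inj_onD[OF bij_betw_imp_inj_on[OF g] m]) simp_all
        then show "f n = h n"
          by blast
      qed
    qed (use bij_betwE[OF g] in \<open>auto simp: Func_def\<close>)
    also have "|Pow B| <o \<kappa>"
      using assms(4) B(2) by (simp add: strong_limit_def)
    finally show ?thesis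
      by (simp add: cexp_natLeq)
  qed
  then show ?thesis
    using assms by (simp add: universe_def)
qed

lemma universe_cardSuc:
  assumes "infinite (UNIV :: 'w set)"
  shows "universe (cardSuc |UNIV :: (nat \<Rightarrow> 'w) set| )"
proof -
  let ?V = "UNIV :: (nat \<Rightarrow> 'w) set"
  have inf: "infinite ?V"
  proof
    assume "finite ?V"
    then have "finite (range (\<lambda>(x :: 'w) (n :: nat). x))"
      by (rule finite_subset[OF subset_UNIV])
    moreover have "inj (\<lambda>(x :: 'w) (n :: nat). x)"
      by (rule injI) (simp add: fun_eq_iff)
    ultimately have "finite (UNIV :: 'w set)"
      by (rule finite_imageD)
    with assms show False ..
  qed
  have "|A| ^c natLeq <o cardSuc |?V|" if A: "|A| <o cardSuc |?V|" for A :: "(nat \<Rightarrow> 'w) set set"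
  proof -
    have "|A| \<le>o |?V|"
      using A by (simp add: cardSuc_ordLeq_ordLess card_of_Card_order)
    then have "|A| ^c natLeq \<le>o |?V| ^c natLeq"
      by (rule cexp_mono1) (rule natLeq_Card_order)
    also have "|?V| ^c natLeq \<le>o |?V|"
      unfolding cexp_natLeq
    proof (rule card_of_ordLeqI[where f = "\<lambda>f n. case prod_decode n of (i, j) \<Rightarrow> f i j"])
      show "inj_on (\<lambda>f n. case prod_decode n of (i, j) \<Rightarrow> f i j) (Func (UNIV :: nat set) ?V)"
      proof (rule inj_onI, intro ext)
        fix f g :: "nat \<Rightarrow> nat \<Rightarrow> 'w" and i j
        assume "(\<lambda>n. case prod_decode n of (i, j) \<Rightarrow> f i j) = (\<lambda>n. case prod_decode n of (i, j) \<Rightarrow> g i j)"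
        from fun_cong[OF this, of "prod_encode (i, j)"] show "f i j = g i j"
          by simp
      qed
    qed simp
    also have "|?V| <o cardSuc |?V|"
      by (rule cardSuc_greater[OF card_of_Card_order])
    finally show ?thesis .
  qed
  moreover have "natLeq <o cardSuc |?V|"
  proof (rule ordLeq_ordLess_trans)
    show "natLeq \<le>o |?V|"
      using inf infinite_iff_natLeq_ordLeq[of ?V] by simp
    show "|?V| <o cardSuc |?V|"
      by (rule cardSuc_greater[OF card_of_Card_order])
  qed
  moreover have "regularCard (cardSuc |?V| )"
    by (rule regularCard_cardSuc) (intro conjI card_of_Card_order, simp only: cinfinite_def Field_card_of inf not_False_eq_True)
  moreover have "Card_order (cardSuc |?V| )"
    by (rule cardSuc_Card_order[OF card_of_Card_order])
  ultimately show ?thesis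
    unfolding universe_def by (intro conjI allI impI)
qed

text \<open>
  Objects and morphisms of a small category may be taken from the type \<^typ>\<open>'u\<close> of \<open>\<kappa>\<close>, since
  every small set is in bijection with a set of elements of that type.
\<close>

definition small_cat :: "'u rel \<Rightarrow> ('j, 'k) cat \<Rightarrow> bool" where
  "small_cat \<kappa> J \<longleftrightarrow> category J \<and> small \<kappa> (Ob J) \<and> (\<forall>a\<in>Ob J. \<forall>b\<in>Ob J. small \<kappa> (Hom J a b))"

definition locally_small :: "'u rel \<Rightarrow> ('o, 'm) cat \<Rightarrow> bool" where
  "locally_small \<kappa> C \<longleftrightarrow> (\<forall>a\<in>Ob C. \<forall>b\<in>Ob C. small \<kappa> (Hom C a b))"

definition cocomplete :: "'u rel \<Rightarrow> ('o, 'm) cat \<Rightarrow> bool" where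
  "cocomplete \<kappa> C \<longleftrightarrow> category C \<and>
     (\<forall>(J :: ('u, 'u) cat) Fo Fm. small_cat \<kappa> J \<and> is_functor J C Fo Fm \<longrightarrow>
        (\<exists>L c. is_colimit J C Fo Fm L c))"


section \<open>Locally presentable categories\<close>

text \<open>
  Small \<open>\<mu>\<close>-directed posets, for a regular cardinal \<open>\<mu>\<close>: every subset with fewer than
  \<open>\<mu>\<close> elements has an upper bound (in particular the poset is nonempty).
\<close>

definition directed_poset :: "'u rel \<Rightarrow> 'l rel \<Rightarrow> 'i set \<Rightarrow> 'i rel \<Rightarrow> bool" where
  "directed_poset \<kappa> \<mu> I r \<longleftrightarrow> partial_order_on I r \<and> small \<kappa> I \<and>
     (\<forall>X\<subseteq>I. |X| <o \<mu> \<longrightarrow> (\<exists>u\<in>I. \<forall>x\<in>X. (x, u) \<in> r))"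

text \<open>
  An object is \<open>\<mu>\<close>-presentable if its hom-functor, with values in the category of sets of
  morphisms of \<open>C\<close>, preserves colimits of small \<open>\<mu>\<close>-directed diagrams.  The test objects in
  \<^const>\<open>set_cat\<close> are sets of any size; whether a cocone of sets is a colimit is
  already decided by maps into a two-element set.
\<close>

definition presentable :: "'u rel \<Rightarrow> 'l rel \<Rightarrow> ('o, 'm) cat \<Rightarrow> 'o \<Rightarrow> bool" where
  "presentable \<kappa> \<mu> C K \<longleftrightarrow> K \<in> Ob C \<and>
     (\<forall>(I :: 'u set) r Do Dm L c.
        directed_poset \<kappa> \<mu> I r \<and> is_functor (poset_cat I r) C Do Dm \<and>
        is_colimit (poset_cat I r) C Do Dm L c \<longrightarrow>
        is_colimit (poset_cat I r) set_cat
          (\<lambda>i. Hom C K (Do i)) (\<lambda>i j u. hom_map C K (Do i) (Do j) (Dm i j u))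
          (Hom C K L) (\<lambda>i. hom_map C K (Do i) L (c i)))"

text \<open>
  A category is locally \<open>\<mu>\<close>-presentable if it is cocomplete and has a small set \<open>G\<close> of
  \<open>\<mu>\<close>-presentable objects such that every object is a \<open>\<mu>\<close>-directed colimit of objects from
  \<open>G\<close>.  Categories are moreover understood to have small hom-sets; this is demanded when
  \<open>\<kappa>\<close> is a strong limit, as otherwise even the category of small sets fails it.
\<close>

definition locally_presentable :: "'u rel \<Rightarrow> 'l rel \<Rightarrow> ('o, 'm) cat \<Rightarrow> bool" where
  "locally_presentable \<kappa> \<mu> C \<longleftrightarrow> cocomplete \<kappa> C \<and>
     (strong_limit \<kappa> \<longrightarrow> locally_small \<kappa> C) \<and>
     (\<exists>G. small \<kappa> G \<and> (\<forall>K\<in>G. presentable \<kappa> \<mu> C K) \<and>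
        (\<forall>M\<in>Ob C. \<exists>(I :: 'u set) r Do Dm c.
           directed_poset \<kappa> \<mu> I r \<and> is_functor (poset_cat I r) C Do Dm \<and>
           (\<forall>i\<in>I. Do i \<in> G) \<and> is_colimit (poset_cat I r) C Do Dm M c))"

definition aleph_1 :: "nat set rel" where
  "aleph_1 = cardSuc natLeq"


section \<open>The category of modules\<close>

text \<open>
  All small \<open>R\<close>-modules, with carriers taken from the type \<^typ>\<open>'u\<close> of \<open>\<kappa>\<close>.
\<close>

definition Mod :: "'u rel \<Rightarrow> ('r, 'z) sigma_sring_scheme \<Rightarrow> (('r, 'u) rmod, 'u \<Rightarrow> 'u) cat" where
  "Mod \<kappa> R = \<lparr>Ob = {M. r_module R M \<and> small \<kappa> (carrier M)},
     Hom = linear_maps R,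
     Id = (\<lambda>M. \<lambda>x\<in>carrier M. x),
     Comp = (\<lambda>M _ _ g f. compose (carrier M) g f)\<rparr>"

end

theory Submission
  imports Defs "HOL-Library.Countable_Set_Type"
begin

text \<open>
  A module is determined by flat facts \<open>\<Sum>\<^sub>n x\<^sub>n = v\<close> and \<open>r x = y\<close> between its elements. Every set
  \<open>Q\<close> of such facts on a small set of generators presents a module: take the infinitary terms that
  are defined under every interpretation of \<open>Q\<close> in a small module, and identify those that always
  agree. Presenting the disjoint union of a diagram gives cocompleteness. A countably directed
  colimit is computed on representatives, since countably many elements and facts already live at
  one stage; therefore modules presented by countably many facts are presentable. There
  is a small set of those up to isomorphism, and every module is the directed colimit of the modules
  presented by the countable sets of facts that hold in it.
\<close>

section \<open>Small sets\<close>

text \<open>The obstacle is partiality. A congruence generated on formal sums would not settle which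
  sums of classes exist, and the partition axiom ties the existence of a sum to that of its subsums
  in both directions. Testing a term in all small modules settles existence and equality together,
  and since the outcome is an initial structure, each axiom is inherited from modules that already
  satisfy it. This quantifies over all small modules, the presented one among them, but only the set
  of terms has to be small. The cardinal \<open>aleph_1\<close> is the arity of sums: a single sum
  involves countably many elements. Facts are positive and flat. Being positive, they are carried
  forward by linear maps; being flat, countably many of them mention countably many elements.
  Ordering countable sets of facts by inclusion yields a poset directly, whereas the countably
  presented modules over a given module form only a category.\<close>

lemma countable_iff_ordLess_aleph_1: "countable A \<longleftrightarrow> |A| <o aleph_1"
  unfolding aleph_1_def countable_card_le_natLeq
  by (rule cardSuc_ordLeq_ordLess[OF natLeq_Card_order card_of_Card_order, symmetric])

lemma small_subset: "small \<kappa> B \<Longrightarrow> A \<subseteq> B \<Longrightarrow> small \<kappa> A"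
  by (rule ordLeq_ordLess_trans[OF card_of_mono1])

lemma small_image: "small \<kappa> A \<Longrightarrow> small \<kappa> (f ` A)"
  by (rule ordLeq_ordLess_trans[OF card_of_image])

lemma small_inj_on: "inj_on f A \<Longrightarrow> small \<kappa> (f ` A) \<Longrightarrow> small \<kappa> A"
  using small_image[where A = "f ` A" and f = "the_inv_into A f"] by (simp add: the_inv_into_onto)

text \<open>A cardinal below \<open>\<kappa>\<close> is realised by a set of elements of type
  \<open>'u\<close>. Through this embedding, small sets of other types, such as sets of facts, can
  serve as index sets in \<open>'u\<close>.\<close>

lemma small_bij_copy:
  fixes \<kappa> :: "'u rel"
  assumes "small \<kappa> A"
  obtains e :: "'a \<Rightarrow> 'u" where "inj_on e A"
proof -
  obtain B :: "'u set" where "|A| =o |B|"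
    using assms internalize_card_of_ordLess[of A \<kappa>] by blast
  then show ?thesis
    using card_of_ordIso[of A B] that bij_betw_imp_inj_on by blast
qed

lemma small_classify:
  fixes \<kappa> :: "'u rel"
  assumes "small \<kappa> A"
  obtains e :: "'a \<Rightarrow> 'u" where "\<And>x y. x \<in> A \<Longrightarrow> y \<in> A \<Longrightarrow> e x = e y \<longleftrightarrow> F x = F y"
proof -
  obtain e :: "_ \<Rightarrow> 'u" where "inj_on e (F ` A)"
    using small_bij_copy[OF small_image[OF assms]] .
  then have "e (F x) = e (F y) \<longleftrightarrow> F x = F y" if "x \<in> A" "y \<in> A" for x y
    using that by (auto dest: inj_onD)
  then show ?thesis
    by (rule that)
qed

section \<open>Closure properties of a universe\<close>

context
  fixes \<kappa> :: "'u rel"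
  assumes univ: "universe \<kappa>"
begin

lemma universe_cinfinite: "cinfinite \<kappa>"
  using univ unfolding universe_def by (blast intro: cinfinite_mono[OF ordLess_imp_ordLeq natLeq_cinfinite])

lemma small_countable: "countable A \<Longrightarrow> small \<kappa> A"
  using univ unfolding universe_def countable_card_le_natLeq by (blast intro: ordLeq_ordLess_trans)

text \<open>This is the regularity of \<open>\<kappa>\<close>; unions of two sets rest on its
  infinity alone.\<close>

lemma small_UN:
  assumes "small \<kappa> I" "\<And>i. i \<in> I \<Longrightarrow> small \<kappa> (A i)"
  shows "small \<kappa> (\<Union>i\<in>I. A i)"
  using card_of_UNION_ordLess_infinite_Field_regularCard[of \<kappa> I A] assms univ universe_cinfinite
  by (simp add: universe_def cinfinite_def)

lemma small_Un: "small \<kappa> A \<Longrightarrow> small \<kappa> B \<Longrightarrow> small \<kappa> (A \<union> B)"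
  using card_of_Un_ordLess_infinite_Field[of \<kappa> A B] univ universe_cinfinite
  by (simp add: universe_def cinfinite_def)

lemma small_insert: "small \<kappa> A \<Longrightarrow> small \<kappa> (insert x A)"
  unfolding insert_is_Un[of x A] by (rule small_Un[OF small_countable]) simp_all

lemma small_Sigma:
  assumes "small \<kappa> I" "\<And>i. i \<in> I \<Longrightarrow> small \<kappa> (A i)"
  shows "small \<kappa> (Sigma I A)"
proof -
  have "Sigma I A = (\<Union>i\<in>I. Pair i ` A i)"
    by auto
  then show ?thesis
    using assms by (simp add: small_UN small_image)
qed

text \<open>The definition of \<open>universe\<close> speaks of sets of elements of
  \<open>'u\<close> only; a bijective copy transfers the bound to any type.\<close>

lemma small_cexp:
  assumes "small \<kappa> A"
  shows "|A| ^c natLeq <o \<kappa>"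
proof -
  obtain B :: "'u set" where B: "|A| =o |B|" "|B| <o \<kappa>"
    using assms internalize_card_of_ordLess[of A \<kappa>] by blast
  have "|A| ^c natLeq \<le>o |B| ^c natLeq"
    by (rule cexp_mono1[OF ordIso_imp_ordLeq[OF B(1)] natLeq_Card_order])
  then show ?thesis
    using B(2) univ by (auto simp: universe_def intro: ordLeq_ordLess_trans)
qed

lemma small_sequences:
  assumes "small \<kappa> A"
  shows "small \<kappa> {f :: nat \<Rightarrow> 'a. range f \<subseteq> A}"
proof -
  have "{f :: nat \<Rightarrow> 'a. range f \<subseteq> A} = Func UNIV A"
    by (auto simp: Func_def)
  then show ?thesis
    using small_cexp[OF assms] by (simp add: cexp_natLeq)
qed

text \<open>A nonempty countable subset is the range of a sequence, so countable powers bound these;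
  the empty set is added separately. The lemma makes both the index poset of a module and the
  collection of countable presentations small.\<close>

lemma small_countable_subsets:
  assumes "small \<kappa> A"
  shows "small \<kappa> {X. X \<subseteq> A \<and> countable X}"
proof -
  have "small \<kappa> {X. X \<subseteq> A \<and> countable X \<and> X \<noteq> {}}"
    by (rule ordLeq_ordLess_trans[OF card_of_countable_sets_Func small_cexp[OF assms]])
  then have "small \<kappa> ({X. X \<subseteq> A \<and> countable X \<and> X \<noteq> {}} \<union> {{}})"
    by (rule small_Un) (simp add: small_countable)
  then show ?thesis
    by (rule small_subset) auto
qed

end

lemma small_Pow:
  fixes \<kappa> :: "'u rel"
  assumes "strong_limit \<kappa>" "small \<kappa> A"
  shows "small \<kappa> (Pow A)"
proof -
  obtain e :: "'a \<Rightarrow> 'u" where e: "inj_on e A"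
    using small_bij_copy[OF assms(2)] .
  have "small \<kappa> (Pow (e ` A))"
    using assms small_image by (auto simp: strong_limit_def)
  then have "small \<kappa> (image e ` Pow A)"
    by (rule small_subset) auto
  then show ?thesis
    by (rule small_inj_on[rotated]) (rule inj_on_image_Pow[OF e])
qed


section \<open>Modules and linear maps\<close>

lemma Sums_opt_eq_Some:
  "Sums_opt M e = Some v \<longleftrightarrow> (\<exists>u. e = (\<lambda>j. Some (u j)) \<and> Sums M u = Some v)"
proof
  assume *: "Sums_opt M e = Some v"
  then have "\<And>j. e j = Some (the (e j))"
    by (auto simp: Sums_opt_def split: if_splits)
  with * show "\<exists>u. e = (\<lambda>j. Some (u j)) \<and> Sums M u = Some v"
    by (intro exI[of _ "\<lambda>j. the (e j)"]) (auto simp: Sums_opt_def fun_eq_iff split: if_splits)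
qed (auto simp: Sums_opt_def)

lemma option_eqI: "(\<And>v. x = Some v \<longleftrightarrow> y = Some v) \<Longrightarrow> x = y"
  by (cases x; cases y) auto

lemma linear_mapsD:
  assumes "f \<in> linear_maps R M N"
  shows linear_maps_closed: "x \<in> carrier M \<Longrightarrow> f x \<in> carrier N"
    and linear_maps_zero: "f (zero M) = zero N"
    and linear_maps_Sums: "(\<And>i. y i \<in> carrier M) \<Longrightarrow> Sums M y = Some v \<Longrightarrow> Sums N (\<lambda>i. f (y i)) = Some (f v)"
    and linear_maps_act: "r \<in> carrier R \<Longrightarrow> x \<in> carrier M \<Longrightarrow> f (act M r x) = act N r (f x)"
    and linear_maps_PiE: "f \<in> carrier M \<rightarrow>\<^sub>E carrier N"
  using assms by (auto simp: linear_maps_def)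

text \<open>The restriction agrees with \<open>f\<close> only on the carrier, which is why zero,
  sums and multiples also have to be shown to lie there.\<close>

lemma linear_mapsI:
  assumes "\<And>x. x \<in> carrier M \<Longrightarrow> f x \<in> carrier N"
    and "zero M \<in> carrier M" "f (zero M) = zero N"
    and "\<And>x v. (\<And>i. x i \<in> carrier M) \<Longrightarrow> Sums M x = Some v \<Longrightarrow> v \<in> carrier M \<and> Sums N (\<lambda>i. f (x i)) = Some (f v)"
    and "\<And>r x. r \<in> carrier R \<Longrightarrow> x \<in> carrier M \<Longrightarrow> act M r x \<in> carrier M \<and> f (act M r x) = act N r (f x)"
  shows "restrict f (carrier M) \<in> linear_maps R M N"
  using assms by (auto simp: linear_maps_def)

lemma linear_maps_eqI:
  assumes "f \<in> linear_maps R M N" "g \<in> linear_maps R M N" "\<And>x. x \<in> carrier M \<Longrightarrow> f x = g x"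
  shows "f = g"
  using assms(1,2)[THEN linear_maps_PiE] assms(3) by (rule PiE_ext)


section \<open>The category of modules\<close>

lemma linear_maps_id:
  assumes "r_module R M"
  shows "(\<lambda>x\<in>carrier M. x) \<in> linear_maps R M M"
proof -
  interpret r_module R M by fact
  show ?thesis
    by (rule linear_mapsI) (auto intro: zero_closed Sums_closed act_closed)
qed

lemma linear_maps_compose:
  assumes "r_module R M" "f \<in> linear_maps R M N" "g \<in> linear_maps R N P"
  shows "compose (carrier M) g f \<in> linear_maps R M P"
proof -
  interpret r_module R M by fact
  show ?thesis
    unfolding compose_def
    by (rule linear_mapsI)
      (auto simp: linear_mapsD[OF assms(2)] linear_mapsD[OF assms(3)]
        intro: zero_closed Sums_closed act_closed)
qed

lemma Mod_simps [simp]: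
  "Ob (Mod \<kappa> R) = {M. r_module R M \<and> small \<kappa> (carrier M)}"
  "Hom (Mod \<kappa> R) = linear_maps R"
  "Id (Mod \<kappa> R) M = (\<lambda>x\<in>carrier M. x)"
  "Comp (Mod \<kappa> R) M N P g f = compose (carrier M) g f"
  by (simp_all add: Mod_def)

lemma category_Mod: "category (Mod \<kappa> R)"
proof
  fix a b c f g
  assume "a \<in> Ob (Mod \<kappa> R)" and "f \<in> Hom (Mod \<kappa> R) a b" "g \<in> Hom (Mod \<kappa> R) b c"
  then show "Comp (Mod \<kappa> R) a b c g f \<in> Hom (Mod \<kappa> R) a c"
    by (simp add: linear_maps_compose)
next
  fix a b f
  assume "f \<in> Hom (Mod \<kappa> R) a b"
  then have "f \<in> carrier a \<rightarrow>\<^sub>E carrier b"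
    by (simp add: linear_maps_PiE)
  then show "Comp (Mod \<kappa> R) a a b f (Id (Mod \<kappa> R) a) = f" "Comp (Mod \<kappa> R) a b b (Id (Mod \<kappa> R) b) f = f"
    by (auto simp: compose_def fun_eq_iff PiE_iff extensional_def)
next
  fix a b c d f g h
  assume "f \<in> Hom (Mod \<kappa> R) a b"
  then have "f \<in> carrier a \<rightarrow> carrier b"
    using linear_maps_PiE by fastforce
  then show "Comp (Mod \<kappa> R) a c d h (Comp (Mod \<kappa> R) a b c g f) = Comp (Mod \<kappa> R) a b d (Comp (Mod \<kappa> R) b c d h g) f"
    by (simp add: compose_assoc)
qed (simp add: linear_maps_id)

text \<open>
  \<open>B\<close> carries the initial structure with respect to the jointly injective family \<open>p\<close>: its sums are
  computed componentwise, and exist as soon as all components exist.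
\<close>

lemma r_module_initial:
  fixes N :: "'i \<Rightarrow> ('r, 'a) rmod" and B :: "('r, 'b) rmod"
  assumes "sigma_semiring R" and modN: "\<And>i. i \<in> A \<Longrightarrow> r_module R (N i)"
    and p: "\<And>i b. i \<in> A \<Longrightarrow> b \<in> carrier B \<Longrightarrow> p i b \<in> carrier (N i)"
    and inj: "\<And>b b'. b \<in> carrier B \<Longrightarrow> b' \<in> carrier B \<Longrightarrow> (\<And>i. i \<in> A \<Longrightarrow> p i b = p i b') \<Longrightarrow> b = b'"
    and zero: "zero B \<in> carrier B" "\<And>i. i \<in> A \<Longrightarrow> p i (zero B) = zero (N i)"
    and act: "\<And>r b. r \<in> carrier R \<Longrightarrow> b \<in> carrier B \<Longrightarrow> act B r b \<in> carrier B"
      "\<And>i r b. i \<in> A \<Longrightarrow> r \<in> carrier R \<Longrightarrow> b \<in> carrier B \<Longrightarrow> p i (act B r b) = act (N i) r (p i b)"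
    and Sums: "\<And>x v. (\<And>n. x n \<in> carrier B) \<Longrightarrow> Sums B x = Some v \<longleftrightarrow>
        v \<in> carrier B \<and> (\<forall>i\<in>A. Sums (N i) (\<lambda>n. p i (x n)) = Some (p i v))"
    and Sums_defined: "\<And>x. (\<And>n. x n \<in> carrier B) \<Longrightarrow>
        (\<And>i. i \<in> A \<Longrightarrow> Sums (N i) (\<lambda>n. p i (x n)) \<noteq> None) \<Longrightarrow> Sums B x \<noteq> None"
  shows "r_module R B"
proof -
  interpret R: sigma_semiring R by fact
  have SumsI: "Sums B x = Some v"
    if "\<And>n. x n \<in> carrier B" "v \<in> carrier B" "\<And>i. i \<in> A \<Longrightarrow> Sums (N i) (\<lambda>n. p i (x n)) = Some (p i v)"
    for x v
    using that Sums[of x v] by blast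
  have SumsD: "Sums (N i) (\<lambda>n. p i (x n)) = Some (p i v)"
    if "\<And>n. x n \<in> carrier B" "Sums B x = Some v" "i \<in> A" for i x v
    using that Sums[of x v] by blast
  have clB: "v \<in> carrier B" if "\<And>n. x n \<in> carrier B" "Sums B x = Some v" for x v
    using that Sums[of x v] by blast
  show ?thesis
  proof
    show "zero B \<in> carrier B"
      by fact
    show "v \<in> carrier B" if "\<And>i. x i \<in> carrier B" "Sums B x = Some v" for x v
      using that by (rule clB)
    show "Sums B x = Some (x j)"
      if x: "\<And>i. x i \<in> carrier B" "\<And>i. i \<noteq> j \<Longrightarrow> x i = zero B" for x j
    proof (rule SumsI)
      fix i assume i: "i \<in> A"
      interpret N: r_module R "N i" by (rule modN[OF i])
      show "Sums (N i) (\<lambda>n. p i (x n)) = Some (p i (x j))"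
        by (rule N.Sums_single[of "\<lambda>n. p i (x n)" j]) (auto simp: x p i zero)
    qed (use x in auto)
    show "Sums B x = Sums B y"
      if x: "\<And>i. x i \<in> carrier B" and y: "\<And>i. y i \<in> carrier B"
        and \<sigma>: "bij_betw \<sigma> {i. x i \<noteq> zero B} {j. y j \<noteq> zero B}"
        and eq: "\<And>i. x i \<noteq> zero B \<Longrightarrow> y (\<sigma> i) = x i" for x y \<sigma>
    proof -
      have "Sums (N i) (\<lambda>n. p i (x n)) = Sums (N i) (\<lambda>n. p i (y n))" if i: "i \<in> A" for i
      proof -
        interpret N: r_module R "N i" by (rule modN[OF i])
        have nz: "p i (x n) \<noteq> zero (N i) \<Longrightarrow> x n \<noteq> zero B" "p i (y n) \<noteq> zero (N i) \<Longrightarrow> y n \<noteq> zero B" for n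
          using zero i by auto
        \<comment> \<open>A nonzero entry of \<open>B\<close> may have zero component, so the
          components have smaller supports; \<open>\<sigma>\<close> restricts to a bijection between
          them because it preserves entries.\<close>
        have "bij_betw \<sigma> {n. p i (x n) \<noteq> zero (N i)} {n. p i (y n) \<noteq> zero (N i)}"
        proof (rule bij_betw_subset[OF \<sigma>])
          show "\<sigma> ` {n. p i (x n) \<noteq> zero (N i)} = {n. p i (y n) \<noteq> zero (N i)}" (is "?L = ?R")
          proof
            show "?L \<subseteq> ?R"
              using nz eq by auto
            show "?R \<subseteq> ?L"
            proof
              fix m assume m: "m \<in> ?R"
              then have "m \<in> {j. y j \<noteq> zero B}"
                using nz by auto
              then obtain n where "x n \<noteq> zero B" "m = \<sigma> n"
                using bij_betw_imp_surj_on[OF \<sigma>] by blast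
              then show "m \<in> ?L"
                using m eq by auto
            qed
          qed
        qed (use nz in auto)
        then show ?thesis
          by (rule N.Sums_reindex[rotated 2]) (use nz eq in \<open>auto simp: p i x y\<close>)
      qed
      then show ?thesis
        by (intro option_eqI) (simp add: Sums x y)
    qed
    show "Sums B x = Sums_opt B (\<lambda>j. Sums B (\<lambda>k. x (\<sigma> (j, k))))"
      if x: "\<And>i. x i \<in> carrier B" and \<sigma>: "bij \<sigma>" for x and \<sigma> :: "nat \<times> nat \<Rightarrow> nat"
    proof (rule option_eqI)
      fix v
      have part: "Sums (N i) (\<lambda>n. p i (x n)) =
          Sums_opt (N i) (\<lambda>j. Sums (N i) (\<lambda>k. p i (x (\<sigma> (j, k)))))" if i: "i \<in> A" for i
      proof -
        interpret N: r_module R "N i" by (rule modN[OF i])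
        show ?thesis
          by (rule N.Sums_partition[OF _ \<sigma>, of "\<lambda>n. p i (x n)"]) (auto simp: p i x)
      qed
      show "Sums B x = Some v \<longleftrightarrow> Sums_opt B (\<lambda>j. Sums B (\<lambda>k. x (\<sigma> (j, k)))) = Some v"
      proof
        assume v: "Sums B x = Some v"
        then have vB: "v \<in> carrier B"
          using clB x by blast
        have opt: "Sums_opt (N i) (\<lambda>j. Sums (N i) (\<lambda>k. p i (x (\<sigma> (j, k))))) = Some (p i v)" if i: "i \<in> A" for i
          using part[OF i] SumsD[OF x v i] by simp
        \<comment> \<open>No candidate in \<open>B\<close> for the value of an inner sum is at hand,
          so its existence must come from \<open>Sums_defined\<close>, that is, from the existence
          of all components.\<close>
        have "Sums B (\<lambda>k. x (\<sigma> (j, k))) \<noteq> None" for j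
        proof (rule Sums_defined)
          show "Sums (N i) (\<lambda>k. p i (x (\<sigma> (j, k)))) \<noteq> None" if i: "i \<in> A" for i
            using opt[OF i] unfolding Sums_opt_eq_Some fun_eq_iff by auto
        qed (rule x)
        then obtain u where u: "\<And>j. Sums B (\<lambda>k. x (\<sigma> (j, k))) = Some (u j)"
          by (intro that[of "\<lambda>j. the (Sums B (\<lambda>k. x (\<sigma> (j, k))))"]) simp
        have uB: "u j \<in> carrier B" for j
          by (rule clB[OF _ u]) (rule x)
        have "Sums B u = Some v"
        proof (rule SumsI)
          fix i assume i: "i \<in> A"
          have "Sums (N i) (\<lambda>k. p i (x (\<sigma> (j, k)))) = Some (p i (u j))" for j
            by (rule SumsD[OF _ u i]) (rule x)
          then show "Sums (N i) (\<lambda>n. p i (u n)) = Some (p i v)"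
            using opt[OF i] by (simp add: Sums_opt_def)
        qed (use uB vB in auto)
        then show "Sums_opt B (\<lambda>j. Sums B (\<lambda>k. x (\<sigma> (j, k)))) = Some v"
          unfolding Sums_opt_eq_Some using u by blast
      next
        assume "Sums_opt B (\<lambda>j. Sums B (\<lambda>k. x (\<sigma> (j, k)))) = Some v"
        then obtain u where u: "\<And>j. Sums B (\<lambda>k. x (\<sigma> (j, k))) = Some (u j)" and v: "Sums B u = Some v"
          unfolding Sums_opt_eq_Some fun_eq_iff by blast
        have uB: "u j \<in> carrier B" for j
          by (rule clB[OF _ u]) (rule x)
        show "Sums B x = Some v"
        proof (rule SumsI)
          fix i assume i: "i \<in> A"
          have "Sums (N i) (\<lambda>k. p i (x (\<sigma> (j, k)))) = Some (p i (u j))" for j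
            by (rule SumsD[OF _ u i]) (rule x)
          then show "Sums (N i) (\<lambda>n. p i (x n)) = Some (p i v)"
            using part[OF i] SumsD[OF uB v i] by (simp add: Sums_opt_def)
        qed (use x clB[OF uB v] in auto)
      qed
    qed
    show "Sums2 B (\<lambda>i j. act B (r i) (x j)) = Some (act B v w)"
      if r: "\<And>i. r i \<in> carrier R" and x: "\<And>j. x j \<in> carrier B"
        and v: "Sums R r = Some v" and w: "Sums B x = Some w" for r x v w
      unfolding Sums2_def
    proof (rule SumsI)
      have vR: "v \<in> carrier R" and wB: "w \<in> carrier B"
        using R.Sums_closed[OF r v] clB[OF x w] by blast+
      show "act B v w \<in> carrier B"
        using act vR wB by blast
      show "(case prod_decode n of (i, j) \<Rightarrow> act B (r i) (x j)) \<in> carrier B" for n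
        using act r x by (simp split: prod.split)
      fix i assume i: "i \<in> A"
      interpret N: r_module R "N i" by (rule modN[OF i])
      have "Sums2 (N i) (\<lambda>k j. act (N i) (r k) (p i (x j))) = Some (act (N i) v (p i w))"
        using p i x by (intro N.act_Sums r v SumsD[OF x w i]) auto
      moreover have "(\<lambda>n. p i (case prod_decode n of (i, j) \<Rightarrow> act B (r i) (x j))) =
          (\<lambda>n. case prod_decode n of (k, j) \<Rightarrow> act (N i) (r k) (p i (x j)))"
        using act(2) i r x by (auto simp: fun_eq_iff split: prod.split)
      ultimately show "Sums (N i) (\<lambda>n. p i (case prod_decode n of (i, j) \<Rightarrow> act B (r i) (x j))) = Some (p i (act B v w))"
        using act(2)[OF i vR wB] by (simp add: Sums2_def)
    qed
    fix r x assume rx: "r \<in> carrier R" "x \<in> carrier B"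
    show "act B r x \<in> carrier B"
      using act rx by blast
  next
    fix r s x assume rsx: "r \<in> carrier R" "s \<in> carrier R" "x \<in> carrier B"
    show "act B (mult R r s) x = act B r (act B s x)"
      by (rule inj) (auto simp: act rsx R.mult_closed p r_module.act_mult[OF modN])
  next
    fix x assume x: "x \<in> carrier B"
    show "act B (one R) x = x"
      by (rule inj) (auto simp: act x R.one_closed p r_module.act_one[OF modN])
    show "act B (zero R) x = zero B"
      by (rule inj) (auto simp: act zero x R.zero_closed p r_module.act_zero_left[OF modN])
  next
    fix r assume r: "r \<in> carrier R"
    show "act B r (zero B) = zero B"
      by (rule inj) (auto simp: act zero r p r_module.act_zero_right[OF modN])
  qed
qed


section \<open>Presentations\<close>

text \<open>Two further kinds of equation are expressed through \<open>ActF\<close>: scalar one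
  gives an identification \<open>x = y\<close>, and scalar zero gives \<open>y = 0\<close>, since
  \<open>zero R\<close> sends every element to zero.\<close>

datatype (scalars: 'r, gens: 'x) fact = SumF "nat \<Rightarrow> 'x" 'x | ActF 'r 'x 'x
  for map: map_fact

primrec holds :: "('r, 'a) rmod \<Rightarrow> ('x \<Rightarrow> 'a) \<Rightarrow> ('r, 'x) fact \<Rightarrow> bool" where
  "holds N f (SumF x v) \<longleftrightarrow> Sums N (\<lambda>n. f (x n)) = Some (f v)"
| "holds N f (ActF r x y) \<longleftrightarrow> act N r (f x) = f y"

definition facts_over :: "'r set \<Rightarrow> 'x set \<Rightarrow> ('r, 'x) fact set" where
  "facts_over S X = {\<phi>. scalars \<phi> \<subseteq> S \<and> gens \<phi> \<subseteq> X}"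

definition generators :: "('r, 'x) fact set \<Rightarrow> 'x set" where
  "generators Q = (\<Union>\<phi>\<in>Q. gens \<phi>)"

text \<open>Interpretations are arbitrary outside the generators. They are therefore compared on
  generators only, and facts are transferred between them by \<open>holds_cong\<close>.\<close>

definition interps :: "('r, 'a) rmod \<Rightarrow> ('r, 'x) fact set \<Rightarrow> ('x \<Rightarrow> 'a) set" where
  "interps N Q = {f. f ` generators Q \<subseteq> carrier N \<and> (\<forall>\<phi>\<in>Q. holds N f \<phi>)}"

lemma holds_map_fact: "holds N f (map_fact id g \<phi>) \<longleftrightarrow> holds N (\<lambda>x. f (g x)) \<phi>"
  by (cases \<phi>) simp_all

lemma holds_cong: "(\<And>x. x \<in> gens \<phi> \<Longrightarrow> f x = g x) \<Longrightarrow> holds N f \<phi> \<longleftrightarrow> holds N g \<phi>"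
  by (cases \<phi>) simp_all

lemma interps_cong:
  "(\<And>x. x \<in> generators Q \<Longrightarrow> f x = g x) \<Longrightarrow> f \<in> interps N Q \<longleftrightarrow> g \<in> interps N Q"
proof -
  assume eq: "\<And>x. x \<in> generators Q \<Longrightarrow> f x = g x"
  then have "holds N f \<phi> \<longleftrightarrow> holds N g \<phi>" if "\<phi> \<in> Q" for \<phi>
    using that by (intro holds_cong) (auto simp: generators_def)
  then show ?thesis
    using eq by (auto simp: interps_def)
qed

lemma interps_mono: "Q \<subseteq> Q' \<Longrightarrow> interps N Q' \<subseteq> interps N Q"
  unfolding interps_def generators_def by blast

text \<open>Facts assert that a sum exists with a given value, never that a sum is undefined; this
  is the direction in which linear maps preserve sums.\<close>

lemma holds_linear:
  assumes "holds N f \<phi>" "h \<in> linear_maps R N P" "scalars \<phi> \<subseteq> carrier R" "f ` gens \<phi> \<subseteq> carrier N"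
  shows "holds P (\<lambda>x. h (f x)) \<phi>"
proof (cases \<phi>)
  case (SumF x v)
  then show ?thesis
    using assms linear_maps_Sums[OF assms(2), of "\<lambda>n. f (x n)" "f v"] by auto
next
  case (ActF r x y)
  then show ?thesis
    using assms(1,3,4) linear_maps_act[OF assms(2), of r "f x"] by auto
qed

lemma interps_linear:
  assumes "f \<in> interps N Q" "h \<in> linear_maps R N P" "\<And>\<phi>. \<phi> \<in> Q \<Longrightarrow> scalars \<phi> \<subseteq> carrier R"
  shows "(\<lambda>x. h (f x)) \<in> interps P Q"
  using assms holds_linear[OF _ assms(2), of f] linear_maps_closed[OF assms(2)]
  by (fastforce simp: interps_def generators_def)

lemma small_facts_over:
  assumes "universe \<kappa>" "small \<kappa> S" "small \<kappa> X"
  shows "small \<kappa> (facts_over S X)"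
proof -
  have "facts_over S X \<subseteq> (\<lambda>(x, v). SumF x v) ` ({x. range x \<subseteq> X} \<times> X) \<union>
      (\<lambda>(r, x, y). ActF r x y) ` (S \<times> X \<times> X)"
  proof
    fix \<phi> assume "\<phi> \<in> facts_over S X"
    then show "\<phi> \<in> (\<lambda>(x, v). SumF x v) ` ({x. range x \<subseteq> X} \<times> X) \<union>
        (\<lambda>(r, x, y). ActF r x y) ` (S \<times> X \<times> X)"
      by (cases \<phi>) (auto simp: facts_over_def image_iff)
  qed
  moreover have "small \<kappa> ((\<lambda>(x, v). SumF x v) ` ({x. range x \<subseteq> X} \<times> X) \<union>
      (\<lambda>(r, x, y). ActF r x y) ` (S \<times> X \<times> X))"
    by (intro small_Un small_image small_Sigma small_sequences assms)
  ultimately show ?thesis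
    by (rule small_subset[rotated])
qed

lemma countable_generators: "countable Q \<Longrightarrow> countable (generators Q)"
proof -
  have "countable (gens \<phi>)" for \<phi> :: "('r, 'x) fact"
    by (cases \<phi>) auto
  then show "countable Q \<Longrightarrow> countable (generators Q)"
    unfolding generators_def by (intro countable_UN)
qed

text \<open>\<open>L\<close> represents the functor \<open>N \<mapsto> interps N Q\<close>, with universal element \<open>\<eta>\<close>.\<close>

definition presents ::
  "'u rel \<Rightarrow> ('r, 'z) sigma_sring_scheme \<Rightarrow> ('r, 'x) fact set \<Rightarrow> ('r, 'u) rmod \<Rightarrow> ('x \<Rightarrow> 'u) \<Rightarrow> bool" where
  "presents \<kappa> R Q L \<eta> \<longleftrightarrow> L \<in> Ob (Mod \<kappa> R) \<and> \<eta> \<in> interps L Q \<and>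
     (\<forall>N\<in>Ob (Mod \<kappa> R). \<forall>f\<in>interps N Q. \<exists>!h. h \<in> linear_maps R L N \<and> (\<forall>x\<in>generators Q. h (\<eta> x) = f x))"

lemma presents_closed:
  assumes "presents \<kappa> R Q L \<eta>"
  shows "L \<in> Ob (Mod \<kappa> R)" "\<eta> \<in> interps L Q" "x \<in> generators Q \<Longrightarrow> \<eta> x \<in> carrier L"
  using assms by (auto simp: presents_def interps_def)

lemma presents_lift:
  assumes "presents \<kappa> R Q L \<eta>" "N \<in> Ob (Mod \<kappa> R)" "f \<in> interps N Q"
  obtains h where "h \<in> linear_maps R L N" "\<And>x. x \<in> generators Q \<Longrightarrow> h (\<eta> x) = f x"
  using assms unfolding presents_def by blast

text \<open>Composing \<open>h\<close> with \<eta> gives an interpretation of \<open>Q\<close> in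
  \<open>N\<close>, and both \<open>h\<close> and \<open>h'\<close> lift it. In this cancellation
  form, uniqueness proves the functor laws and the commuting triangles below.\<close>

lemma presents_eqI:
  assumes "presents \<kappa> R Q L \<eta>" "N \<in> Ob (Mod \<kappa> R)" "\<And>\<phi>. \<phi> \<in> Q \<Longrightarrow> scalars \<phi> \<subseteq> carrier R"
    and "h \<in> linear_maps R L N" "h' \<in> linear_maps R L N"
    and "\<And>x. x \<in> generators Q \<Longrightarrow> h (\<eta> x) = h' (\<eta> x)"
  shows "h = h'"
proof -
  have "(\<lambda>x. h (\<eta> x)) \<in> interps N Q"
    by (rule interps_linear[OF presents_closed(2)[OF assms(1)] assms(4,3)])
  then have "\<exists>!k. k \<in> linear_maps R L N \<and> (\<forall>x\<in>generators Q. k (\<eta> x) = h (\<eta> x))"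
    using assms(1,2) by (auto simp: presents_def)
  then show ?thesis
    using assms(4-6) by (elim ex1E) metis
qed

text \<open>The same module presents both sets of facts, with universal element precomposed by the
  renaming. Hence presentations by countably many elements of any module can be rewritten over the
  natural numbers, which leaves a small set of them.\<close>

lemma presents_rename:
  assumes e: "inj_on e (generators Q)" and pres: "presents \<kappa> R (map_fact id e ` Q) L \<eta>"
  shows "presents \<kappa> R Q L (\<lambda>x. \<eta> (e x))"
proof -
  have gen: "generators (map_fact id e ` Q) = e ` generators Q"
    by (auto simp: generators_def fact.set_map)
  have 1: "(\<lambda>x. f (e x)) \<in> interps N Q \<longleftrightarrow> f \<in> interps N (map_fact id e ` Q)" for f N
    by (auto simp: interps_def gen holds_map_fact)
  have "\<exists>!h. h \<in> linear_maps R L N \<and> (\<forall>x\<in>generators Q. h (\<eta> (e x)) = f x)"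
    if N: "N \<in> Ob (Mod \<kappa> R)" and f: "f \<in> interps N Q" for N f
  proof -
    let ?g = "\<lambda>y. f (the_inv_into (generators Q) e y)"
    have g: "?g (e x) = f x" if "x \<in> generators Q" for x
      using the_inv_into_f_f[OF e that] by simp
    have "?g \<in> interps N (map_fact id e ` Q)"
      using f interps_cong[of Q "\<lambda>x. ?g (e x)" f N] g 1[of ?g N] by blast
    then have "\<exists>!h. h \<in> linear_maps R L N \<and> (\<forall>x\<in>generators (map_fact id e ` Q). h (\<eta> x) = ?g x)"
      using pres N by (auto simp: presents_def)
    then show ?thesis
      using g by (simp add: gen)
  qed
  then show ?thesis
    using pres 1[of \<eta> L] by (simp add: presents_def)
qed


section \<open>Existence of presented modules\<close>

text \<open>\<open>Zero\<close> is a constructor of its own because a presentation may have no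
  generators, and then no other term could start the recursion.\<close>

datatype (tm_scalars: 'r, tm_gens: 'x) tm =
  Gen 'x | Zero | Act 'r "('r, 'x) tm" | Sum "nat \<Rightarrow> ('r, 'x) tm"

text \<open>
  A term is a tree with countable branching; recording the label at each address, and repeating the
  label of a leaf below it, bounds the number of terms by a countable power.
\<close>

primrec tm_labels :: "('r, 'x) tm \<Rightarrow> nat list \<Rightarrow> 'x + 'r option option" where
  "tm_labels (Gen x) = (\<lambda>_. Inl x)"
| "tm_labels Zero = (\<lambda>_. Inr None)"
| "tm_labels (Act r t) = (\<lambda>p. case p of [] \<Rightarrow> Inr (Some (Some r)) | _ # q \<Rightarrow> tm_labels t q)"
| "tm_labels (Sum ts) = (\<lambda>p. case p of [] \<Rightarrow> Inr (Some None) | n # q \<Rightarrow> tm_labels (ts n) q)"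

text \<open>The root label reveals the constructor together with its generator or scalar; the labels
  at longer addresses are those of the immediate subterms, to which induction applies.\<close>

lemma inj_tm_labels: "inj tm_labels"
proof (rule injI)
  show "tm_labels s = tm_labels t \<Longrightarrow> s = t" for s t :: "('r, 'x) tm"
  proof (induction s arbitrary: t)
    case (Gen x)
    show ?case
      using fun_cong[OF Gen, of "[]"] by (cases t) simp_all
  next
    case Zero
    show ?case
      using fun_cong[OF Zero, of "[]"] by (cases t) simp_all
  next
    case (Act r s)
    obtain t' where t': "t = Act r t'"
      using fun_cong[OF Act.prems, of "[]"] by (cases t) simp_all
    \<comment> \<open>Below an \<open>Act\<close> the first index of an address is ignored, so 0
      stands for any index.\<close>
    have "tm_labels s = tm_labels t'"
      using fun_cong[OF Act.prems, of "0 # p" for p] t' by (intro ext) simp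
    then show ?case
      using Act.IH t' by simp
  next
    case (Sum ss)
    obtain ts where ts: "t = Sum ts"
      using fun_cong[OF Sum.prems, of "[]"] by (cases t) simp_all
    have "tm_labels (ss n) = tm_labels (ts n)" for n
      using fun_cong[OF Sum.prems, of "n # p" for p] ts by (intro ext) simp
    then have "ss n = ts n" for n
      by (rule Sum.IH[OF rangeI])
    then show ?case
      using ts by (simp add: fun_eq_iff)
  qed
qed

lemma range_tm_labels:
  "tm_labels t p \<in> Inl ` tm_gens t \<union> Inr ` insert None (Some ` insert None (Some ` tm_scalars t))"
proof (induction t arbitrary: p)
  case (Act r t)
  show ?case
    using Act.IH by (cases p) auto
next
  case (Sum ts)
  show ?case
    using Sum.IH[OF rangeI] by (cases p) (simp, fastforce)
qed auto

lemma small_tms: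
  fixes S :: "'r set" and X :: "'x set"
  assumes univ: "universe \<kappa>" and S: "small \<kappa> S" and X: "small \<kappa> X"
  shows "small \<kappa> {t. tm_scalars t \<subseteq> S \<and> tm_gens t \<subseteq> X}" (is "small \<kappa> ?T")
proof (rule small_inj_on)
  let ?c = "\<lambda>t n. tm_labels t (from_nat n)"
  have "small \<kappa> (Inl ` X \<union> Inr ` insert None (Some ` insert None (Some ` S)))"
    by (intro small_Un[OF univ] small_insert[OF univ] small_image S X)
  note small = small_sequences[OF univ this]
  have "?c t n \<in> Inl ` X \<union> Inr ` insert None (Some ` insert None (Some ` S))" if "t \<in> ?T" for t n
    using range_tm_labels[of t "from_nat n"] that by blast
  then show "small \<kappa> (?c ` ?T)"
    by (intro small_subset[OF small]) blast
  show "inj_on ?c ?T"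
  proof (rule inj_onI)
    fix s t :: "('r, 'x) tm" assume eq: "?c s = ?c t"
    have "tm_labels s p = tm_labels t p" for p
      using fun_cong[OF eq, of "to_nat p"] by simp
    then show "s = t"
      by (intro injD[OF inj_tm_labels]) (simp add: fun_eq_iff)
  qed
qed

primrec tm_eval :: "('r, 'a) rmod \<Rightarrow> ('x \<Rightarrow> 'a) \<Rightarrow> ('r, 'x) tm \<Rightarrow> 'a option" where
  "tm_eval N f (Gen x) = Some (f x)"
| "tm_eval N f Zero = Some (zero N)"
| "tm_eval N f (Act r t) = map_option (act N r) (tm_eval N f t)"
| "tm_eval N f (Sum ts) = Sums_opt N (\<lambda>n. tm_eval N f (ts n))"

lemma tm_eval_closed:
  assumes "r_module R N"
  shows "tm_eval N f t = Some v \<Longrightarrow> tm_scalars t \<subseteq> carrier R \<Longrightarrow> f ` tm_gens t \<subseteq> carrier N \<Longrightarrow> v \<in> carrier N"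
proof (induction t arbitrary: v)
  case (Sum ts)
  then obtain u where u: "\<And>n. tm_eval N f (ts n) = Some (u n)" and v: "Sums N u = Some v"
    by (auto simp: Sums_opt_eq_Some fun_eq_iff)
  have "u n \<in> carrier N" for n
    by (rule Sum.IH[OF rangeI u]) (use Sum.prems in fastforce)+
  then show ?case
    by (rule sigma_monoid.Sums_closed[OF _ _ v, rotated]) (use assms in \<open>simp add: r_module_def\<close>)
qed (use assms in \<open>auto intro: r_module.act_closed sigma_monoid.zero_closed simp: r_module_def\<close>)

text \<open>
  The carrier of the presented module consists of the terms that are defined in every
  interpretation, modulo equality in every interpretation. No congruence has to be generated.
\<close>

theorem presents_exists:
  fixes \<kappa> :: "'u rel" and R :: "('r, 'z) sigma_sring_scheme" and Q :: "('r, 'x) fact set"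
  assumes univ: "universe \<kappa>" and R: "sigma_semiring R" and smallR: "small \<kappa> (carrier R)"
    and scal: "\<And>\<phi>. \<phi> \<in> Q \<Longrightarrow> scalars \<phi> \<subseteq> carrier R" and smallQ: "small \<kappa> (generators Q)"
  obtains L :: "('r, 'u) rmod" and \<eta> where "presents \<kappa> R Q L \<eta>"
proof -
  \<comment> \<open>\<open>A\<close> indexes the components of the initial structure. Its size is
    irrelevant to \<open>r_module_initial\<close>; carriers in \<open>'u\<close> make it a
    set.\<close>
  define A where "A = {(N, f). N \<in> Ob (Mod \<kappa> R) \<and> f \<in> interps N Q}"
  define T where "T = {t. tm_scalars t \<subseteq> carrier R \<and> tm_gens t \<subseteq> generators Q \<and>
     (\<forall>a\<in>A. tm_eval (fst a) (snd a) t \<noteq> None)}"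
  define val :: "('r, 'u) rmod \<times> ('x \<Rightarrow> 'u) \<Rightarrow> ('r, 'x) tm \<Rightarrow> 'u" where "val = (\<lambda>a t. the (tm_eval (fst a) (snd a) t))"
  have modA: "r_module R (fst a)" if "a \<in> A" for a
    using that by (auto simp: A_def)
  have intA: "snd a \<in> interps (fst a) Q" if "a \<in> A" for a
    using that by (auto simp: A_def)
  have val: "tm_eval (fst a) (snd a) t = Some (val a t)" if "a \<in> A" "t \<in> T" for a t
    using that by (auto simp: T_def val_def)
  have val_closed: "val a t \<in> carrier (fst a)" if "a \<in> A" "t \<in> T" for a t
  proof (rule tm_eval_closed[OF modA val])
    have "tm_gens t \<subseteq> generators Q" "snd a ` generators Q \<subseteq> carrier (fst a)"
      using that intA by (auto simp: T_def interps_def)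
    then show "snd a ` tm_gens t \<subseteq> carrier (fst a)"
      by blast
  qed (use that in \<open>auto simp: T_def\<close>)
  have "small \<kappa> T"
    using small_tms[OF univ smallR smallQ] by (rule small_subset) (auto simp: T_def)
  \<comment> \<open>\<open>cl\<close> names in \<open>'u\<close> the tuple of all values of a term.
    Restricting the tuple to \<open>A\<close> leaves no junk coordinates to distinguish
    terms.\<close>
  then obtain cl :: "('r, 'x) tm \<Rightarrow> 'u" where
      cl: "\<And>s t. s \<in> T \<Longrightarrow> t \<in> T \<Longrightarrow> cl s = cl t \<longleftrightarrow> (\<lambda>a\<in>A. val a s) = (\<lambda>a\<in>A. val a t)"
    by (rule small_classify[where F = "\<lambda>t. \<lambda>a\<in>A. val a t"]) (rule that)
  define rep where "rep = inv_into T cl"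
  define p where "p = (\<lambda>a b. val a (rep b))"
  have rep: "rep b \<in> T" "cl (rep b) = b" if "b \<in> cl ` T" for b
    using that by (auto simp: rep_def inv_into_into f_inv_into_f)
  have cl_eqD: "val a s = val a t" if "cl s = cl t" "a \<in> A" "s \<in> T" "t \<in> T" for a s t
    using that(1) unfolding cl[OF that(3,4)] by (metis restrict_apply' that(2))
  have cl_eqI: "cl s = cl t" if "\<And>a. a \<in> A \<Longrightarrow> val a s = val a t" "s \<in> T" "t \<in> T" for s t
    using that cl by (simp add: restrict_def fun_eq_iff)
  have p_cl: "p a (cl t) = val a t" if "a \<in> A" "t \<in> T" for a t
    using that rep[of "cl t"] by (auto simp: p_def intro: cl_eqD)
  have p_closed: "p a b \<in> carrier (fst a)" if "a \<in> A" "b \<in> cl ` T" for a b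
    using that rep by (simp add: p_def val_closed)
  have p_inj: "b = b'" if "b \<in> cl ` T" "b' \<in> cl ` T" "\<And>a. a \<in> A \<Longrightarrow> p a b = p a b'" for b b'
    using cl_eqI[of "rep b" "rep b'"] rep that by (simp add: p_def)
  have T_Zero: "Zero \<in> T" "\<And>a. a \<in> A \<Longrightarrow> val a Zero = zero (fst a)"
    by (auto simp: T_def val_def)
  have T_Gen: "Gen x \<in> T" "a \<in> A \<Longrightarrow> val a (Gen x) = snd a x" if "x \<in> generators Q" for x a
    using that by (auto simp: T_def val_def)
  have T_Act: "Act r t \<in> T" "a \<in> A \<Longrightarrow> val a (Act r t) = act (fst a) r (val a t)"
    if "r \<in> carrier R" "t \<in> T" for r t a
    using that val[of a t] by (auto simp: T_def val_def)
  have Act_D: "r \<in> carrier R" "t \<in> T" if "Act r t \<in> T" for r t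
    using that by (auto simp: T_def)
  have eval_Sum: "tm_eval (fst a) (snd a) (Sum ts) = Sums (fst a) (\<lambda>n. val a (ts n))"
    if "a \<in> A" "\<And>n. ts n \<in> T" for a ts
    using val[OF that(1) that(2)] by (simp add: Sums_opt_def cong: if_cong)
  \<comment> \<open>Existence of all component sums is membership of the formal sum in
    \<open>T\<close>. This supplies \<open>Sums_defined\<close>, for which the formal sum itself is
    the required value.\<close>
  have Sum_iff: "Sum ts \<in> T \<longleftrightarrow> (\<forall>a\<in>A. Sums (fst a) (\<lambda>n. val a (ts n)) \<noteq> None)"
    if ts: "\<And>n. ts n \<in> T" for ts
  proof -
    have "tm_scalars (Sum ts) \<subseteq> carrier R \<and> tm_gens (Sum ts) \<subseteq> generators Q"
      using ts by (auto simp: T_def)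
    moreover have "tm_eval (fst a) (snd a) (Sum ts) = Sums (fst a) (\<lambda>n. val a (ts n))" if "a \<in> A" for a
      using that ts by (rule eval_Sum)
    ultimately show ?thesis
      unfolding T_def by simp
  qed
  have Sum_val: "Sums (fst a) (\<lambda>n. val a (ts n)) = Some (val a (Sum ts))"
    if "a \<in> A" "\<And>n. ts n \<in> T" "Sum ts \<in> T" for a ts
    using eval_Sum[of a ts, OF that(1,2)] val[OF that(1,3)] by simp
  \<comment> \<open>\<open>Sums_opt\<close> is strict, so definedness passes to subterms; the
    induction for uniqueness relies on \<open>T\<close> being closed under them.\<close>
  have Sum_D: "ts n \<in> T" if "Sum ts \<in> T" for ts n
  proof -
    have "tm_eval (fst a) (snd a) (ts n) \<noteq> None" if "a \<in> A" for a
    proof -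
      have "tm_eval (fst a) (snd a) (Sum ts) \<noteq> None"
        using that \<open>Sum ts \<in> T\<close> unfolding T_def by blast
      then show ?thesis
        by (auto simp: Sums_opt_def split: if_splits)
    qed
    moreover have "tm_scalars (ts n) \<subseteq> tm_scalars (Sum ts)" "tm_gens (ts n) \<subseteq> tm_gens (Sum ts)"
      by auto
    ultimately show ?thesis
      using that unfolding T_def by blast
  qed

  \<comment> \<open>Choosing representatives is harmless: both membership of a formal sum in
    \<open>T\<close> and its class depend only on the values of the summands.\<close>
  define L :: "('r, 'u) rmod" where "L = \<lparr>carrier = cl ` T, zero = cl Zero,
    Sums = (\<lambda>x. if Sum (\<lambda>n. rep (x n)) \<in> T then Some (cl (Sum (\<lambda>n. rep (x n)))) else None),
    act = (\<lambda>r b. cl (Act r (rep b)))\<rparr>"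
  have L: "carrier L = cl ` T" "zero L = cl Zero"
    by (simp_all add: L_def)
  have L_act: "act L r b \<in> cl ` T" "a \<in> A \<Longrightarrow> p a (act L r b) = act (fst a) r (p a b)"
    if "r \<in> carrier R" "b \<in> cl ` T" for a r b
    using T_Act[OF that(1) rep(1)[OF that(2)]] by (simp_all add: L_def p_cl) (simp add: p_def)
  have L_Sums_defined: "Sums L x \<noteq> None"
    if "\<And>n. x n \<in> cl ` T" "\<And>a. a \<in> A \<Longrightarrow> Sums (fst a) (\<lambda>n. p a (x n)) \<noteq> None" for x
    using that rep Sum_iff[of "\<lambda>n. rep (x n)"] by (simp add: L_def p_def)
  have L_Sums: "Sums L x = Some v \<longleftrightarrow>
      v \<in> cl ` T \<and> (\<forall>a\<in>A. Sums (fst a) (\<lambda>n. p a (x n)) = Some (p a v))" (is "_ \<longleftrightarrow> ?P v")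
    if x: "\<And>n. x n \<in> cl ` T" for x v
  proof -
    have 1: "?P v" if "Sums L x = Some v" for v
    proof -
      have S: "Sum (\<lambda>n. rep (x n)) \<in> T" "v = cl (Sum (\<lambda>n. rep (x n)))"
        using that by (auto simp: L_def split: if_splits)
      have "Sums (fst a) (\<lambda>n. p a (x n)) = Some (p a v)" if a: "a \<in> A" for a
        using Sum_val[of a "\<lambda>n. rep (x n)", OF a rep(1)[OF x] S(1)] p_cl[OF a S(1)] S(2)
        by (simp add: p_def)
      with S show ?thesis
        by blast
    qed
    show ?thesis
    proof
      assume v: "?P v"
      \<comment> \<open>The candidate \<open>v\<close> serves first to show that all component sums
        exist; the resulting value is then identified with \<open>v\<close> by joint
        injectivity.\<close>
      have "Sums L x \<noteq> None"
        by (rule L_Sums_defined[OF x]) (use v in simp)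
      then obtain w where w: "Sums L x = Some w"
        by blast
      have "w = v"
      proof (rule p_inj)
        show "p a w = p a v" if "a \<in> A" for a
          using bspec[OF conjunct2[OF 1[OF w]] that] bspec[OF conjunct2[OF v] that] by simp
      qed (use 1[OF w] v in simp_all)
      with w show "Sums L x = Some v"
        by simp
    qed (rule 1)
  qed
  have modL: "r_module R L"
  proof (rule r_module_initial[where N = fst and p = p and A = A, OF R modA])
    show "p a b \<in> carrier (fst a)" if "a \<in> A" "b \<in> carrier L" for a b
      using that unfolding L by (rule p_closed)
    show "b = b'" if "b \<in> carrier L" "b' \<in> carrier L" "\<And>a. a \<in> A \<Longrightarrow> p a b = p a b'" for b b'
      using that unfolding L by (rule p_inj)
    show "zero L \<in> carrier L"
      unfolding L by (rule imageI[OF T_Zero(1)])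
    show "p a (zero L) = zero (fst a)" if "a \<in> A" for a
      using p_cl[OF that T_Zero(1)] T_Zero(2)[OF that] by (simp add: L)
    show "act L r b \<in> carrier L" if "r \<in> carrier R" "b \<in> carrier L" for r b
      using that unfolding L by (rule L_act(1))
    show "p a (act L r b) = act (fst a) r (p a b)" if "a \<in> A" "r \<in> carrier R" "b \<in> carrier L" for a r b
      using that(2,3,1) unfolding L by (rule L_act(2))
    show "Sums L x = Some v \<longleftrightarrow> v \<in> carrier L \<and> (\<forall>a\<in>A. Sums (fst a) (\<lambda>n. p a (x n)) = Some (p a v))"
      if "\<And>n. x n \<in> carrier L" for x v
      using that unfolding L by (rule L_Sums)
    show "Sums L x \<noteq> None"
      if "\<And>n. x n \<in> carrier L" "\<And>a. a \<in> A \<Longrightarrow> Sums (fst a) (\<lambda>n. p a (x n)) \<noteq> None" for x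
      using that unfolding L by (rule L_Sums_defined)
  qed
  have ObL: "L \<in> Ob (Mod \<kappa> R)"
    using modL small_image[OF \<open>small \<kappa> T\<close>, of cl] by (simp add: L)
  define \<eta> where "\<eta> = (\<lambda>x. cl (Gen x))"
  have \<eta>: "\<eta> x \<in> cl ` T" "a \<in> A \<Longrightarrow> p a (\<eta> x) = snd a x" if "x \<in> generators Q" for x a
    using T_Gen[OF that] by (auto simp: \<eta>_def p_cl)
  \<comment> \<open>Every component of \<eta> is an interpretation of \<open>Q\<close>, and sums and
    actions in \<open>L\<close> are detected by components, so \<eta> satisfies the facts
    too.\<close>
  have "holds L \<eta> \<phi>" if "\<phi> \<in> Q" for \<phi>
  proof (cases \<phi>)
    case (SumF x v)
    have gen: "x n \<in> generators Q" "v \<in> generators Q" for n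
      using that SumF by (auto simp: generators_def intro!: bexI[of _ \<phi>])
    have "holds (fst a) (snd a) \<phi>" if "a \<in> A" for a
      using intA[OF that] \<open>\<phi> \<in> Q\<close> by (simp add: interps_def)
    then show ?thesis
      using SumF gen \<eta> by (simp add: L_Sums)
  next
    case (ActF r x y)
    have gen: "x \<in> generators Q" "y \<in> generators Q" "r \<in> carrier R"
      using that ActF scal[OF that] by (auto simp: generators_def intro!: bexI[of _ \<phi>])
    have "act L r (\<eta> x) = \<eta> y"
    proof (rule p_inj)
      show "act L r (\<eta> x) \<in> cl ` T"
        using L_act(1)[OF gen(3) \<eta>(1)[OF gen(1)]] .
      show "\<eta> y \<in> cl ` T"
        using \<eta>(1)[OF gen(2)] .
      fix a assume a: "a \<in> A"
      have "holds (fst a) (snd a) \<phi>"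
        using intA[OF a] \<open>\<phi> \<in> Q\<close> by (simp add: interps_def)
      then show "p a (act L r (\<eta> x)) = p a (\<eta> y)"
        using L_act(2)[OF gen(3) \<eta>(1)[OF gen(1)] a] \<eta>(2)[OF _ a] gen ActF by simp
    qed
    then show ?thesis
      using ActF by simp
  qed
  then have \<eta>_int: "\<eta> \<in> interps L Q"
    using \<eta> by (auto simp: interps_def L)
  have "\<exists>!h. h \<in> linear_maps R L N \<and> (\<forall>x\<in>generators Q. h (\<eta> x) = f x)"
    if N: "N \<in> Ob (Mod \<kappa> R)" and f: "f \<in> interps N Q" for N f
  proof (rule ex_ex1I)
    have a: "(N, f) \<in> A"
      using N f by (simp add: A_def)
    \<comment> \<open>The lift of an interpretation is evaluation at it, since \<open>(N, f)\<close>
      is one of the indices in \<open>A\<close>.\<close>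
    have "restrict (p (N, f)) (carrier L) \<in> linear_maps R L N"
    proof (rule linear_mapsI; unfold L)
      show "p (N, f) b \<in> carrier N" if "b \<in> cl ` T" for b
        using p_closed[OF a that] by simp
      show "p (N, f) (cl Zero) = zero N"
        using p_cl[OF a T_Zero(1)] T_Zero(2)[OF a] by simp
      show "v \<in> cl ` T \<and> Sums N (\<lambda>n. p (N, f) (x n)) = Some (p (N, f) v)"
        if "\<And>n. x n \<in> cl ` T" "Sums L x = Some v" for x v
        using L_Sums[where x = x and v = v, OF that(1)] that(2) a by auto
      show "act L r b \<in> cl ` T \<and> p (N, f) (act L r b) = act N r (p (N, f) b)"
        if "r \<in> carrier R" "b \<in> cl ` T" for r b
        using L_act(1)[OF that] L_act(2)[OF that a] by simp
    qed (rule imageI[OF T_Zero(1)])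
    then show "\<exists>h. h \<in> linear_maps R L N \<and> (\<forall>x\<in>generators Q. h (\<eta> x) = f x)"
      using \<eta>(1) \<eta>(2)[OF _ a] by (intro exI[of _ "restrict (p (N, f)) (carrier L)"]) (simp add: L)
  next
    fix h h'
    assume "h \<in> linear_maps R L N \<and> (\<forall>x\<in>generators Q. h (\<eta> x) = f x)"
      and "h' \<in> linear_maps R L N \<and> (\<forall>x\<in>generators Q. h' (\<eta> x) = f x)"
    then have h: "h \<in> linear_maps R L N" "h' \<in> linear_maps R L N"
      and eq: "\<And>x. x \<in> generators Q \<Longrightarrow> h (\<eta> x) = h' (\<eta> x)"
      by auto
    \<comment> \<open>Every class is built from classes of generators by zero, actions and sums of
      \<open>L\<close>, so linear maps agreeing on generators agree on all terms.\<close>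
    have "t \<in> T \<Longrightarrow> h (cl t) = h' (cl t)" for t
    proof (induction t)
      case (Gen x)
      then show ?case
        using eq[of x] by (auto simp: \<eta>_def T_def)
    next
      case Zero
      then show ?case
        using h[THEN linear_maps_zero] by (simp add: L)
    next
      case (Act r t)
      note rt = Act_D[OF Act.prems]
      have "act L r (cl t) = cl (Act r t)"
      proof (rule p_inj)
        show "p a (act L r (cl t)) = p a (cl (Act r t))" if "a \<in> A" for a
          using L_act(2)[OF rt(1) imageI[OF rt(2)] that] T_Act(2)[OF rt that] p_cl[OF that rt(2)] p_cl[OF that Act.prems]
          by simp
      qed (use L_act(1) rt Act.prems in blast)+
      then show ?case
        using h[THEN linear_maps_act, of r "cl t"] Act.IH rt by (simp add: L)
    next
      case (Sum ts)
      note ts = Sum_D[OF Sum.prems]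
      have s: "Sums L (\<lambda>n. cl (ts n)) = Some (cl (Sum ts))"
      proof (subst L_Sums)
        show "cl (ts n) \<in> cl ` T" for n
          using ts by (rule imageI)
        show "cl (Sum ts) \<in> cl ` T \<and>
            (\<forall>a\<in>A. Sums (fst a) (\<lambda>n. p a (cl (ts n))) = Some (p a (cl (Sum ts))))"
          using Sum_val[of _ ts, OF _ ts Sum.prems] Sum.prems ts by (simp add: p_cl)
      qed
      have "Sums N (\<lambda>n. h (cl (ts n))) = Some (h (cl (Sum ts)))"
        "Sums N (\<lambda>n. h' (cl (ts n))) = Some (h' (cl (Sum ts)))"
        using h[THEN linear_maps_Sums, OF _ s] ts by (auto simp: L)
      then show ?case
        using Sum.IH[OF rangeI ts] by simp
    qed
    then show "h = h'"
      by (intro linear_maps_eqI[OF h]) (auto simp: L)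
  qed
  then have "presents \<kappa> R Q L \<eta>"
    using ObL \<eta>_int unfolding presents_def by blast
  then show ?thesis
    by (rule that)
qed


section \<open>Cocompleteness\<close>

lemma compose_eq_iff:
  "f \<in> A \<rightarrow>\<^sub>E B \<Longrightarrow> compose A h g = f \<longleftrightarrow> (\<forall>x\<in>A. h (g x) = f x)"
  by (auto simp: compose_def fun_eq_iff PiE_iff extensional_def)

text \<open>Generators are pairs of an object \<open>j\<close> of the diagram and an element of its
  module. \<open>Q1\<close> and \<open>Q2\<close> make each map \<open>x \<mapsto> (j, x)\<close>
  linear and \<open>Q3\<close> makes these maps compatible, so interpretations of \<open>Q\<close>
  amount to cocones and the representing module is the colimit.\<close>

theorem cocomplete_Mod:
  fixes \<kappa> :: "'u rel" and R :: "('r, 'z) sigma_sring_scheme"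
  assumes univ: "universe \<kappa>" and R: "sigma_semiring R" and smallR: "small \<kappa> (carrier R)"
  shows "cocomplete \<kappa> (Mod \<kappa> R)"
  unfolding cocomplete_def
proof (intro conjI allI impI category_Mod)
  interpret R: sigma_semiring R by fact
  fix J :: "('u, 'u) cat" and Fo Fm
  assume "small_cat \<kappa> J \<and> is_functor J (Mod \<kappa> R) Fo Fm"
  then have smallJ: "small \<kappa> (Ob J)" and F: "is_functor J (Mod \<kappa> R) Fo Fm"
    by (auto simp: small_cat_def)
  have Fo: "r_module R (Fo j)" "small \<kappa> (carrier (Fo j))" if "j \<in> Ob J" for j
    using F that by (auto simp: is_functor_def)
  have Fm: "Fm j k f \<in> linear_maps R (Fo j) (Fo k)" if "j \<in> Ob J" "k \<in> Ob J" "f \<in> Hom J j k" for j k f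
    using F that by (auto simp: is_functor_def)
  define Q1 :: "('r, 'u \<times> 'u) fact set" where "Q1 = {SumF (\<lambda>n. (j, x n)) (j, v) | j x v.
      j \<in> Ob J \<and> (\<forall>n. x n \<in> carrier (Fo j)) \<and> Sums (Fo j) x = Some v}"
  define Q2 where "Q2 = {ActF r (j, x) (j, act (Fo j) r x) | r j x.
      r \<in> carrier R \<and> j \<in> Ob J \<and> x \<in> carrier (Fo j)}"
  \<comment> \<open>Multiplication by one turns the identification of an element with its image into
    a fact.\<close>
  define Q3 where "Q3 = {ActF (one R) (j, x) (k, Fm j k f x) | j k f x.
      j \<in> Ob J \<and> k \<in> Ob J \<and> f \<in> Hom J j k \<and> x \<in> carrier (Fo j)}"
  define Q where "Q = Q1 \<union> Q2 \<union> Q3"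
  have gen: "generators Q = Sigma (Ob J) (\<lambda>j. carrier (Fo j))"
  proof
    have "generators Q1 \<subseteq> Sigma (Ob J) (\<lambda>j. carrier (Fo j))"
    proof
      fix y assume "y \<in> generators Q1"
      then obtain \<phi> where "\<phi> \<in> Q1" and "y \<in> gens \<phi>"
        by (auto simp: generators_def)
      from \<open>\<phi> \<in> Q1\<close> obtain j x v where *: "j \<in> Ob J" "\<And>n. x n \<in> carrier (Fo j)" "Sums (Fo j) x = Some v"
          and \<phi>: "\<phi> = SumF (\<lambda>n. (j, x n)) (j, v)"
        unfolding Q1_def by auto
      interpret M: r_module R "Fo j" by (rule Fo[OF *(1)])
      show "y \<in> Sigma (Ob J) (\<lambda>j. carrier (Fo j))"
        using *(1,2) M.Sums_closed[OF *(2,3)] \<open>y \<in> gens \<phi>\<close> unfolding \<phi> by auto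
    qed
    moreover have "generators Q2 \<subseteq> Sigma (Ob J) (\<lambda>j. carrier (Fo j))"
      using r_module.act_closed[OF Fo(1)] by (auto simp: generators_def Q2_def)
    moreover have "generators Q3 \<subseteq> Sigma (Ob J) (\<lambda>j. carrier (Fo j))"
      using linear_maps_closed[OF Fm] by (auto simp: generators_def Q3_def)
    ultimately show "generators Q \<subseteq> Sigma (Ob J) (\<lambda>j. carrier (Fo j))"
      by (auto simp: Q_def generators_def)
    \<comment> \<open>The unit facts in \<open>Q2\<close> ensure that every pair occurs as a
      generator.\<close>
    show "Sigma (Ob J) (\<lambda>j. carrier (Fo j)) \<subseteq> generators Q"
    proof (clarify)
      fix j x assume "j \<in> Ob J" "x \<in> carrier (Fo j)"
      then have "ActF (one R) (j, x) (j, act (Fo j) (one R) x) \<in> Q"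
        using R.one_closed by (auto simp: Q_def Q2_def)
      then show "(j, x) \<in> generators Q"
        unfolding generators_def by (rule UN_I) simp
    qed
  qed
  have scal: "scalars \<phi> \<subseteq> carrier R" if "\<phi> \<in> Q" for \<phi>
    using that R.one_closed by (auto simp: Q_def Q1_def Q2_def Q3_def)
  have "small \<kappa> (generators Q)"
    unfolding gen by (intro small_Sigma[OF univ smallJ] Fo)
  then obtain L and \<eta> :: "'u \<times> 'u \<Rightarrow> 'u" where pres: "presents \<kappa> R Q L \<eta>"
    using presents_exists[OF univ R smallR scal] by blast
  define c where "c = (\<lambda>j. \<lambda>x\<in>carrier (Fo j). \<eta> (j, x))"
  have cocone: "is_cocone J (Mod \<kappa> R) Fo Fm N (\<lambda>j. \<lambda>x\<in>carrier (Fo j). f (j, x))"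
    if N: "N \<in> Ob (Mod \<kappa> R)" and f: "f \<in> interps N Q" for N f
  proof -
    interpret N: r_module R N using N by simp
    have fcl: "f (j, x) \<in> carrier N" if "j \<in> Ob J" "x \<in> carrier (Fo j)" for j x
      using f that by (auto simp: interps_def gen)
    have hold: "holds N f \<phi>" if "\<phi> \<in> Q" for \<phi>
      using f that by (simp add: interps_def)
    have "(\<lambda>x\<in>carrier (Fo j). f (j, x)) \<in> linear_maps R (Fo j) N" if j: "j \<in> Ob J" for j
    proof -
      interpret M: r_module R "Fo j" by (rule Fo[OF j])
      have act: "f (j, act (Fo j) r x) = act N r (f (j, x))" if "r \<in> carrier R" "x \<in> carrier (Fo j)" for r x
      proof -
        have "ActF r (j, x) (j, act (Fo j) r x) \<in> Q"
          using that j by (auto simp: Q_def Q2_def)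
        from hold[OF this] show ?thesis
          by simp
      qed
      show ?thesis
      proof (rule linear_mapsI)
        \<comment> \<open>The fact for scalar zero acting on the zero of \<open>Fo j\<close> forces
          its image to be zero in \<open>N\<close>.\<close>
        show "f (j, zero (Fo j)) = zero N"
          using act[OF R.zero_closed M.zero_closed] M.act_zero_left[OF M.zero_closed]
            N.act_zero_left[OF fcl[OF j M.zero_closed]] by simp
        show "v \<in> carrier (Fo j) \<and> Sums N (\<lambda>i. f (j, x i)) = Some (f (j, v))"
          if x: "\<And>i. x i \<in> carrier (Fo j)" and v: "Sums (Fo j) x = Some v" for x v
        proof -
          have "SumF (\<lambda>n. (j, x n)) (j, v) \<in> Q"
            using x v j by (auto simp: Q_def Q1_def)
          from hold[OF this] show ?thesis
            using M.Sums_closed[OF x v] by simp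
        qed
      qed (use fcl j act M.zero_closed M.act_closed in auto)
    qed
    moreover have "f (k, Fm j k g x) = f (j, x)"
      if *: "j \<in> Ob J" "k \<in> Ob J" "g \<in> Hom J j k" "x \<in> carrier (Fo j)" for j k g x
    proof -
      have "ActF (one R) (j, x) (k, Fm j k g x) \<in> Q"
        using * by (auto simp: Q_def Q3_def)
      from hold[OF this] show ?thesis
        using N.act_one[OF fcl[OF *(1,4)]] by simp
    qed
    ultimately show ?thesis
      using N Fm by (auto simp: is_cocone_def compose_def fun_eq_iff linear_maps_closed[OF Fm])
  qed
  have interp: "(\<lambda>(j, x). d j x) \<in> interps N Q"
    if "is_cocone J (Mod \<kappa> R) Fo Fm N d" for N d
  proof -
    have N: "r_module R N" and d: "\<And>j. j \<in> Ob J \<Longrightarrow> d j \<in> linear_maps R (Fo j) N"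
      and d_eq: "\<And>j k f. j \<in> Ob J \<Longrightarrow> k \<in> Ob J \<Longrightarrow> f \<in> Hom J j k \<Longrightarrow>
        compose (carrier (Fo j)) (d k) (Fm j k f) = d j"
      using that by (auto simp: is_cocone_def)
    interpret N: r_module R N by fact
    have "holds N (\<lambda>(j, x). d j x) \<phi>" if "\<phi> \<in> Q" for \<phi>
    proof -
      have "holds N (\<lambda>(j, x). d j x) \<phi>" if "\<phi> \<in> Q1"
        using that linear_maps_Sums[OF d] by (auto simp: Q1_def)
      moreover have "holds N (\<lambda>(j, x). d j x) \<phi>" if "\<phi> \<in> Q2"
        using that linear_maps_act[OF d] by (auto simp: Q2_def)
      moreover have "holds N (\<lambda>(j, x). d j x) \<phi>" if \<phi>: "\<phi> \<in> Q3"
      proof -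
        obtain j k f x where *: "\<phi> = ActF (one R) (j, x) (k, Fm j k f x)"
          "j \<in> Ob J" "k \<in> Ob J" "f \<in> Hom J j k" "x \<in> carrier (Fo j)"
          using \<phi> by (auto simp: Q3_def)
        have "d j x = d k (Fm j k f x)"
          using fun_cong[OF d_eq[OF *(2-4)], of x] *(5) by (simp add: compose_def)
        then show ?thesis
          using *(1) N.act_one[OF linear_maps_closed[OF d[OF *(2)] *(5)]] by simp
      qed
      ultimately show ?thesis
        using that by (auto simp: Q_def)
    qed
    then show ?thesis
      using d by (auto simp: interps_def gen linear_maps_closed[OF d])
  qed
  have "is_colimit J (Mod \<kappa> R) Fo Fm L c"
    unfolding is_colimit_def
  proof (intro conjI allI impI)
    show "is_cocone J (Mod \<kappa> R) Fo Fm L c"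
      unfolding c_def by (rule cocone[OF presents_closed(1,2)[OF pres]])
    fix N d assume d: "is_cocone J (Mod \<kappa> R) Fo Fm N d"
    then have N: "N \<in> Ob (Mod \<kappa> R)" and dl: "\<And>j. j \<in> Ob J \<Longrightarrow> d j \<in> linear_maps R (Fo j) N"
      by (auto simp: is_cocone_def)
    have "\<exists>!h. h \<in> linear_maps R L N \<and> (\<forall>y\<in>generators Q. h (\<eta> y) = (case y of (j, x) \<Rightarrow> d j x))"
      using pres N interp[OF d] unfolding presents_def by blast
    \<comment> \<open>Agreement on all pairs is agreement leg by leg, so unique lifting is literally
      the universal property of the cocone.\<close>
    moreover have "(\<forall>y\<in>generators Q. h (\<eta> y) = (case y of (j, x) \<Rightarrow> d j x)) \<longleftrightarrow>
        (\<forall>j\<in>Ob J. Comp (Mod \<kappa> R) (Fo j) L N h (c j) = d j)" for h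
      by (simp add: gen compose_eq_iff[OF linear_maps_PiE[OF dl]] c_def)
    ultimately show "\<exists>!h. h \<in> Hom (Mod \<kappa> R) L N \<and>
        (\<forall>j\<in>Ob J. Comp (Mod \<kappa> R) (Fo j) L N h (c j) = d j)"
      by simp
  qed
  then show "\<exists>L c. is_colimit J (Mod \<kappa> R) Fo Fm L c"
    by blast
qed


section \<open>Countably directed colimits\<close>

locale directed_diagram =
  fixes \<kappa> :: "'u rel" and R :: "('r, 'z) sigma_sring_scheme" and I :: "'u set" and r :: "'u rel"
    and D :: "'u \<Rightarrow> ('r, 'u) rmod" and Dm :: "'u \<Rightarrow> 'u \<Rightarrow> unit \<Rightarrow> 'u \<Rightarrow> 'u"
  assumes univ: "universe \<kappa>" and R: "sigma_semiring R"
    and dir: "directed_poset \<kappa> aleph_1 I r"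
    and func: "is_functor (poset_cat I r) (Mod \<kappa> R) D Dm"
begin

abbreviation t where "t i j \<equiv> Dm i j ()"

lemma poset: "r \<subseteq> I \<times> I" "refl_on I r" "trans r" "small \<kappa> I"
  using dir by (auto simp: directed_poset_def partial_order_on_def preorder_on_def)

lemma r_refl: "i \<in> I \<Longrightarrow> (i, i) \<in> r"
  using poset(2) by (rule refl_onD)

lemma r_trans: "(i, j) \<in> r \<Longrightarrow> (j, k) \<in> r \<Longrightarrow> (i, k) \<in> r"
  using poset(3) by (rule transD)

lemma r_Ob: assumes "(i, j) \<in> r" shows "i \<in> I" "j \<in> I"
  using poset(1) assms by auto

lemma upper_bound:
  assumes "countable X" "X \<subseteq> I"
  shows "\<exists>u\<in>I. \<forall>x\<in>X. (x, u) \<in> r"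
  using dir assms unfolding directed_poset_def countable_iff_ordLess_aleph_1 by blast

lemma upper_bound2:
  assumes "i \<in> I" "j \<in> I"
  obtains u where "(i, u) \<in> r" "(j, u) \<in> r"
  using upper_bound[of "{i, j}"] assms by auto

lemma D_Ob: "i \<in> I \<Longrightarrow> D i \<in> Ob (Mod \<kappa> R)"
  using func by (auto simp: is_functor_def poset_cat_def)

lemma D_mod: "i \<in> I \<Longrightarrow> r_module R (D i)"
  using D_Ob by simp

lemma t_linear:
  assumes "(i, j) \<in> r"
  shows "t i j \<in> linear_maps R (D i) (D j)"
  using func r_Ob[OF assms] assms by (simp add: is_functor_def poset_cat_def)

lemma t_closed: "(i, j) \<in> r \<Longrightarrow> x \<in> carrier (D i) \<Longrightarrow> t i j x \<in> carrier (D j)"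
  by (rule linear_maps_closed[OF t_linear])

lemma t_refl: "i \<in> I \<Longrightarrow> x \<in> carrier (D i) \<Longrightarrow> t i i x = x"
proof -
  have "\<forall>i\<in>Ob (poset_cat I r). Dm i i (Id (poset_cat I r) i) = Id (Mod \<kappa> R) (D i)"
    using func unfolding is_functor_def by (elim conjE)
  then show "i \<in> I \<Longrightarrow> x \<in> carrier (D i) \<Longrightarrow> t i i x = x"
    by (simp add: poset_cat_def)
qed

lemma t_trans:
  assumes "(i, j) \<in> r" "(j, k) \<in> r" "x \<in> carrier (D i)"
  shows "t j k (t i j x) = t i k x"
proof -
  have "\<forall>i\<in>Ob (poset_cat I r). \<forall>j\<in>Ob (poset_cat I r). \<forall>k\<in>Ob (poset_cat I r).
      \<forall>f\<in>Hom (poset_cat I r) i j. \<forall>g\<in>Hom (poset_cat I r) j k.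
      Dm i k (Comp (poset_cat I r) i j k g f) = Comp (Mod \<kappa> R) (D i) (D j) (D k) (Dm j k g) (Dm i j f)"
    using func unfolding is_functor_def by (elim conjE)
  then have "\<forall>i\<in>I. \<forall>j\<in>I. \<forall>k\<in>I. (i, j) \<in> r \<longrightarrow> (j, k) \<in> r \<longrightarrow>
      t i k = compose (carrier (D i)) (t j k) (t i j)"
    by (simp only: poset_cat_def cat.simps mem_Collect_eq Mod_simps Ball_def) blast
  then have "t i k = compose (carrier (D i)) (t j k) (t i j)"
    using r_Ob[OF assms(1)] r_Ob[OF assms(2)] assms(1,2) by blast
  then show ?thesis
    using assms(3) by (simp add: compose_def)
qed

text \<open>Eventual equality of stage elements, the relation by which a directed colimit of sets is
  a quotient of the disjoint union.\<close>

definition merge :: "'u \<times> 'u \<Rightarrow> 'u \<times> 'u \<Rightarrow> bool" where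
  "merge a b \<longleftrightarrow> (\<exists>k. (fst a, k) \<in> r \<and> (fst b, k) \<in> r \<and> t (fst a) k (snd a) = t (fst b) k (snd b))"

lemma merge_trans:
  assumes "merge a b" "merge b c"
    and "snd a \<in> carrier (D (fst a))" "snd b \<in> carrier (D (fst b))" "snd c \<in> carrier (D (fst c))"
  shows "merge a c"
proof -
  obtain k where k: "(fst a, k) \<in> r" "(fst b, k) \<in> r" "t (fst a) k (snd a) = t (fst b) k (snd b)"
    using assms(1) by (auto simp: merge_def)
  obtain l where l: "(fst b, l) \<in> r" "(fst c, l) \<in> r" "t (fst b) l (snd b) = t (fst c) l (snd c)"
    using assms(2) by (auto simp: merge_def)
  obtain m where m: "(k, m) \<in> r" "(l, m) \<in> r"
    using upper_bound2 r_Ob(2)[OF k(1)] r_Ob(2)[OF l(1)] by blast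
  have "t (fst a) m (snd a) = t k m (t (fst b) k (snd b))"
    using t_trans[OF k(1) m(1) assms(3)] k(3) by simp
  also have "\<dots> = t l m (t (fst b) l (snd b))"
    using t_trans[OF k(2) m(1) assms(4)] t_trans[OF l(1) m(2) assms(4)] by simp
  also have "\<dots> = t (fst c) m (snd c)"
    using t_trans[OF l(2) m(2) assms(5)] l(3) by simp
  finally show ?thesis
    using r_trans[OF k(1) m(1)] r_trans[OF l(2) m(2)] unfolding merge_def by blast
qed

end

text \<open>\<open>q i x\<close> is a name for the germ of \<open>x\<close> at stage
  \<open>i\<close>. Leaving the naming abstract allows two instances: names chosen freely in
  \<open>'u\<close>, which yield a concrete colimit, and the legs of an arbitrary given
  colimit.\<close>

locale directed_model = directed_diagram \<kappa> R I r D Dm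
  for \<kappa> :: "'u rel" and R :: "('r, 'z) sigma_sring_scheme" and I r D Dm +
  fixes q :: "'u \<Rightarrow> 'u \<Rightarrow> 'u"
  assumes q_eq: "\<And>i j x y. \<lbrakk>i \<in> I; j \<in> I; x \<in> carrier (D i); y \<in> carrier (D j)\<rbrakk> \<Longrightarrow>
      q i x = q j y \<longleftrightarrow> merge (i, x) (j, y)"
begin

section \<open>The module of germs\<close>

definition C :: "'u set" where "C = {q i x | i x. i \<in> I \<and> x \<in> carrier (D i)}"

lemma q_closed: "i \<in> I \<Longrightarrow> x \<in> carrier (D i) \<Longrightarrow> q i x \<in> C"
  by (auto simp: C_def)

lemma q_t: "(i, j) \<in> r \<Longrightarrow> x \<in> carrier (D i) \<Longrightarrow> q j (t i j x) = q i x"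
  using q_eq[of j i "t i j x" x] r_Ob[of i j] r_refl[of j] t_refl[of j "t i j x"] t_closed[of i j x]
  by (auto simp: merge_def)

text \<open>Each equality of germs is witnessed at its own stage, and a bound of these countably
  many stages witnesses all of them. Directedness for finite sets would not reach all entries of a
  sum at once.\<close>

lemma merge_all:
  assumes "\<And>n :: nat. i n \<in> I \<and> j n \<in> I \<and> x n \<in> carrier (D (i n)) \<and> y n \<in> carrier (D (j n)) \<and>
      q (i n) (x n) = q (j n) (y n)"
  obtains k where "\<And>n. (i n, k) \<in> r \<and> (j n, k) \<in> r \<and> t (i n) k (x n) = t (j n) k (y n)"
proof -
  have "\<exists>k. (i n, k) \<in> r \<and> (j n, k) \<in> r \<and> t (i n) k (x n) = t (j n) k (y n)" for n
    using assms[of n] q_eq[of "i n" "j n" "x n" "y n"] by (auto simp: merge_def)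
  then obtain k where k: "\<And>n. (i n, k n) \<in> r \<and> (j n, k n) \<in> r \<and> t (i n) (k n) (x n) = t (j n) (k n) (y n)"
    by metis
  have "range k \<subseteq> I"
    using k r_Ob(2) by blast
  then obtain u where "(k n, u) \<in> r" for n
    using upper_bound[of "range k"] by auto
  then have "(i n, u) \<in> r \<and> (j n, u) \<in> r \<and> t (i n) u (x n) = t (j n) u (y n)" for n
    using k[of n] assms[of n] r_trans t_trans[of "i n" "k n" u "x n"] t_trans[of "j n" "k n" u "y n"] by metis
  then show ?thesis
    by (rule that)
qed

lemma merge1:
  assumes "i \<in> I" "j \<in> I" "x \<in> carrier (D i)" "y \<in> carrier (D j)" "q i x = q j y"
  obtains k where "(i, k) \<in> r" "(j, k) \<in> r" "t i k x = t j k y"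
  using assms q_eq by (auto simp: merge_def)

text \<open>A relation rather than a function, since independence of the stage and of the
  representatives is only proved in \<open>has_Sum_unique\<close>.\<close>

definition has_Sum :: "(nat \<Rightarrow> 'u) \<Rightarrow> 'u \<Rightarrow> bool" where
  "has_Sum y v \<longleftrightarrow> (\<exists>i x w. i \<in> I \<and> (\<forall>n. x n \<in> carrier (D i) \<and> q i (x n) = y n) \<and>
     Sums (D i) x = Some w \<and> q i w = v)"

lemma has_SumI:
  "i \<in> I \<Longrightarrow> (\<And>n. x n \<in> carrier (D i)) \<Longrightarrow> (\<And>n. q i (x n) = y n) \<Longrightarrow> Sums (D i) x = Some w \<Longrightarrow>
    has_Sum y (q i w)"
  by (auto simp: has_Sum_def)

lemma has_SumE:
  assumes "has_Sum y v"
  obtains i x w where "i \<in> I" "\<And>n. x n \<in> carrier (D i)" "\<And>n. q i (x n) = y n" "Sums (D i) x = Some w"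
    "w \<in> carrier (D i)" "q i w = v"
proof -
  obtain i x w where *: "i \<in> I" "\<And>n. x n \<in> carrier (D i)" "\<And>n. q i (x n) = y n" "Sums (D i) x = Some w" "q i w = v"
    using assms by (auto simp: has_Sum_def)
  interpret r_module R "D i" by (rule D_mod[OF *(1)])
  show ?thesis
    using that[OF *(1-4) Sums_closed[OF *(2,4)] *(5)] .
qed

text \<open>At a stage where the two families of representatives agree entry by entry, both sums are
  pushed forward to the sum of the same family.\<close>

lemma has_Sum_unique:
  assumes "has_Sum y v" "has_Sum y v'"
  shows "v = v'"
proof -
  from assms(1) obtain i x w where i: "i \<in> I" "\<And>n. x n \<in> carrier (D i)" "\<And>n. q i (x n) = y n"
      "Sums (D i) x = Some w" "w \<in> carrier (D i)" "q i w = v"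
    by (rule has_SumE) (rule that)
  from assms(2) obtain j x' w' where j: "j \<in> I" "\<And>n. x' n \<in> carrier (D j)" "\<And>n. q j (x' n) = y n"
      "Sums (D j) x' = Some w'" "w' \<in> carrier (D j)" "q j w' = v'"
    by (rule has_SumE) (rule that)
  obtain k where k: "\<And>n. (i, k) \<in> r \<and> (j, k) \<in> r \<and> t i k (x n) = t j k (x' n)"
    using merge_all[of "\<lambda>_. i" "\<lambda>_. j" x x'] i(1-3) j(1-3) by auto
  have "Sums (D k) (\<lambda>n. t i k (x n)) = Some (t i k w)"
    by (rule linear_maps_Sums[OF t_linear i(2,4)]) (use k in blast)
  moreover have "Sums (D k) (\<lambda>n. t j k (x' n)) = Some (t j k w')"
    by (rule linear_maps_Sums[OF t_linear j(2,4)]) (use k in blast)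
  ultimately have "t i k w = t j k w'"
    using k by simp
  then show ?thesis
    using q_t[of i k w] q_t[of j k w'] k i(5,6) j(5,6) by simp
qed

definition rep :: "'u \<Rightarrow> 'u \<times> 'u" where
  "rep b = (SOME a. fst a \<in> I \<and> snd a \<in> carrier (D (fst a)) \<and> q (fst a) (snd a) = b)"

lemma rep:
  assumes "b \<in> C"
  shows "fst (rep b) \<in> I" "snd (rep b) \<in> carrier (D (fst (rep b)))" "q (fst (rep b)) (snd (rep b)) = b"
proof -
  obtain i x where "i \<in> I" "x \<in> carrier (D i)" "q i x = b"
    using assms by (auto simp: C_def)
  then have "\<exists>a. fst a \<in> I \<and> snd a \<in> carrier (D (fst a)) \<and> q (fst a) (snd a) = b"
    by (intro exI[of _ "(i, x)"]) simp
  from someI_ex[OF this] show "fst (rep b) \<in> I" "snd (rep b) \<in> carrier (D (fst (rep b)))" "q (fst (rep b)) (snd (rep b)) = b"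
    unfolding rep_def by auto
qed

text \<open>Zero and action use arbitrarily chosen stages and representatives; \<open>L_zero\<close>
  and \<open>L_act\<close> show that the choices do not matter.\<close>

definition L :: "('r, 'u) rmod" where
  "L = \<lparr>carrier = C, zero = (let i = SOME i. i \<in> I in q i (zero (D i))),
     Sums = (\<lambda>y. if \<exists>v. has_Sum y v then Some (THE v. has_Sum y v) else None),
     act = (\<lambda>s b. q (fst (rep b)) (act (D (fst (rep b))) s (snd (rep b))))\<rparr>"

lemma L_carrier [simp]: "carrier L = C"
  by (simp add: L_def)

lemma L_Sums: "Sums L y = Some v \<longleftrightarrow> has_Sum y v"
proof -
  have "(THE v. has_Sum y v) = v" if "has_Sum y v" for v
    using that by (rule the_equality) (rule has_Sum_unique[OF _ that])
  then show ?thesis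
    by (auto simp: L_def)
qed

lemma L_zero: assumes "i \<in> I" shows "q i (zero (D i)) = zero L"
proof -
  define j where "j = (SOME i. i \<in> I)"
  have j: "j \<in> I"
    using someI[of "\<lambda>i. i \<in> I"] assms by (simp add: j_def)
  obtain k where k: "(i, k) \<in> r" "(j, k) \<in> r"
    using upper_bound2[OF assms j] .
  have "q i (zero (D i)) = q k (zero (D k))" if "(i, k) \<in> r" for i
  proof -
    interpret r_module R "D i" by (rule D_mod[OF r_Ob(1)[OF that]])
    show ?thesis
      using q_t[OF that zero_closed] linear_maps_zero[OF t_linear[OF that]] by simp
  qed
  then show ?thesis
    using k by (simp add: L_def j_def[symmetric] Let_def)
qed

lemma L_act:
  assumes "i \<in> I" "x \<in> carrier (D i)" "s \<in> carrier R"
  shows "act L s (q i x) = q i (act (D i) s x)"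
proof -
  define j y where "j = fst (rep (q i x))" and "y = snd (rep (q i x))"
  have j: "j \<in> I" "y \<in> carrier (D j)" "q j y = q i x"
    using rep[OF q_closed[OF assms(1,2)]] by (auto simp: j_def y_def)
  obtain k where k: "(j, k) \<in> r" "(i, k) \<in> r" "t j k y = t i k x"
    using merge1[OF j(1) assms(1) j(2) assms(2) j(3)] .
  have "q l (act (D l) s z) = q k (act (D k) s (t l k z))" if "(l, k) \<in> r" "z \<in> carrier (D l)" for l z
  proof -
    interpret r_module R "D l" by (rule D_mod[OF r_Ob(1)[OF that(1)]])
    show ?thesis
      using q_t[OF that(1) act_closed[OF assms(3) that(2)]] linear_maps_act[OF t_linear[OF that(1)] assms(3) that(2)] by simp
  qed
  then have "q j (act (D j) s y) = q i (act (D i) s x)"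
    using k j assms by simp
  then show ?thesis
    by (simp add: L_def j_def y_def)
qed

lemma I_nonempty: obtains i where "i \<in> I"
  using upper_bound[of "{}"] by auto

text \<open>The difficulty is that a nonzero representative may have zero germ, so supports at a
  stage can exceed those in \<open>L\<close>. Countably many such entries become zero at a common
  stage, where the reindexing axiom of the module applies.\<close>

lemma has_Sum_reindex:
  assumes y: "\<And>n. y n \<in> C" and z: "\<And>n. z n \<in> C"
    and \<sigma>: "bij_betw \<sigma> {n. y n \<noteq> zero L} {m. z m \<noteq> zero L}"
    and eq: "\<And>n. y n \<noteq> zero L \<Longrightarrow> z (\<sigma> n) = y n"
    and v: "has_Sum y v"
  shows "has_Sum z v"
proof -
  from v obtain i x w where i: "i \<in> I" "\<And>n. x n \<in> carrier (D i)" "\<And>n. q i (x n) = y n"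
      "Sums (D i) x = Some w" "w \<in> carrier (D i)" "q i w = v"
    by (rule has_SumE) (rule that)
  interpret Di: r_module R "D i" by (rule D_mod[OF i(1)])
  \<comment> \<open>Same germs as \<open>x\<close>, with zero chosen wherever the germ is zero.
    Merging \<open>x\<close> with \<open>x'\<close> gives a stage \<open>k\<close> at which all
    these entries vanish.\<close>
  define x' where "x' = (\<lambda>n. if y n = zero L then zero (D i) else x n)"
  have x': "x' n \<in> carrier (D i)" "q i (x n) = q i (x' n)" for n
    using i(2,3) Di.zero_closed L_zero[OF i(1)] by (simp_all add: x'_def)
  obtain k where k: "\<And>n. (i, k) \<in> r \<and> (i, k) \<in> r \<and> t i k (x n) = t i k (x' n)"
    by (rule merge_all[of "\<lambda>_. i" "\<lambda>_. i" x x']) (use i(1,2) x' in auto)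
  have ik: "(i, k) \<in> r"
    using k by blast
  interpret Dk: r_module R "D k" by (rule D_mod[OF r_Ob(2)[OF ik]])
  define X where "X = (\<lambda>n. t i k (x n))"
  have X: "X n \<in> carrier (D k)" "q k (X n) = y n" for n
    using t_closed[OF ik i(2)] q_t[OF ik i(2)] i(3) by (simp_all add: X_def)
  have X_zero: "X n = zero (D k) \<longleftrightarrow> y n = zero L" for n
  proof
    assume "X n = zero (D k)"
    then show "y n = zero L"
      using X(2)[of n] L_zero[OF r_Ob(2)[OF ik]] by simp
  next
    assume "y n = zero L"
    then show "X n = zero (D k)"
      using k linear_maps_zero[OF t_linear[OF ik]] by (simp add: X_def x'_def)
  qed
  have SX: "Sums (D k) X = Some (t i k w)"
    unfolding X_def by (rule linear_maps_Sums[OF t_linear[OF ik] i(2,4)])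
  \<comment> \<open>Inverse of \<sigma> on supports, used to transport the representatives of
    \<open>y\<close> to \<open>z\<close>; the remaining entries of \<open>Z\<close> are set to
    zero.\<close>
  define \<tau> where "\<tau> = inv_into {n. y n \<noteq> zero L} \<sigma>"
  define Z where "Z = (\<lambda>m. if z m = zero L then zero (D k) else X (\<tau> m))"
  have \<tau>: "y (\<tau> m) \<noteq> zero L" "\<sigma> (\<tau> m) = m" if "z m \<noteq> zero L" for m
  proof -
    have "m \<in> \<sigma> ` {n. y n \<noteq> zero L}"
      using that bij_betw_imp_surj_on[OF \<sigma>] by simp
    then show "y (\<tau> m) \<noteq> zero L" "\<sigma> (\<tau> m) = m"
      using inv_into_into[of m \<sigma> "{n. y n \<noteq> zero L}"] f_inv_into_f[of m \<sigma> "{n. y n \<noteq> zero L}"]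
      by (auto simp: \<tau>_def)
  qed
  have Z: "Z m \<in> carrier (D k)" "q k (Z m) = z m" for m
    using X \<tau>[of m] eq[of "\<tau> m"] Dk.zero_closed L_zero[OF r_Ob(2)[OF ik]] by (auto simp: Z_def)
  have "Sums (D k) X = Sums (D k) Z"
  proof (rule Dk.Sums_reindex[OF X(1) Z(1)])
    have "{m. Z m \<noteq> zero (D k)} = {m. z m \<noteq> zero L}"
      using X_zero \<tau> by (auto simp: Z_def)
    then show "bij_betw \<sigma> {n. X n \<noteq> zero (D k)} {m. Z m \<noteq> zero (D k)}"
      using \<sigma> by (simp add: X_zero)
    fix n assume "X n \<noteq> zero (D k)"
    then have n: "y n \<noteq> zero L"
      by (simp add: X_zero)
    then have "z (\<sigma> n) \<noteq> zero L" "\<tau> (\<sigma> n) = n"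
      using eq inv_into_f_f[OF bij_betw_imp_inj_on[OF \<sigma>]] by (auto simp: \<tau>_def)
    then show "Z (\<sigma> n) = X n"
      by (simp add: Z_def)
  qed
  then have "has_Sum z (q k (t i k w))"
    using SX Z by (intro has_SumI[OF r_Ob(2)[OF ik]]) auto
  then show ?thesis
    using q_t[OF ik i(5)] i(6) by simp
qed

text \<open>From left to right everything happens at one stage. Conversely, the inner sums live at
  different stages and their values need only have the same germs as the summands of the outer sum,
  so all of this has to be brought to one stage first.\<close>

lemma has_Sum_partition:
  fixes \<sigma> :: "nat \<times> nat \<Rightarrow> nat"
  assumes y: "\<And>n. y n \<in> C" and \<sigma>: "bij \<sigma>"
  shows "has_Sum y v \<longleftrightarrow> (\<exists>u. (\<forall>j. has_Sum (\<lambda>k. y (\<sigma> (j, k))) (u j)) \<and> has_Sum u v)"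
proof
  assume "has_Sum y v"
  then obtain i x w where i: "i \<in> I" "\<And>n. x n \<in> carrier (D i)" "\<And>n. q i (x n) = y n"
      "Sums (D i) x = Some w" "w \<in> carrier (D i)" "q i w = v"
    by (rule has_SumE) (rule that)
  interpret Di: r_module R "D i" by (rule D_mod[OF i(1)])
  have "Sums_opt (D i) (\<lambda>j. Sums (D i) (\<lambda>k. x (\<sigma> (j, k)))) = Some w"
    using Di.Sums_partition[of x \<sigma>, OF i(2) \<sigma>] i(4) by simp
  then obtain u where u: "\<And>j. Sums (D i) (\<lambda>k. x (\<sigma> (j, k))) = Some (u j)" and w: "Sums (D i) u = Some w"
    unfolding Sums_opt_eq_Some fun_eq_iff by blast
  have ucl: "u j \<in> carrier (D i)" for j
    by (rule Di.Sums_closed[OF _ u]) (rule i(2))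
  have "has_Sum (\<lambda>k. y (\<sigma> (j, k))) (q i (u j))" for j
    by (rule has_SumI[OF i(1) _ _ u]) (rule i(2), rule i(3))
  moreover have "has_Sum (\<lambda>j. q i (u j)) (q i w)"
    by (rule has_SumI[OF i(1) ucl _ w]) simp
  ultimately show "\<exists>u. (\<forall>j. has_Sum (\<lambda>k. y (\<sigma> (j, k))) (u j)) \<and> has_Sum u v"
    using i(6) by (intro exI[of _ "\<lambda>j. q i (u j)"]) simp
next
  assume "\<exists>u. (\<forall>j. has_Sum (\<lambda>k. y (\<sigma> (j, k))) (u j)) \<and> has_Sum u v"
  then obtain u where u: "\<And>j. has_Sum (\<lambda>k. y (\<sigma> (j, k))) (u j)" and v: "has_Sum u v"
    by blast
  from v obtain l z w where l: "l \<in> I" "\<And>n. z n \<in> carrier (D l)" "\<And>n. q l (z n) = u n"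
      "Sums (D l) z = Some w" "w \<in> carrier (D l)" "q l w = v"
    by (rule has_SumE) (rule that)
  have "\<exists>i x w. i \<in> I \<and> (\<forall>k. x k \<in> carrier (D i) \<and> q i (x k) = y (\<sigma> (j, k))) \<and>
      Sums (D i) x = Some w \<and> w \<in> carrier (D i) \<and> q i w = u j" for j
    using u[of j] by (rule has_SumE) blast
  then obtain i x w' where i: "\<And>j. i j \<in> I" "\<And>j k. x j k \<in> carrier (D (i j))"
      "\<And>j k. q (i j) (x j k) = y (\<sigma> (j, k))" "\<And>j. Sums (D (i j)) (x j) = Some (w' j)"
      "\<And>j. w' j \<in> carrier (D (i j))" "\<And>j. q (i j) (w' j) = u j"
    by metis
  \<comment> \<open>At \<open>m\<close> the inner sums exist and their values coincide with the
    summands of the outer sum, one equality for each \<open>j\<close>.\<close>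
  obtain m where m: "\<And>j. (i j, m) \<in> r \<and> (l, m) \<in> r \<and> t (i j) m (w' j) = t l m (z j)"
    by (rule merge_all[of i "\<lambda>_. l" w' z]) (use i l in auto)
  have lm: "(l, m) \<in> r" and im: "\<And>j. (i j, m) \<in> r"
    using m by auto
  interpret Dm: r_module R "D m" by (rule D_mod[OF r_Ob(2)[OF lm]])
  define \<tau> where "\<tau> = inv \<sigma>"
  have \<tau>: "\<tau> (\<sigma> a) = a" "\<sigma> (\<tau> n) = n" for a n
    using \<sigma> by (simp_all add: \<tau>_def bij_is_inj bij_is_surj surj_f_inv_f)
  \<comment> \<open>The double family at stage \<open>m\<close>, flattened along the inverse of
    \<sigma>.\<close>
  define Y where "Y = (\<lambda>n. case \<tau> n of (j, k) \<Rightarrow> t (i j) m (x j k))"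
  have Y\<sigma>: "Y (\<sigma> (j, k)) = t (i j) m (x j k)" for j k
    by (simp add: Y_def \<tau>)
  have Y: "Y n \<in> carrier (D m)" "q m (Y n) = y n" for n
  proof -
    obtain j k where jk: "\<tau> n = (j, k)"
      by (cases "\<tau> n")
    then have n: "n = \<sigma> (j, k)"
      using \<tau>(2)[of n] by simp
    show "Y n \<in> carrier (D m)" "q m (Y n) = y n"
      unfolding n Y\<sigma> using t_closed[OF im i(2)] q_t[OF im i(2)] i(3) by simp_all
  qed
  have "Sums (D m) (\<lambda>k. Y (\<sigma> (j, k))) = Some (t l m (z j))" for j
    unfolding Y\<sigma> using linear_maps_Sums[OF t_linear[OF im] i(2) i(4)] m by simp
  then have "Sums (D m) Y = Sums (D m) (\<lambda>j. t l m (z j))"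
    using Dm.Sums_partition[of Y \<sigma>, OF Y(1) \<sigma>] by (simp add: Sums_opt_def)
  also have "\<dots> = Some (t l m w)"
    by (rule linear_maps_Sums[OF t_linear[OF lm] l(2,4)])
  finally have "has_Sum y (q m (t l m w))"
    by (intro has_SumI[OF r_Ob(2)[OF lm] Y])
  then show "has_Sum y v"
    using q_t[OF lm l(5)] l(6) by simp
qed

lemma has_Sum_closed: "has_Sum y v \<Longrightarrow> v \<in> C"
  by (elim has_SumE) (auto intro: q_closed)

lemma r_module_L: "r_module R L"
proof -
  interpret R: sigma_semiring R by (rule R)
  obtain i0 where i0: "i0 \<in> I"
    by (rule I_nonempty)
  have lift: "\<exists>i x. i \<in> I \<and> x \<in> carrier (D i) \<and> b = q i x" if "b \<in> C" for b
    using that by (auto simp: C_def)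
  show ?thesis
  proof
    show "zero L \<in> carrier L"
      using q_closed[OF i0 sigma_monoid.zero_closed] D_mod[OF i0] L_zero[OF i0]
      by (simp add: r_module_def)
    show "v \<in> carrier L" if "Sums L y = Some v" for y v
      using that has_Sum_closed by (simp add: L_Sums)
    show "Sums L y = Some (y j)"
      if y: "\<And>n. y n \<in> carrier L" "\<And>n. n \<noteq> j \<Longrightarrow> y n = zero L" for y j
    proof -
      obtain i x where i: "i \<in> I" "x \<in> carrier (D i)" "y j = q i x"
        using lift[of "y j"] y(1)[of j] unfolding L_carrier by blast
      interpret Di: r_module R "D i" by (rule D_mod[OF i(1)])
      have "Sums (D i) (\<lambda>n. if n = j then x else zero (D i)) = Some x"
        using Di.Sums_single[of "\<lambda>n. if n = j then x else zero (D i)" j] i(2) Di.zero_closed by simp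
      then have "has_Sum y (q i x)"
        by (rule has_SumI[OF i(1), rotated 2]) (use i y Di.zero_closed L_zero[OF i(1)] in auto)
      then show ?thesis
        using i(3) by (simp add: L_Sums)
    qed
    show "Sums L y = Sums L z"
      if y: "\<And>n. y n \<in> carrier L" and z: "\<And>n. z n \<in> carrier L"
        and \<sigma>: "bij_betw \<sigma> {n. y n \<noteq> zero L} {m. z m \<noteq> zero L}"
        and eq: "\<And>n. y n \<noteq> zero L \<Longrightarrow> z (\<sigma> n) = y n" for y z \<sigma>
    proof (rule option_eqI)
      fix v
      \<comment> \<open>\<open>has_Sum_reindex\<close> transfers sums in one direction; the inverse
        bijection gives the other, hence equality including definedness.\<close>
      let ?\<tau> = "inv_into {n. y n \<noteq> zero L} \<sigma>"
      have \<tau>: "bij_betw ?\<tau> {m. z m \<noteq> zero L} {n. y n \<noteq> zero L}"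
        by (rule bij_betw_inv_into[OF \<sigma>])
      have "y (?\<tau> m) = z m" if "z m \<noteq> zero L" for m
        using bij_betw_inv_into_right[OF \<sigma>, of m] bij_betwE[OF \<tau>] eq[of "?\<tau> m"] that by auto
      then show "Sums L y = Some v \<longleftrightarrow> Sums L z = Some v"
        using has_Sum_reindex[OF _ _ \<sigma> eq] has_Sum_reindex[OF _ _ \<tau>] y z by (auto simp: L_Sums)
    qed
    show "Sums L y = Sums_opt L (\<lambda>j. Sums L (\<lambda>k. y (\<sigma> (j, k))))"
      if y: "\<And>n. y n \<in> carrier L" and \<sigma>: "bij \<sigma>" for y and \<sigma> :: "nat \<times> nat \<Rightarrow> nat"
      using has_Sum_partition[OF _ \<sigma>, of y] y
      by (intro option_eqI) (simp add: L_Sums Sums_opt_eq_Some fun_eq_iff)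
    show "Sums2 L (\<lambda>i j. act L (s i) (y j)) = Some (act L v w)"
      if s: "\<And>i. s i \<in> carrier R" and y: "\<And>j. y j \<in> carrier L"
        and v: "Sums R s = Some v" and w: "Sums L y = Some w" for s y v w
    proof -
      have vR: "v \<in> carrier R"
        using R.Sums_closed[OF s v] .
      obtain i x w' where i: "i \<in> I" "\<And>n. x n \<in> carrier (D i)" "\<And>n. q i (x n) = y n"
          "Sums (D i) x = Some w'" "w' \<in> carrier (D i)" "q i w' = w"
        using w unfolding L_Sums by (rule has_SumE) (rule that)
      interpret Di: r_module R "D i" by (rule D_mod[OF i(1)])
      have "Sums2 (D i) (\<lambda>k j. act (D i) (s k) (x j)) = Some (act (D i) v w')"
        by (rule Di.act_Sums[OF s i(2) v i(4)])
      then have "has_Sum (\<lambda>n. case prod_decode n of (k, j) \<Rightarrow> act L (s k) (y j)) (q i (act (D i) v w'))"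
        unfolding Sums2_def
        by (intro has_SumI[OF i(1)])
          (auto split: prod.split simp: Di.act_closed[OF s i(2)] L_act[OF i(1,2) s, symmetric] i(3))
      then show ?thesis
        using L_act[OF i(1,5) vR] i(6) by (simp add: Sums2_def L_Sums)
    qed
  next
    fix s b assume s: "s \<in> carrier R" and "b \<in> carrier L"
    then obtain i x where i: "i \<in> I" "x \<in> carrier (D i)" "b = q i x"
      using lift[of b] unfolding L_carrier by blast
    interpret Di: r_module R "D i" by (rule D_mod[OF i(1)])
    show "act L s b \<in> carrier L"
      using q_closed[OF i(1) Di.act_closed[OF s i(2)]] L_act[OF i(1,2) s] i(3) by simp
    fix s' assume s': "s' \<in> carrier R"
    show "act L (mult R s s') b = act L s (act L s' b)"
      using L_act[OF i(1,2) R.mult_closed[OF s s']] L_act[OF i(1,2) s'] L_act[OF i(1) Di.act_closed[OF s' i(2)] s]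
        Di.act_mult[OF s s' i(2)] i(3) by simp
  next
    fix b assume "b \<in> carrier L"
    then obtain i x where i: "i \<in> I" "x \<in> carrier (D i)" "b = q i x"
      using lift[of b] unfolding L_carrier by blast
    interpret Di: r_module R "D i" by (rule D_mod[OF i(1)])
    show "act L (one R) b = b"
      using L_act[OF i(1,2) R.one_closed] Di.act_one[OF i(2)] i(3) by simp
    show "act L (zero R) b = zero L"
      using L_act[OF i(1,2) R.zero_closed] Di.act_zero_left[OF i(2)] i(3) L_zero[OF i(1)] by simp
  next
    fix s assume s: "s \<in> carrier R"
    interpret Di: r_module R "D i0" by (rule D_mod[OF i0])
    show "act L s (zero L) = zero L"
      using L_act[OF i0 Di.zero_closed s] Di.act_zero_right[OF s] L_zero[OF i0] by simp
  qed
qed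

lemma L_Ob: "L \<in> Ob (Mod \<kappa> R)"
proof -
  have "C = (\<Union>i\<in>I. q i ` carrier (D i))"
    by (auto simp: C_def)
  then have "small \<kappa> C"
    using small_UN[OF univ poset(4), of "\<lambda>i. q i ` carrier (D i)"] D_Ob by (simp add: small_image)
  then show ?thesis
    using r_module_L by simp
qed

lemma q_linear: assumes "i \<in> I" shows "restrict (q i) (carrier (D i)) \<in> linear_maps R (D i) L"
proof -
  interpret Di: r_module R "D i" by (rule D_mod[OF assms])
  show ?thesis
  proof (rule linear_mapsI)
    show "v \<in> carrier (D i) \<and> Sums L (\<lambda>n. q i (x n)) = Some (q i v)"
      if "\<And>n. x n \<in> carrier (D i)" "Sums (D i) x = Some v" for x v
      unfolding L_Sums using Di.Sums_closed[OF that] has_SumI[OF assms that(1) refl that(2)] ..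
    show "act (D i) s x \<in> carrier (D i) \<and> q i (act (D i) s x) = act L s (q i x)"
      if "s \<in> carrier R" "x \<in> carrier (D i)" for s x
      using Di.act_closed[OF that] L_act[OF assms that(2,1)] by simp
  qed (simp_all add: assms q_closed Di.zero_closed L_zero)
qed

lemma q_cocone: "is_cocone (poset_cat I r) (Mod \<kappa> R) D Dm L (\<lambda>i. restrict (q i) (carrier (D i)))"
  unfolding is_cocone_def
proof (intro conjI ballI)
  fix i j f assume "f \<in> Hom (poset_cat I r) i j"
  then have ij: "(i, j) \<in> r"
    by (simp add: poset_cat_def split: if_splits)
  show "Comp (Mod \<kappa> R) (D i) (D j) L (restrict (q j) (carrier (D j))) (Dm i j f) = restrict (q i) (carrier (D i))"
    by (rule ext) (simp add: compose_def t_closed[OF ij] q_t[OF ij])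
qed (use L_Ob q_linear in \<open>simp_all add: poset_cat_def\<close>)

text \<open>A cocone takes equal values on elements that merge, so evaluating it at a representative
  is well defined; a sum of germs is a sum at one stage, where a single leg is linear.\<close>

lemma cocone_lift:
  assumes "is_cocone (poset_cat I r) (Mod \<kappa> R) D Dm N d"
  obtains h where "h \<in> linear_maps R L N" "\<And>i x. i \<in> I \<Longrightarrow> x \<in> carrier (D i) \<Longrightarrow> h (q i x) = d i x"
proof -
  have d: "d i \<in> linear_maps R (D i) N" if "i \<in> I" for i
    using assms that by (simp add: is_cocone_def poset_cat_def)
  have d_eq: "compose (carrier (D i)) (d j) (t i j) = d i" if "(i, j) \<in> r" for i j
    using assms r_Ob[OF that] that by (simp add: is_cocone_def poset_cat_def)
  have dt: "d j (t i j x) = d i x" if "(i, j) \<in> r" "x \<in> carrier (D i)" for i j x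
    using fun_cong[OF d_eq[OF that(1)], of x] that by (simp add: compose_def)
  define h where "h = (\<lambda>b. d (fst (rep b)) (snd (rep b)))"
  have h: "h (q i x) = d i x" if ix: "i \<in> I" "x \<in> carrier (D i)" for i x
  proof -
    note a = rep[OF q_closed[OF ix]]
    obtain k where k: "(fst (rep (q i x)), k) \<in> r" "(i, k) \<in> r"
        "t (fst (rep (q i x))) k (snd (rep (q i x))) = t i k x"
      using merge1[OF a(1) ix(1) a(2) ix(2) a(3)] .
    then show ?thesis
      unfolding h_def using dt[OF k(1) a(2)] dt[OF k(2) ix(2)] k(3) by argo
  qed
  have lift: "\<exists>i x. i \<in> I \<and> x \<in> carrier (D i) \<and> b = q i x" if "b \<in> C" for b
    using that by (auto simp: C_def)
  interpret L: r_module R L by (rule r_module_L)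
  obtain i0 where i0: "i0 \<in> I"
    by (rule I_nonempty)
  have "restrict h (carrier L) \<in> linear_maps R L N"
  proof (rule linear_mapsI)
    show "h b \<in> carrier N" if "b \<in> carrier L" for b
      using lift[of b] that h linear_maps_closed[OF d] by fastforce
    show "zero L \<in> carrier L"
      by (rule L.zero_closed)
    have "zero (D i0) \<in> carrier (D i0)"
      using D_mod[OF i0] by (simp add: r_module_def sigma_monoid.zero_closed)
    then show "h (zero L) = zero N"
      using h[OF i0] L_zero[OF i0] linear_maps_zero[OF d[OF i0]] by metis
    show "v \<in> carrier L \<and> Sums N (\<lambda>n. h (y n)) = Some (h v)"
      if y: "\<And>n. y n \<in> carrier L" and v: "Sums L y = Some v" for y v
    proof -
      obtain i x w where i: "i \<in> I" "\<And>n. x n \<in> carrier (D i)" "\<And>n. q i (x n) = y n"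
          "Sums (D i) x = Some w" "w \<in> carrier (D i)" "q i w = v"
        using v unfolding L_Sums by (rule has_SumE) (rule that)
      have "h (y n) = d i (x n)" "h v = d i w" for n
        using h[OF i(1) i(2)[of n]] h[OF i(1,5)] i(3,6) by simp_all
      then show ?thesis
        using linear_maps_Sums[OF d[OF i(1)] i(2,4)] L.Sums_closed[OF y v] by simp
    qed
    show "act L s b \<in> carrier L \<and> h (act L s b) = act N s (h b)"
      if s: "s \<in> carrier R" and b: "b \<in> carrier L" for s b
    proof -
      obtain i x where i: "i \<in> I" "x \<in> carrier (D i)" "b = q i x"
        using lift[of b] b unfolding L_carrier by blast
      interpret Di: r_module R "D i" by (rule D_mod[OF i(1)])
      show ?thesis
        using L.act_closed[OF s b] h[OF i(1) Di.act_closed[OF s i(2)]] h[OF i(1,2)] i(3)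
          L_act[OF i(1,2) s] linear_maps_act[OF d[OF i(1)] s i(2)] by simp
    qed
  qed
  then show ?thesis
    by (rule that) (use h q_closed in auto)
qed

end


section \<open>Describing an arbitrary colimit by germs\<close>

lemma Ob_poset_cat: "Ob (poset_cat I r) = I"
  by (simp add: poset_cat_def)

context directed_diagram begin

lemma merge_refl: "i \<in> I \<Longrightarrow> merge (i, x) (i, x)"
  using r_refl by (auto simp: merge_def)

lemma merge_sym: "merge a b \<Longrightarrow> merge b a"
  unfolding merge_def by metis

text \<open>Germs are named by classifying the pairs according to their merge class, a small set of
  pairs being enough names in \<open>'u\<close>.\<close>

lemma model_exists: obtains q where "directed_model \<kappa> R I r D Dm q"
proof -
  define Z where "Z = Sigma I (\<lambda>i. carrier (D i))"
  have "small \<kappa> Z"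
    unfolding Z_def using D_Ob by (intro small_Sigma[OF univ poset(4)]) simp
  then obtain e :: "'u \<times> 'u \<Rightarrow> 'u" where
      e: "\<And>a b. a \<in> Z \<Longrightarrow> b \<in> Z \<Longrightarrow> e a = e b \<longleftrightarrow> {c \<in> Z. merge a c} = {c \<in> Z. merge b c}"
    by (rule small_classify[where F = "\<lambda>a. {c \<in> Z. merge a c}"]) (rule that)
  have Z: "fst a \<in> I" "snd a \<in> carrier (D (fst a))" "merge a a" if "a \<in> Z" for a
    using that merge_refl[of "fst a" "snd a"] by (auto simp: Z_def)
  have "e a = e b \<longleftrightarrow> merge a b" if a: "a \<in> Z" and b: "b \<in> Z" for a b
  proof
    assume "e a = e b"
    then have "{c \<in> Z. merge a c} = {c \<in> Z. merge b c}"
      using e[OF a b] by simp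
    then show "merge a b"
      using Z(3)[OF b] b by blast
  next
    assume ab: "merge a b"
    have "merge a c \<longleftrightarrow> merge b c" if c: "c \<in> Z" for c
      using merge_trans[OF merge_sym[OF ab], of c] merge_trans[OF ab, of c] Z(2)[OF a] Z(2)[OF b] Z(2)[OF c]
      by blast
    then show "e a = e b"
      using e[OF a b] by blast
  qed
  then have "directed_model \<kappa> R I r D Dm (\<lambda>i x. e (i, x))"
    by unfold_locales (simp add: Z_def)
  then show ?thesis
    by (rule that)
qed

text \<open>
  A colimit is a retract of the concrete one, by universality; hence it inherits the description of
  elements, equality and sums by representatives.
\<close>

lemma colimit_model:
  assumes "is_colimit (poset_cat I r) (Mod \<kappa> R) D Dm K c"
  shows "directed_model \<kappa> R I r D Dm c" (is ?model)
    and "directed_model.C I D c = carrier K" (is ?carrier)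
    and "\<lbrakk>\<And>n. y n \<in> carrier K; Sums K y = Some v\<rbrakk> \<Longrightarrow> directed_model.has_Sum I D c y v"
proof -
  have cocone: "is_cocone (poset_cat I r) (Mod \<kappa> R) D Dm K c"
    and K: "K \<in> Ob (Mod \<kappa> R)"
    using assms by (simp_all add: is_colimit_def is_cocone_def)
  have c: "c i \<in> linear_maps R (D i) K" if "i \<in> I" for i
    using cocone that by (simp add: is_cocone_def Ob_poset_cat)
  have cc: "compose (carrier (D i)) (c j) (t i j) = c i" if "(i, j) \<in> r" for i j
    using cocone r_Ob[OF that] that by (simp add: is_cocone_def poset_cat_def)
  have ct: "c j (t i j x) = c i x" if "(i, j) \<in> r" "x \<in> carrier (D i)" for i j x
    using fun_cong[OF cc[OF that(1)], of x] that(2) by (simp add: compose_def)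
  have univ_prop: "\<exists>!h. h \<in> linear_maps R K N \<and> (\<forall>i\<in>I. compose (carrier (D i)) h (c i) = d i)"
    if "is_cocone (poset_cat I r) (Mod \<kappa> R) D Dm N d" for N d
    using assms that unfolding is_colimit_def by (simp add: Ob_poset_cat)
  obtain q where "directed_model \<kappa> R I r D Dm q"
    by (rule model_exists)
  then interpret M: directed_model \<kappa> R I r D Dm q .
  obtain h where h: "h \<in> linear_maps R K M.L"
      and hc: "\<And>i. i \<in> I \<Longrightarrow> compose (carrier (D i)) h (c i) = restrict (q i) (carrier (D i))"
    using univ_prop[OF M.q_cocone] by blast
  have hc: "h (c i x) = q i x" if "i \<in> I" "x \<in> carrier (D i)" for i x
    using fun_cong[OF hc[OF that(1)], of x] that by (simp add: compose_def)
  obtain k where k: "k \<in> linear_maps R M.L K" and kq: "\<And>i x. i \<in> I \<Longrightarrow> x \<in> carrier (D i) \<Longrightarrow> k (q i x) = c i x"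
    using M.cocone_lift[OF cocone] by blast
  have id: "(\<lambda>x\<in>carrier K. x) \<in> linear_maps R K K"
    using K by (simp add: linear_maps_id)
  have kh_lin: "compose (carrier K) k h \<in> linear_maps R K K"
    using K by (intro linear_maps_compose[OF _ h k]) simp
  note univ_prop[OF cocone]
  moreover have "compose (carrier (D i)) (\<lambda>x\<in>carrier K. x) (c i) = c i" if "i \<in> I" for i
    unfolding compose_eq_iff[OF linear_maps_PiE[OF c[OF that]]]
    using linear_maps_closed[OF c[OF that]] by simp
  moreover have "compose (carrier (D i)) (compose (carrier K) k h) (c i) = c i" if "i \<in> I" for i
    unfolding compose_eq_iff[OF linear_maps_PiE[OF c[OF that]]]
    using linear_maps_closed[OF c[OF that]] hc[OF that] kq[OF that] by (simp add: compose_def)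
  ultimately have kh: "compose (carrier K) k h = (\<lambda>x\<in>carrier K. x)"
    using id kh_lin by blast
  have kh: "k (h y) = y" if "y \<in> carrier K" for y
    using that fun_cong[OF kh, of y] by (simp add: compose_def)
  have c_eq: "c i x = c j y \<longleftrightarrow> merge (i, x) (j, y)"
    if "i \<in> I" "j \<in> I" "x \<in> carrier (D i)" "y \<in> carrier (D j)" for i j x y
    using M.q_eq[OF that] hc[OF that(1,3)] hc[OF that(2,4)] kq[OF that(1,3)] kq[OF that(2,4)] by metis
  show model: ?model
    by unfold_locales (rule c_eq)
  then interpret N: directed_model \<kappa> R I r D Dm c .
  show ?carrier
  proof
    show "N.C \<subseteq> carrier K"
      using linear_maps_closed[OF c] by (auto simp: N.C_def)
    show "carrier K \<subseteq> N.C"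
    proof
      fix y assume y: "y \<in> carrier K"
      then have "h y \<in> M.C"
        using linear_maps_closed[OF h] by simp
      then obtain i x where i: "h y = q i x" "i \<in> I" "x \<in> carrier (D i)"
        unfolding M.C_def by blast
      then have "y = c i x"
        using kh[OF y] kq[OF i(2,3)] by simp
      then show "y \<in> N.C"
        using i N.q_closed by simp
    qed
  qed
  \<comment> \<open>A sum in \<open>K\<close> is pushed by \<open>h\<close> into the concrete
    module, where it is realised at a stage; applying \<open>k\<close> turns the germs there back
    into the original entries and value.\<close>
  show "N.has_Sum y v" if y: "\<And>n. y n \<in> carrier K" and v: "Sums K y = Some v"
  proof -
    have "Sums M.L (\<lambda>n. h (y n)) = Some (h v)"
      by (rule linear_maps_Sums[OF h y v])
    then obtain i x w where i: "i \<in> I" "\<And>n. x n \<in> carrier (D i)" "\<And>n. q i (x n) = h (y n)"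
        "Sums (D i) x = Some w" "w \<in> carrier (D i)" "q i w = h v"
      unfolding M.L_Sums by (rule M.has_SumE) (rule that)
    have "v \<in> carrier K"
      using K y v by (auto simp: r_module_def intro: sigma_monoid.Sums_closed)
    then have "c i w = v"
      using kq[OF i(1,5)] kh[of v] i(6) by simp
    moreover have "c i (x n) = y n" for n
      using kq[OF i(1) i(2)[of n]] kh[OF y[of n]] i(3)[of n] by simp
    ultimately show ?thesis
      using N.has_SumI[OF i(1,2) _ i(4), of y] by simp
  qed
qed

end


section \<open>Countably presented modules are presentable\<close>

locale presented_in_colimit = directed_diagram \<kappa> R I r D Dm
  for \<kappa> :: "'u rel" and R :: "('r, 'z) sigma_sring_scheme" and I r D Dm +
  fixes Q :: "('r, 'x) fact set" and P :: "('r, 'u) rmod" and \<eta> :: "'x \<Rightarrow> 'u"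
    and K :: "('r, 'u) rmod" and c :: "'u \<Rightarrow> 'u \<Rightarrow> 'u"
  assumes pres: "presents \<kappa> R Q P \<eta>" and countable: "countable Q"
    and scal: "\<And>\<phi>. \<phi> \<in> Q \<Longrightarrow> scalars \<phi> \<subseteq> carrier R"
    and colim: "is_colimit (poset_cat I r) (Mod \<kappa> R) D Dm K c"
begin

text \<open>The legs of the given colimit act as the names of germs, so elements, equalities and
  sums of \<open>K\<close> itself have witnesses at stages.\<close>

sublocale M: directed_model \<kappa> R I r D Dm c
  by (rule colimit_model(1)[OF colim])

lemma C_eq: "M.C = carrier K"
  by (rule colimit_model(2)[OF colim])

lemma K_Ob: "K \<in> Ob (Mod \<kappa> R)"
  using colim by (simp add: is_colimit_def is_cocone_def)

lemma c_linear: "i \<in> I \<Longrightarrow> c i \<in> linear_maps R (D i) K"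
  using colim by (simp add: is_colimit_def is_cocone_def poset_cat_def)

lemma P_mod: "r_module R P"
  using presents_closed(1)[OF pres] by simp

text \<open>A sum in the colimit is witnessed at some unrelated stage by representatives other than
  \<open>u\<close>. Matching the entries and the value with \<open>u\<close> takes countably many
  equalities of germs; an action fact takes one.\<close>

lemma holds_at_stage:
  assumes u: "i \<in> I" "\<And>x. x \<in> gens \<phi> \<Longrightarrow> u x \<in> carrier (D i)"
    and \<phi>: "scalars \<phi> \<subseteq> carrier R" "holds K (\<lambda>x. c i (u x)) \<phi>"
  obtains k where "(i, k) \<in> r" "holds (D k) (\<lambda>x. t i k (u x)) \<phi>"
proof (cases \<phi>)
  case (SumF x v)
  have "Sums K (\<lambda>n. c i (u (x n))) = Some (c i (u v))"
    using \<phi>(2) SumF by simp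
  then have "M.has_Sum (\<lambda>n. c i (u (x n))) (c i (u v))"
    using SumF u linear_maps_closed[OF c_linear] by (intro colimit_model(3)[OF colim]) auto
  then obtain j x' w where j: "j \<in> I" "\<And>n. x' n \<in> carrier (D j)" "\<And>n. c j (x' n) = c i (u (x n))"
      "Sums (D j) x' = Some w" "w \<in> carrier (D j)" "c j w = c i (u v)"
    by (rule M.has_SumE) (rule that)
  \<comment> \<open>\<open>case_nat\<close> puts the value at index 0 and shifts the entries by one,
    so that a single merge treats both.\<close>
  obtain k where k: "\<And>n. (j, k) \<in> r \<and> (i, k) \<in> r \<and>
      t j k (case_nat w x' n) = t i k (case_nat (u v) (\<lambda>n. u (x n)) n)"
    by (rule M.merge_all[of "\<lambda>_. j" "\<lambda>_. i" "case_nat w x'" "case_nat (u v) (\<lambda>n. u (x n))"])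
      (use j u SumF in \<open>auto split: nat.split\<close>)
  have jk: "(j, k) \<in> r" and ik: "(i, k) \<in> r"
    using k by auto
  have "Sums (D k) (\<lambda>n. t j k (x' n)) = Some (t j k w)"
    by (rule linear_maps_Sums[OF t_linear[OF jk] j(2,4)])
  moreover have "t j k (x' n) = t i k (u (x n))" for n
    using k[of "Suc n"] by simp
  moreover have "t j k w = t i k (u v)"
    using k[of 0] by simp
  ultimately show ?thesis
    using SumF that[OF ik] by simp
next
  case (ActF s x y)
  have s: "s \<in> carrier R" and x: "u x \<in> carrier (D i)" and y: "u y \<in> carrier (D i)"
    using \<phi>(1) u ActF by auto
  have sx: "act (D i) s (u x) \<in> carrier (D i)"
    using D_mod[OF u(1)] s x by (rule r_module.act_closed)
  have "c i (act (D i) s (u x)) = c i (u y)"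
    using linear_maps_act[OF c_linear[OF u(1)] s x] \<phi>(2) ActF by simp
  then obtain k where k: "(i, k) \<in> r" "t i k (act (D i) s (u x)) = t i k (u y)"
    using M.merge1[OF u(1) u(1) sx y] by blast
  then have "act (D k) s (t i k (u x)) = t i k (u y)"
    using linear_maps_act[OF t_linear[OF k(1)] s x] by simp
  then show ?thesis
    using ActF that[OF k(1)] by simp
qed

text \<open>Surjectivity half of presentability. The images of the generators are represented at one
  stage, the facts become true later, and a bound of the countably many stages involved carries an
  interpretation of \<open>Q\<close>, hence a map from \<open>P\<close>.\<close>

lemma factor:
  assumes f: "f \<in> linear_maps R P K"
  obtains i g where "i \<in> I" "g \<in> linear_maps R P (D i)" "compose (carrier P) (c i) g = f"
proof -
  have f\<eta>: "(\<lambda>x. f (\<eta> x)) \<in> interps K Q"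
    by (rule interps_linear[OF presents_closed(2)[OF pres] f scal])
  have "\<exists>i y. i \<in> I \<and> y \<in> carrier (D i) \<and> c i y = f (\<eta> x)" if "x \<in> generators Q" for x
  proof -
    have "f (\<eta> x) \<in> M.C"
      using f\<eta> that by (auto simp: interps_def C_eq)
    then show ?thesis
      unfolding M.C_def mem_Collect_eq by metis
  qed
  then obtain i y where iy: "\<And>x. x \<in> generators Q \<Longrightarrow> i x \<in> I \<and> y x \<in> carrier (D (i x)) \<and> c (i x) (y x) = f (\<eta> x)"
    by metis
  \<comment> \<open>Countability of \<open>Q\<close> gives countably many generators, hence a common
    stage for their representatives.\<close>
  have "\<exists>j\<in>I. \<forall>l\<in>i ` generators Q. (l, j) \<in> r"
    using iy countable_generators[OF countable] by (intro upper_bound) auto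
  then obtain j where j: "j \<in> I" "\<And>x. x \<in> generators Q \<Longrightarrow> (i x, j) \<in> r"
    by blast
  define u where "u = (\<lambda>x. t (i x) j (y x))"
  have u: "u x \<in> carrier (D j)" "c j (u x) = f (\<eta> x)" if "x \<in> generators Q" for x
    using iy[OF that] j(2)[OF that] t_closed M.q_t by (auto simp: u_def)
  have gen: "gens \<phi> \<subseteq> generators Q" if "\<phi> \<in> Q" for \<phi>
    using that by (auto simp: generators_def)
  have "\<exists>k. (j, k) \<in> r \<and> holds (D k) (\<lambda>x. t j k (u x)) \<phi>" if \<phi>: "\<phi> \<in> Q" for \<phi>
  proof -
    have "holds K (\<lambda>x. f (\<eta> x)) \<phi>"
      using f\<eta> \<phi> by (simp add: interps_def)
    then have "holds K (\<lambda>x. c j (u x)) \<phi>"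
      using holds_cong[of \<phi> "\<lambda>x. c j (u x)" "\<lambda>x. f (\<eta> x)" K] gen[OF \<phi>] u(2) by blast
    then obtain k where "(j, k) \<in> r" "holds (D k) (\<lambda>x. t j k (u x)) \<phi>"
      using holds_at_stage[OF j(1) _ scal[OF \<phi>], of u] gen[OF \<phi>] u(1) by blast
    then show ?thesis
      by blast
  qed
  then obtain k where k: "\<And>\<phi>. \<phi> \<in> Q \<Longrightarrow> (j, k \<phi>) \<in> r \<and> holds (D (k \<phi>)) (\<lambda>x. t j (k \<phi>) (u x)) \<phi>"
    by metis
  \<comment> \<open>Each fact has its own stage of validity; \<open>j\<close> is inserted so that
    \<open>m\<close> lies above it even when \<open>Q\<close> is empty.\<close>
  have "\<exists>m\<in>I. \<forall>l\<in>insert j (k ` Q). (l, m) \<in> r"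
    using k r_Ob(2) j(1) countable by (intro upper_bound) auto
  then obtain m where m: "m \<in> I" "(j, m) \<in> r" "\<And>\<phi>. \<phi> \<in> Q \<Longrightarrow> (k \<phi>, m) \<in> r"
    by blast
  have "holds (D m) (\<lambda>x. t j m (u x)) \<phi>" if \<phi>: "\<phi> \<in> Q" for \<phi>
  proof -
    have "(\<lambda>x. t j (k \<phi>) (u x)) ` gens \<phi> \<subseteq> carrier (D (k \<phi>))"
      using gen[OF \<phi>] u(1) t_closed k[OF \<phi>] by blast
    then have "holds (D m) (\<lambda>x. t (k \<phi>) m (t j (k \<phi>) (u x))) \<phi>"
      using holds_linear[OF _ t_linear[OF m(3)[OF \<phi>]] scal[OF \<phi>]] k[OF \<phi>] by blast
    moreover have "t (k \<phi>) m (t j (k \<phi>) (u x)) = t j m (u x)" if "x \<in> gens \<phi>" for x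
      using t_trans[of j "k \<phi>" m "u x"] k[OF \<phi>] m(3)[OF \<phi>] u(1) gen[OF \<phi>] that by blast
    ultimately show ?thesis
      using holds_cong[of \<phi> "\<lambda>x. t (k \<phi>) m (t j (k \<phi>) (u x))" "\<lambda>x. t j m (u x)" "D m"] by blast
  qed
  then have "(\<lambda>x. t j m (u x)) \<in> interps (D m) Q"
    using t_closed[OF m(2) u(1)] by (auto simp: interps_def)
  then obtain g where g: "g \<in> linear_maps R P (D m)" "\<And>x. x \<in> generators Q \<Longrightarrow> g (\<eta> x) = t j m (u x)"
    using presents_lift[OF pres D_Ob[OF m(1)]] by blast
  have "compose (carrier P) (c m) g = f"
  proof (rule presents_eqI[OF pres K_Ob scal _ f])
    show "compose (carrier P) (c m) g \<in> linear_maps R P K"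
      by (rule linear_maps_compose[OF P_mod g(1) c_linear[OF m(1)]])
    show "compose (carrier P) (c m) g (\<eta> x) = f (\<eta> x)" if "x \<in> generators Q" for x
      using presents_closed(3)[OF pres that] g(2)[OF that] M.q_t[OF m(2) u(1)[OF that]] u(2)[OF that]
      by (simp add: compose_def)
  qed
  then show ?thesis
    using that m(1) g(1) by blast
qed

text \<open>Injectivity half: maps out of \<open>P\<close> are determined on generators, and the
  countably many equalities of their germs hold at one stage.\<close>

lemma factor_unique:
  assumes g: "i \<in> I" "g \<in> linear_maps R P (D i)" and g': "j \<in> I" "g' \<in> linear_maps R P (D j)"
    and eq: "compose (carrier P) (c i) g = compose (carrier P) (c j) g'"
  obtains k where "(i, k) \<in> r" "(j, k) \<in> r" "compose (carrier P) (t i k) g = compose (carrier P) (t j k) g'"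
proof -
  have cl: "g (\<eta> x) \<in> carrier (D i)" "g' (\<eta> x) \<in> carrier (D j)" if "x \<in> generators Q" for x
    using presents_closed(3)[OF pres that] linear_maps_closed[OF g(2)] linear_maps_closed[OF g'(2)] by auto
  have "\<exists>k. (i, k) \<in> r \<and> (j, k) \<in> r \<and> t i k (g (\<eta> x)) = t j k (g' (\<eta> x))" if x: "x \<in> generators Q" for x
  proof -
    have "c i (g (\<eta> x)) = c j (g' (\<eta> x))"
      using fun_cong[OF eq, of "\<eta> x"] presents_closed(3)[OF pres x] by (simp add: compose_def)
    then show ?thesis
      using M.merge1[OF g(1) g'(1) cl[OF x]] by blast
  qed
  then obtain k where k: "\<And>x. x \<in> generators Q \<Longrightarrow>
      (i, k x) \<in> r \<and> (j, k x) \<in> r \<and> t i (k x) (g (\<eta> x)) = t j (k x) (g' (\<eta> x))"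
    by metis
  have "\<exists>m\<in>I. \<forall>l\<in>insert i (insert j (k ` generators Q)). (l, m) \<in> r"
    using k r_Ob(2) g(1) g'(1) countable_generators[OF countable] by (intro upper_bound) auto
  then obtain m where m: "m \<in> I" "(i, m) \<in> r" "(j, m) \<in> r" "\<And>x. x \<in> generators Q \<Longrightarrow> (k x, m) \<in> r"
    by blast
  have "t i m (g (\<eta> x)) = t j m (g' (\<eta> x))" if x: "x \<in> generators Q" for x
    using t_trans[of i "k x" m "g (\<eta> x)"] t_trans[of j "k x" m "g' (\<eta> x)"] k[OF x] m(4)[OF x] cl[OF x] by simp
  then have "compose (carrier P) (t i m) g = compose (carrier P) (t j m) g'"
    using presents_closed(3)[OF pres]
    by (intro presents_eqI[OF pres D_Ob[OF m(1)] scal linear_maps_compose[OF P_mod g(2) t_linear[OF m(2)]]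
        linear_maps_compose[OF P_mod g'(2) t_linear[OF m(3)]]]) (simp_all add: compose_def)
  then show ?thesis
    using that m(2,3) by blast
qed

text \<open>A map from \<open>P\<close> to \<open>K\<close> is sent to the value of the cocone at a
  chosen factorization. \<open>factor\<close> provides one, and by \<open>factor_unique\<close> the
  choice does not affect the value.\<close>

lemma hom_colimit:
  "is_colimit (poset_cat I r) set_cat (\<lambda>i. linear_maps R P (D i))
    (\<lambda>i j u. hom_map (Mod \<kappa> R) P (D i) (D j) (Dm i j u))
    (linear_maps R P K) (\<lambda>i. hom_map (Mod \<kappa> R) P (D i) K (c i))"
proof -
  have Hom: "u \<in> Hom (poset_cat I r) i j \<longleftrightarrow> (i, j) \<in> r" for i j u
    by (simp add: poset_cat_def)
  have hom_map: "hom_map (Mod \<kappa> R) P A B g = (\<lambda>f\<in>linear_maps R P A. compose (carrier P) g f)" for A B g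
    by (simp add: hom_map_def)
  have cf: "compose (carrier P) (c i) f \<in> linear_maps R P K" if "i \<in> I" "f \<in> linear_maps R P (D i)" for i f
    using that c_linear by (intro linear_maps_compose[OF P_mod])
  have tf: "compose (carrier P) (t i j) f \<in> linear_maps R P (D j)"
    if "(i, j) \<in> r" "f \<in> linear_maps R P (D i)" for i j f
    using that t_linear by (intro linear_maps_compose[OF P_mod])
  have ctf: "compose (carrier P) (c j) (compose (carrier P) (t i j) f) = compose (carrier P) (c i) f"
    if "(i, j) \<in> r" "f \<in> linear_maps R P (D i)" for i j f
    using that M.q_t[OF that(1)] linear_maps_closed[OF that(2)] by (simp add: compose_def fun_eq_iff)
  show ?thesis
    unfolding is_colimit_def
  proof (intro conjI allI impI)
    show "is_cocone (poset_cat I r) set_cat (\<lambda>i. linear_maps R P (D i))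
      (\<lambda>i j u. hom_map (Mod \<kappa> R) P (D i) (D j) (Dm i j u))
      (linear_maps R P K) (\<lambda>i. hom_map (Mod \<kappa> R) P (D i) K (c i))"
      unfolding is_cocone_def hom_map Ob_poset_cat Hom
    proof (intro conjI ballI)
      show "linear_maps R P K \<in> Ob set_cat"
        by (simp add: set_cat_def)
      show "(\<lambda>f\<in>linear_maps R P (D i). compose (carrier P) (c i) f)
          \<in> Hom set_cat (linear_maps R P (D i)) (linear_maps R P K)" if "i \<in> I" for i
        using cf[OF that] by (simp add: set_cat_def)
      fix i j u assume "u \<in> Hom (poset_cat I r) i j"
      then have ij: "(i, j) \<in> r"
        by (simp add: Hom)
      show "Comp set_cat (linear_maps R P (D i)) (linear_maps R P (D j)) (linear_maps R P K)
          (\<lambda>f\<in>linear_maps R P (D j). compose (carrier P) (c j) f)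
          (\<lambda>f\<in>linear_maps R P (D i). compose (carrier P) (Dm i j u) f) =
        (\<lambda>f\<in>linear_maps R P (D i). compose (carrier P) (c i) f)"
        by (rule ext) (simp add: set_cat_def compose_def[of "linear_maps R P (D i)"] tf[OF ij] ctf[OF ij])
    qed
  next
    fix N d
    assume "is_cocone (poset_cat I r) set_cat (\<lambda>i. linear_maps R P (D i))
      (\<lambda>i j u. hom_map (Mod \<kappa> R) P (D i) (D j) (Dm i j u)) N d"
    then have d: "\<And>i. i \<in> I \<Longrightarrow> d i \<in> linear_maps R P (D i) \<rightarrow>\<^sub>E N"
      and d_eq: "\<And>i j. i \<in> I \<Longrightarrow> j \<in> I \<Longrightarrow> (i, j) \<in> r \<Longrightarrow> compose (linear_maps R P (D i)) (d j)
        (\<lambda>f\<in>linear_maps R P (D i). compose (carrier P) (t i j) f) = d i"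
      unfolding is_cocone_def hom_map Ob_poset_cat Hom by (simp_all add: set_cat_def Hom)
    have dt: "d j (compose (carrier P) (t i j) f) = d i f"
      if "(i, j) \<in> r" "f \<in> linear_maps R P (D i)" for i j f
      using fun_cong[OF d_eq[OF r_Ob[OF that(1)] that(1)], of f] that(2)
      by (simp add: compose_def[of "linear_maps R P (D i)"])
    have d_unique: "d i g = d j g'"
      if g: "i \<in> I" "g \<in> linear_maps R P (D i)" and g': "j \<in> I" "g' \<in> linear_maps R P (D j)"
        and eq: "compose (carrier P) (c i) g = compose (carrier P) (c j) g'" for i j g g'
    proof -
      obtain k where "(i, k) \<in> r" "(j, k) \<in> r" "compose (carrier P) (t i k) g = compose (carrier P) (t j k) g'"
        using factor_unique[OF g g' eq] .
      then show ?thesis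
        using dt[of i k g] dt[of j k g'] g(2) g'(2) by simp
    qed
    have "\<exists>i g. i \<in> I \<and> g \<in> linear_maps R P (D i) \<and> compose (carrier P) (c i) g = f"
      if "f \<in> linear_maps R P K" for f
      using factor[OF that] by metis
    then obtain i g where ig: "\<And>f. f \<in> linear_maps R P K \<Longrightarrow>
        i f \<in> I \<and> g f \<in> linear_maps R P (D (i f)) \<and> compose (carrier P) (c (i f)) (g f) = f"
      by metis
    define h where "h = (\<lambda>f\<in>linear_maps R P K. d (i f) (g f))"
    have h: "h (compose (carrier P) (c j) f) = d j f" if "j \<in> I" "f \<in> linear_maps R P (D j)" for j f
    proof -
      let ?f = "compose (carrier P) (c j) f"
      note ig' = ig[OF cf[OF that]]
      have "d (i ?f) (g ?f) = d j f"
        by (rule d_unique[OF _ _ that]) (use ig' in blast)+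
      then show ?thesis
        by (simp add: h_def cf[OF that])
    qed
    have iff: "Comp set_cat (linear_maps R P (D j)) (linear_maps R P K) N k (hom_map (Mod \<kappa> R) P (D j) K (c j)) = d j \<longleftrightarrow>
        (\<forall>f\<in>linear_maps R P (D j). k (compose (carrier P) (c j) f) = d j f)" if "j \<in> I" for j k
    proof -
      have "Comp set_cat (linear_maps R P (D j)) (linear_maps R P K) N k (hom_map (Mod \<kappa> R) P (D j) K (c j)) =
          compose (linear_maps R P (D j)) k (\<lambda>f\<in>linear_maps R P (D j). compose (carrier P) (c j) f)"
        by (simp add: hom_map set_cat_def)
      then show ?thesis
        by (simp only: compose_eq_iff[OF d[OF that]] restrict_apply' cong: ball_cong)
    qed
    show "\<exists>!h. h \<in> Hom set_cat (linear_maps R P K) N \<and>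
        (\<forall>j\<in>Ob (poset_cat I r). Comp set_cat (linear_maps R P (D j)) (linear_maps R P K) N h
          (hom_map (Mod \<kappa> R) P (D j) K (c j)) = d j)"
    proof (rule ex1I[of _ h])
      have "h f \<in> N" if "f \<in> linear_maps R P K" for f
        using ig[OF that] d[of "i f"] that by (auto simp: h_def)
      then have "h \<in> linear_maps R P K \<rightarrow>\<^sub>E N"
        by (auto simp: h_def)
      then show "h \<in> Hom set_cat (linear_maps R P K) N \<and>
        (\<forall>j\<in>Ob (poset_cat I r). Comp set_cat (linear_maps R P (D j)) (linear_maps R P K) N h
          (hom_map (Mod \<kappa> R) P (D j) K (c j)) = d j)"
        using h by (simp add: iff Ob_poset_cat) (simp add: set_cat_def)
      fix k
      assume "k \<in> Hom set_cat (linear_maps R P K) N \<and>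
        (\<forall>j\<in>Ob (poset_cat I r). Comp set_cat (linear_maps R P (D j)) (linear_maps R P K) N k
          (hom_map (Mod \<kappa> R) P (D j) K (c j)) = d j)"
      then have k: "k \<in> linear_maps R P K \<rightarrow>\<^sub>E N"
        and kd: "\<And>j f. j \<in> I \<Longrightarrow> f \<in> linear_maps R P (D j) \<Longrightarrow> k (compose (carrier P) (c j) f) = d j f"
        by (simp_all add: iff Ob_poset_cat) (simp add: set_cat_def)
      show "k = h"
      proof (rule PiE_ext[OF k])
        show "h \<in> linear_maps R P K \<rightarrow>\<^sub>E N"
          by fact
        show "k f = h f" if "f \<in> linear_maps R P K" for f
          using kd[of "i f" "g f"] ig[OF that] that by (simp add: h_def)
      qed
    qed
  qed
qed

end

theorem presentable_if_countably_presented: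
  fixes \<kappa> :: "'u rel" and R :: "('r, 'z) sigma_sring_scheme"
  assumes "universe \<kappa>" "sigma_semiring R" "presents \<kappa> R Q P \<eta>" "countable Q"
    and "\<And>\<phi>. \<phi> \<in> Q \<Longrightarrow> scalars \<phi> \<subseteq> carrier R"
  shows "presentable \<kappa> aleph_1 (Mod \<kappa> R) P"
  unfolding presentable_def
proof (intro conjI allI impI; (elim conjE)?)
  show "P \<in> Ob (Mod \<kappa> R)"
    using presents_closed(1)[OF assms(3)] .
  fix I :: "'u set" and r Do Dm L c
  assume "directed_poset \<kappa> aleph_1 I r" "is_functor (poset_cat I r) (Mod \<kappa> R) Do Dm"
    "is_colimit (poset_cat I r) (Mod \<kappa> R) Do Dm L c"
  then interpret presented_in_colimit \<kappa> R I r Do Dm Q P \<eta> L c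
    using assms by (intro presented_in_colimit.intro directed_diagram.intro presented_in_colimit_axioms.intro)
  show "is_colimit (poset_cat I r) set_cat (\<lambda>i. Hom (Mod \<kappa> R) P (Do i))
      (\<lambda>i j u. hom_map (Mod \<kappa> R) P (Do i) (Do j) (Dm i j u))
      (Hom (Mod \<kappa> R) P L) (\<lambda>i. hom_map (Mod \<kappa> R) P (Do i) L (c i))"
    using hom_colimit by simp
qed


section \<open>Modules as colimits of countably presented modules\<close>

lemma category_poset_cat:
  assumes "partial_order_on I r"
  shows "category (poset_cat I r)"
  using assms
  by unfold_locales (auto simp: poset_cat_def partial_order_on_def preorder_on_def split: if_splits
      dest: refl_onD transD)

text \<open>The full table of sums and multiples of \<open>M\<close>, with its elements as
  generators. Its subsets are presentations over \<open>M\<close>, the identity being the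
  tautological interpretation.\<close>

definition true_facts :: "('r, 'z) sigma_sring_scheme \<Rightarrow> ('r, 'a) rmod \<Rightarrow> ('r, 'a) fact set" where
  "true_facts R M = {\<phi> \<in> facts_over (carrier R) (carrier M). holds M id \<phi>}"

lemma id_interps: "Q \<subseteq> true_facts R M \<Longrightarrow> id \<in> interps M Q"
  by (force simp: true_facts_def interps_def generators_def facts_over_def)

lemma true_facts_scalars: "Q \<subseteq> true_facts R M \<Longrightarrow> \<phi> \<in> Q \<Longrightarrow> scalars \<phi> \<subseteq> carrier R"
  by (auto simp: true_facts_def facts_over_def)

text \<open>Sum facts and action facts are the two linearity conditions; preservation of zero is the
  action fact for scalar zero.\<close>

lemma linear_maps_from_facts:
  assumes M: "r_module R M" and N: "r_module R N"
    and h: "\<And>x. x \<in> carrier M \<Longrightarrow> h x \<in> carrier N"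
    and holds: "\<And>\<phi>. \<phi> \<in> true_facts R M \<Longrightarrow> holds N h \<phi>"
  shows "restrict h (carrier M) \<in> linear_maps R M N"
proof -
  interpret M: r_module R M by fact
  interpret N: r_module R N by fact
  have act: "h (act M r x) = act N r (h x)" if "r \<in> carrier R" "x \<in> carrier M" for r x
    using holds[of "ActF r x (act M r x)"] that M.act_closed by (simp add: true_facts_def facts_over_def)
  show ?thesis
  proof (rule linear_mapsI)
    show "h (zero M) = zero N"
      using act[OF M.R.zero_closed M.zero_closed] M.act_zero_left[OF M.zero_closed]
        N.act_zero_left[OF h[OF M.zero_closed]] by simp
    show "v \<in> carrier M \<and> Sums N (\<lambda>n. h (x n)) = Some (h v)"
      if x: "\<And>n. x n \<in> carrier M" and v: "Sums M x = Some v" for x v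
    proof -
      have vM: "v \<in> carrier M"
        by (rule M.Sums_closed[OF x v])
      then have "SumF x v \<in> true_facts R M"
        using x v by (auto simp: true_facts_def facts_over_def)
      from holds[OF this] vM show ?thesis
        by simp
    qed
  qed (use h act M.zero_closed M.act_closed in auto)
qed

text \<open>Each element and each fact of \<open>M\<close> already occurs in a singleton of facts. A
  cocone therefore determines a map on elements, and its linearity is checked one fact at a time.
  Countable unions of countable sets of facts give directedness.\<close>

theorem countably_presented_colimit:
  fixes \<kappa> :: "'u rel" and R :: "('r, 'z) sigma_sring_scheme" and M :: "('r, 'u) rmod"
  assumes univ: "universe \<kappa>" and smallR: "small \<kappa> (carrier R)"
    and M: "M \<in> Ob (Mod \<kappa> R)"
    and G: "\<And>Q. Q \<subseteq> true_facts R M \<Longrightarrow> countable Q \<Longrightarrow> \<exists>L\<in>G. \<exists>\<eta>. presents \<kappa> R Q L \<eta>"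
  shows "\<exists>(I :: 'u set) r Do Dm c.
           directed_poset \<kappa> aleph_1 I r \<and> is_functor (poset_cat I r) (Mod \<kappa> R) Do Dm \<and>
           (\<forall>i\<in>I. Do i \<in> G) \<and> is_colimit (poset_cat I r) (Mod \<kappa> R) Do Dm M c"
proof -
  interpret M: r_module R M
    using M by simp
  define S where "S = {Q. Q \<subseteq> true_facts R M \<and> countable Q}"
  have "small \<kappa> (facts_over (carrier R) (carrier M))"
    using M by (intro small_facts_over univ smallR) simp
  then have "small \<kappa> (true_facts R M)"
    by (rule small_subset) (auto simp: true_facts_def)
  then have smallS: "small \<kappa> S"
    unfolding S_def by (rule small_countable_subsets[OF univ])
  \<comment> \<open>The index poset must consist of elements of \<open>'u\<close>, so sets of facts
    are replaced by codes, with \<Phi> decoding them.\<close>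
  then obtain e :: "('r, 'u) fact set \<Rightarrow> 'u" where e: "inj_on e S"
    by (rule small_bij_copy)
  have "\<forall>Q\<in>S. \<exists>L \<eta>. L \<in> G \<and> presents \<kappa> R Q L \<eta>"
    using G unfolding S_def by blast
  then obtain L \<eta> where LG: "\<And>Q. Q \<in> S \<Longrightarrow> L Q \<in> G" and pres: "\<And>Q. Q \<in> S \<Longrightarrow> presents \<kappa> R Q (L Q) (\<eta> Q)"
    by metis
  have scal: "scalars \<phi> \<subseteq> carrier R" if "Q \<in> S" "\<phi> \<in> Q" for Q \<phi>
    using that true_facts_scalars[of Q] by (auto simp: S_def)
  have L_Ob: "L Q \<in> Ob (Mod \<kappa> R)" if "Q \<in> S" for Q
    using presents_closed(1)[OF pres[OF that]] .
  have L_mod: "r_module R (L Q)" if "Q \<in> S" for Q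
    using L_Ob[OF that] by simp
  have \<eta>: "\<eta> Q x \<in> carrier (L Q)" if "Q \<in> S" "x \<in> generators Q" for Q x
    using presents_closed(3)[OF pres[OF that(1)] that(2)] .
  have gen_mono: "generators Q \<subseteq> generators Q'" if "Q \<subseteq> Q'" for Q Q' :: "('r, 'u) fact set"
    using that by (auto simp: generators_def)
  \<comment> \<open>A smaller set of facts has more interpretations, so the universal element of
    \<open>Q'\<close> also interprets \<open>Q\<close>.\<close>
  have "\<exists>h. h \<in> linear_maps R (L Q) (L Q') \<and> (\<forall>x\<in>generators Q. h (\<eta> Q x) = \<eta> Q' x)"
    if "Q \<in> S" "Q' \<in> S" "Q \<subseteq> Q'" for Q Q'
  proof -
    have "\<eta> Q' \<in> interps (L Q') Q"
      using presents_closed(2)[OF pres[OF that(2)]] interps_mono[OF that(3)] by blast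
    then show ?thesis
      using presents_lift[OF pres[OF that(1)] L_Ob[OF that(2)]] by metis
  qed
  then obtain t where t: "\<And>Q Q'. Q \<in> S \<Longrightarrow> Q' \<in> S \<Longrightarrow> Q \<subseteq> Q' \<Longrightarrow> t Q Q' \<in> linear_maps R (L Q) (L Q')"
      and t\<eta>: "\<And>Q Q' x. Q \<in> S \<Longrightarrow> Q' \<in> S \<Longrightarrow> Q \<subseteq> Q' \<Longrightarrow> x \<in> generators Q \<Longrightarrow> t Q Q' (\<eta> Q x) = \<eta> Q' x"
    by metis
  have "\<exists>h. h \<in> linear_maps R (L Q) M \<and> (\<forall>x\<in>generators Q. h (\<eta> Q x) = x)" if "Q \<in> S" for Q
  proof -
    have "id \<in> interps M Q"
      using that by (intro id_interps[of Q R]) (simp add: S_def)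
    then show ?thesis
      using presents_lift[OF pres[OF that] M] by (metis id_apply)
  qed
  then obtain c where c: "\<And>Q. Q \<in> S \<Longrightarrow> c Q \<in> linear_maps R (L Q) M"
      and c\<eta>: "\<And>Q x. Q \<in> S \<Longrightarrow> x \<in> generators Q \<Longrightarrow> c Q (\<eta> Q x) = x"
    by metis

  define I where "I = e ` S"
  define \<Phi> where "\<Phi> = inv_into S e"
  define r where "r = {(i, j). i \<in> I \<and> j \<in> I \<and> \<Phi> i \<subseteq> \<Phi> j}"
  have \<Phi>: "\<Phi> i \<in> S" if "i \<in> I" for i
    using that by (auto simp: I_def \<Phi>_def inv_into_into)
  have eI: "e Q \<in> I" "\<Phi> (e Q) = Q" if "Q \<in> S" for Q
    using that e by (simp_all add: I_def \<Phi>_def)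
  have \<Phi>_inj: "i = j" if "i \<in> I" "j \<in> I" "\<Phi> i = \<Phi> j" for i j
    using that inv_into_injective[of S e i j] by (simp add: I_def \<Phi>_def)
  have rD: "i \<in> I" "j \<in> I" "\<Phi> i \<in> S" "\<Phi> j \<in> S" "\<Phi> i \<subseteq> \<Phi> j" if "(i, j) \<in> r" for i j
    using that \<Phi> by (auto simp: r_def)
  have po: "partial_order_on I r"
    using \<Phi>_inj by (auto simp: partial_order_on_def preorder_on_def r_def refl_on_def trans_def antisym_def)
  have dir: "directed_poset \<kappa> aleph_1 I r"
    unfolding directed_poset_def countable_iff_ordLess_aleph_1[symmetric]
  proof (intro conjI allI impI po)
    show "small \<kappa> I"
      unfolding I_def by (rule small_image[OF smallS])
    fix X assume X: "X \<subseteq> I" "countable X"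
    define U where "U = (\<Union>i\<in>X. \<Phi> i)"
    have U: "U \<in> S"
      unfolding S_def
    proof (intro CollectI conjI)
      show "U \<subseteq> true_facts R M"
        using \<Phi> X(1) by (auto simp: U_def S_def)
      show "countable U"
        unfolding U_def using \<Phi> X by (intro countable_UN) (auto simp: S_def)
    qed
    have "(x, e U) \<in> r" if "x \<in> X" for x
      using that X(1) eI[OF U] by (auto simp: r_def U_def)
    then show "\<exists>u\<in>I. \<forall>x\<in>X. (x, u) \<in> r"
      using eI(1)[OF U] by blast
  qed
  define Do where "Do = (\<lambda>i. L (\<Phi> i))"
  define Dm :: "'u \<Rightarrow> 'u \<Rightarrow> unit \<Rightarrow> 'u \<Rightarrow> 'u" where "Dm = (\<lambda>i j _. t (\<Phi> i) (\<Phi> j))"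
  have Hom: "u \<in> Hom (poset_cat I r) i j \<longleftrightarrow> (i, j) \<in> r" for i j u
    by (simp add: poset_cat_def)
  have func: "is_functor (poset_cat I r) (Mod \<kappa> R) Do Dm"
    unfolding is_functor_def Ob_poset_cat Hom Dm_def Do_def
  proof (intro conjI ballI)
    show "category (poset_cat I r)"
      by (rule category_poset_cat[OF po])
    show "category (Mod \<kappa> R)"
      by (rule category_Mod)
    show "L (\<Phi> i) \<in> Ob (Mod \<kappa> R)" if "i \<in> I" for i
      using L_Ob[OF \<Phi>[OF that]] .
    show "t (\<Phi> i) (\<Phi> j) \<in> Hom (Mod \<kappa> R) (L (\<Phi> i)) (L (\<Phi> j))"
      if "u \<in> Hom (poset_cat I r) i j" for i j u
      using that t rD by (simp add: Hom)
    show "t (\<Phi> i) (\<Phi> i) = Id (Mod \<kappa> R) (L (\<Phi> i))" if "i \<in> I" for i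
    proof -
      note Q = \<Phi>[OF that]
      have "t (\<Phi> i) (\<Phi> i) = (\<lambda>x\<in>carrier (L (\<Phi> i)). x)"
        by (rule presents_eqI[OF pres[OF Q] L_Ob[OF Q] scal[OF Q] t[OF Q Q subset_refl]
              linear_maps_id[OF L_mod[OF Q]]])
          (simp_all add: t\<eta>[OF Q Q subset_refl] \<eta>[OF Q])
      then show ?thesis
        by simp
    qed
    fix i j k u v assume "u \<in> Hom (poset_cat I r) i j" and "v \<in> Hom (poset_cat I r) j k"
    then have ij: "(i, j) \<in> r" and jk: "(j, k) \<in> r"
      by (simp_all add: Hom)
    note Q = rD(3-5)[OF ij] rD(4,5)[OF jk]
    have ik: "\<Phi> i \<subseteq> \<Phi> k"
      using Q by blast
    have "t (\<Phi> i) (\<Phi> k) = compose (carrier (L (\<Phi> i))) (t (\<Phi> j) (\<Phi> k)) (t (\<Phi> i) (\<Phi> j))"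
    proof (rule presents_eqI[OF pres[OF Q(1)] L_Ob[OF Q(4)] scal[OF Q(1)] t[OF Q(1,4) ik]
            linear_maps_compose[OF L_mod[OF Q(1)] t[OF Q(1-3)] t[OF Q(2,4,5)]]])
      fix x assume x: "x \<in> generators (\<Phi> i)"
      then have "x \<in> generators (\<Phi> j)"
        using gen_mono[OF Q(3)] by blast
      then show "t (\<Phi> i) (\<Phi> k) (\<eta> (\<Phi> i) x) =
          compose (carrier (L (\<Phi> i))) (t (\<Phi> j) (\<Phi> k)) (t (\<Phi> i) (\<Phi> j)) (\<eta> (\<Phi> i) x)"
        using x \<eta>[OF Q(1) x] t\<eta>[OF Q(1-3) x] t\<eta>[OF Q(2,4,5)] t\<eta>[OF Q(1,4) ik x] by (simp add: compose_def)
    qed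
    then show "t (\<Phi> i) (\<Phi> k) = Comp (Mod \<kappa> R) (L (\<Phi> i)) (L (\<Phi> j)) (L (\<Phi> k)) (t (\<Phi> j) (\<Phi> k)) (t (\<Phi> i) (\<Phi> j))"
      by simp
  qed
  have colim: "is_colimit (poset_cat I r) (Mod \<kappa> R) Do Dm M (\<lambda>i. c (\<Phi> i))"
    unfolding is_colimit_def
  proof (intro conjI allI impI)
    show "is_cocone (poset_cat I r) (Mod \<kappa> R) Do Dm M (\<lambda>i. c (\<Phi> i))"
      unfolding is_cocone_def Ob_poset_cat Hom Dm_def Do_def
    proof (intro conjI ballI M)
      show "c (\<Phi> i) \<in> Hom (Mod \<kappa> R) (L (\<Phi> i)) M" if "i \<in> I" for i
        using c[OF \<Phi>[OF that]] by simp
      fix i j u assume "u \<in> Hom (poset_cat I r) i j"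
      then have "(i, j) \<in> r"
        by (simp add: Hom)
      note Q = rD(3-5)[OF this]
      have "compose (carrier (L (\<Phi> i))) (c (\<Phi> j)) (t (\<Phi> i) (\<Phi> j)) = c (\<Phi> i)"
      proof (rule presents_eqI[OF pres[OF Q(1)] M scal[OF Q(1)]
              linear_maps_compose[OF L_mod[OF Q(1)] t[OF Q] c[OF Q(2)]] c[OF Q(1)]])
        fix x assume x: "x \<in> generators (\<Phi> i)"
        then have "x \<in> generators (\<Phi> j)"
          using gen_mono[OF Q(3)] by blast
        then show "compose (carrier (L (\<Phi> i))) (c (\<Phi> j)) (t (\<Phi> i) (\<Phi> j)) (\<eta> (\<Phi> i) x) = c (\<Phi> i) (\<eta> (\<Phi> i) x)"
          using x \<eta>[OF Q(1) x] t\<eta>[OF Q x] c\<eta>[OF Q(1) x] c\<eta>[OF Q(2)] by (simp add: compose_def)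
      qed
      then show "Comp (Mod \<kappa> R) (L (\<Phi> i)) (L (\<Phi> j)) M (c (\<Phi> j)) (t (\<Phi> i) (\<Phi> j)) = c (\<Phi> i)"
        by simp
    qed
    fix N d assume "is_cocone (poset_cat I r) (Mod \<kappa> R) Do Dm N d"
    note cocone = this[unfolded is_cocone_def Ob_poset_cat Dm_def Do_def]
    have N: "N \<in> Ob (Mod \<kappa> R)"
      using cocone by blast
    define d' where "d' = (\<lambda>Q. d (e Q))"
    have d': "d' Q \<in> linear_maps R (L Q) N" if "Q \<in> S" for Q
      using cocone eI[OF that] by (auto simp: d'_def)
    have dt: "d' Q' (t Q Q' y) = d' Q y" if QQ': "Q \<in> S" "Q' \<in> S" "Q \<subseteq> Q'" and y: "y \<in> carrier (L Q)" for Q Q' y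
    proof -
      have "() \<in> Hom (poset_cat I r) (e Q) (e Q')"
        unfolding Hom using eI QQ' by (simp add: r_def)
      then have "Comp (Mod \<kappa> R) (L (\<Phi> (e Q))) (L (\<Phi> (e Q'))) N (d (e Q')) (t (\<Phi> (e Q)) (\<Phi> (e Q'))) = d (e Q)"
        using cocone eI(1)[OF QQ'(1)] eI(1)[OF QQ'(2)] by blast
      then have "compose (carrier (L Q)) (d' Q') (t Q Q') = d' Q"
        by (simp add: eI QQ' d'_def)
      from fun_cong[OF this, of y] y show ?thesis
        by (simp add: compose_def)
    qed
    \<comment> \<open>The tautology \<open>1 x = x\<close> is a true fact with \<open>x\<close> as
      its only generator, so it makes \<open>x\<close> available in the diagram.\<close>
    define gen where "gen = (\<lambda>x. {ActF (one R) x x :: ('r, 'u) fact})"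
    have gen: "gen x \<in> S" "x \<in> generators (gen x)" if "x \<in> carrier M" for x
      using that M.R.one_closed M.act_one
      by (auto simp: gen_def S_def true_facts_def facts_over_def generators_def)
    define h where "h = (\<lambda>x. d' (gen x) (\<eta> (gen x) x))"
    have h: "h x = d' Q (\<eta> Q x)" if Q: "Q \<in> S" and x: "x \<in> generators Q" for Q x
    proof -
      have xM: "x \<in> carrier M"
        using id_interps[of Q R M] Q x by (auto simp: S_def interps_def)
      \<comment> \<open>The union lies above both \<open>Q\<close> and \<open>gen x\<close>;
        compatibility of the cocone along the two inclusions shows that \<open>h\<close> does not
        depend on the set from which \<open>x\<close> is read.\<close>
      have U: "Q \<union> gen x \<in> S"
        using Q gen(1)[OF xM] by (simp add: S_def)
      have "d' Q (\<eta> Q x) = d' (Q \<union> gen x) (\<eta> (Q \<union> gen x) x)"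
        using dt[OF Q U _ \<eta>[OF Q x]] t\<eta>[OF Q U _ x] by simp
      also have "\<dots> = h x"
        using dt[OF gen(1)[OF xM] U _ \<eta>[OF gen[OF xM]]] t\<eta>[OF gen(1)[OF xM] U _ gen(2)[OF xM]]
        by (simp add: h_def)
      finally show ?thesis
        by simp
    qed
    have h_lin: "restrict h (carrier M) \<in> linear_maps R M N"
    proof (rule linear_maps_from_facts)
      show "r_module R M" "r_module R N"
        using M N by simp_all
      show "h x \<in> carrier N" if "x \<in> carrier M" for x
        using linear_maps_closed[OF d'[OF gen(1)[OF that]]] \<eta>[OF gen[OF that]] by (simp add: h_def)
      fix \<phi> assume "\<phi> \<in> true_facts R M"
      \<comment> \<open>The fact holds in its own presentation, and the leg of the cocone there
        carries it to \<open>N\<close>.\<close>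
      then have Q: "{\<phi>} \<in> S"
        by (simp add: S_def)
      have "(\<lambda>x. d' {\<phi>} (\<eta> {\<phi>} x)) \<in> interps N {\<phi>}"
        by (rule interps_linear[OF presents_closed(2)[OF pres[OF Q]] d'[OF Q] scal[OF Q]])
      then show "holds N h \<phi>"
        using holds_cong[of \<phi> h "\<lambda>x. d' {\<phi>} (\<eta> {\<phi>} x)" N] h[OF Q]
        by (simp add: interps_def generators_def)
    qed
    have hM: "x \<in> carrier M" if "Q \<in> S" "x \<in> generators Q" for Q x
      using linear_maps_closed[OF c[OF that(1)] \<eta>[OF that]] c\<eta>[OF that] by simp
    have hc: "compose (carrier (L Q)) (restrict h (carrier M)) (c Q) = d' Q" if Q: "Q \<in> S" for Q
      by (rule presents_eqI[OF pres[OF Q] N scal[OF Q] linear_maps_compose[OF L_mod[OF Q] c[OF Q] h_lin] d'[OF Q]])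
        (simp_all add: compose_def \<eta>[OF Q] c\<eta>[OF Q] hM[OF Q] h[OF Q])
    show "\<exists>!h. h \<in> Hom (Mod \<kappa> R) M N \<and>
        (\<forall>i\<in>Ob (poset_cat I r). Comp (Mod \<kappa> R) (Do i) M N h (c (\<Phi> i)) = d i)"
    proof (rule ex1I[of _ "restrict h (carrier M)"])
      have "d' (\<Phi> i) = d i" if "i \<in> I" for i
        using that by (simp add: d'_def \<Phi>_def I_def f_inv_into_f)
      then show "restrict h (carrier M) \<in> Hom (Mod \<kappa> R) M N \<and>
          (\<forall>i\<in>Ob (poset_cat I r). Comp (Mod \<kappa> R) (Do i) M N (restrict h (carrier M)) (c (\<Phi> i)) = d i)"
        using h_lin hc[OF \<Phi>] by (simp add: Ob_poset_cat Do_def)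
      fix k assume "k \<in> Hom (Mod \<kappa> R) M N \<and>
          (\<forall>i\<in>Ob (poset_cat I r). Comp (Mod \<kappa> R) (Do i) M N k (c (\<Phi> i)) = d i)"
      then have k: "k \<in> linear_maps R M N"
        and kc: "\<And>i. i \<in> I \<Longrightarrow> compose (carrier (L (\<Phi> i))) k (c (\<Phi> i)) = d i"
        by (simp_all add: Ob_poset_cat Do_def)
      show "k = restrict h (carrier M)"
      proof (rule linear_maps_eqI[OF k h_lin])
        fix x assume x: "x \<in> carrier M"
        have "compose (carrier (L (gen x))) k (c (gen x)) = d' (gen x)"
          using kc[OF eI(1)[OF gen(1)[OF x]]] by (simp add: eI gen(1)[OF x] d'_def)
        from fun_cong[OF this, of "\<eta> (gen x) x"] show "k x = restrict h (carrier M) x"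
          using x \<eta>[OF gen[OF x]] c\<eta>[OF gen[OF x]] by (simp add: compose_def h_def)
      qed
    qed
  qed
  have "\<forall>i\<in>I. Do i \<in> G"
    using LG \<Phi> by (simp add: Do_def)
  with dir func colim show ?thesis
    by blast
qed

section \<open>Small hom-sets and a small set of countable presentations\<close>

lemma locally_small_Mod:
  assumes "universe \<kappa>" "strong_limit \<kappa>"
  shows "locally_small \<kappa> (Mod \<kappa> R)"
  unfolding locally_small_def
proof (intro ballI)
  fix M N assume "M \<in> Ob (Mod \<kappa> R)" "N \<in> Ob (Mod \<kappa> R)"
  \<comment> \<open>Linear maps are recovered from their graphs. Carriers may be uncountable, so
    countable powers do not bound these and the strong limit property is used.\<close>
  then have "small \<kappa> (Pow (carrier M \<times> carrier N))"
    using assms by (intro small_Pow small_Sigma) simp_all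
  moreover have "(\<lambda>f. (\<lambda>x. (x, f x)) ` carrier M) ` linear_maps R M N \<subseteq> Pow (carrier M \<times> carrier N)"
    by (auto simp: linear_maps_closed)
  ultimately have "small \<kappa> ((\<lambda>f. (\<lambda>x. (x, f x)) ` carrier M) ` linear_maps R M N)"
    by (rule small_subset)
  moreover have "inj_on (\<lambda>f. (\<lambda>x. (x, f x)) ` carrier M) (linear_maps R M N)"
  proof (rule inj_onI)
    fix f g assume fg: "f \<in> linear_maps R M N" "g \<in> linear_maps R M N"
      and eq: "(\<lambda>x. (x, f x)) ` carrier M = (\<lambda>x. (x, g x)) ` carrier M"
    have "f x = g x" if "x \<in> carrier M" for x
    proof -
      have "(x, f x) \<in> (\<lambda>x. (x, g x)) ` carrier M"
        using that eq by blast
      then show ?thesis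
        by auto
    qed
    then show "f = g"
      by (rule linear_maps_eqI[OF fg])
  qed
  ultimately show "small \<kappa> (Hom (Mod \<kappa> R) M N)"
    by (auto intro: small_inj_on)
qed

theorem theorem4p1:
  fixes \<kappa> :: "'u rel" and R :: "'r sigma_sring"
  assumes "universe \<kappa>"
    and "sigma_semiring R"
    and "small \<kappa> (carrier R)"
  shows "locally_presentable \<kappa> aleph_1 (Mod \<kappa> R)"
proof -
  \<comment> \<open>Countable presentations on natural numbers; one module chosen for each of them
    gives the required set of presentable objects.\<close>
  let ?W = "{Q. Q \<subseteq> facts_over (carrier R) (UNIV :: nat set) \<and> countable Q}"
  have smallW: "small \<kappa> ?W"
    by (intro small_countable_subsets small_facts_over assms small_countable) simp_all
  have scal: "scalars \<phi> \<subseteq> carrier R" if "Q \<in> ?W" "\<phi> \<in> Q" for Q \<phi>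
    using that by (auto simp: facts_over_def)
  have "\<exists>L \<eta>. presents \<kappa> R Q L \<eta>" if "Q \<in> ?W" for Q
    using presents_exists[OF assms scal[OF that] small_countable[OF assms(1) countable_generators]] that
    by blast
  then obtain L \<eta> where L: "\<And>Q. Q \<in> ?W \<Longrightarrow> presents \<kappa> R Q (L Q) (\<eta> Q)"
    by metis
  have "\<exists>K\<in>L ` ?W. \<exists>\<eta>. presents \<kappa> R Q K \<eta>" if "Q \<subseteq> true_facts R M" "countable Q" for Q and M :: "('r, 'u) rmod"
  proof -
    \<comment> \<open>An enumeration of the countably many generators turns facts about elements of
      \<open>M\<close> into members of \<open>?W\<close>.\<close>
    let ?e = "to_nat_on (generators Q)"
    have "map_fact id ?e ` Q \<in> ?W"
      using that(2) true_facts_scalars[OF that(1)] unfolding facts_over_def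
      by (fastforce simp: fact.set_map)
    then show ?thesis
      using presents_rename[OF inj_on_to_nat_on[OF countable_generators[OF that(2)]] L] by blast
  qed
  then have "\<exists>(I :: 'u set) r Do Dm c.
      directed_poset \<kappa> aleph_1 I r \<and> is_functor (poset_cat I r) (Mod \<kappa> R) Do Dm \<and>
      (\<forall>i\<in>I. Do i \<in> L ` ?W) \<and> is_colimit (poset_cat I r) (Mod \<kappa> R) Do Dm M c"
    if "M \<in> Ob (Mod \<kappa> R)" for M
    using that by (intro countably_presented_colimit assms) blast+
  moreover have "presentable \<kappa> aleph_1 (Mod \<kappa> R) K" if K: "K \<in> L ` ?W" for K
  proof -
    obtain Q where Q: "Q \<in> ?W" "K = L Q"
      using K by (rule imageE) (rule that)
    then show ?thesis
      using presentable_if_countably_presented[OF assms(1,2) L[OF Q(1)] _ scal[OF Q(1)]] by simp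
  qed
  moreover have "small \<kappa> (L ` ?W)"
    by (rule small_image[OF smallW])
  ultimately show ?thesis
    unfolding locally_presentable_def
    using cocomplete_Mod[OF assms] locally_small_Mod[OF assms(1)]
    by (intro conjI impI exI[of _ "L ` ?W"] ballI) simp_all
qed

end
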